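(* Let $X=\mathbb R^n$ and $C=\mathbb R^{n-l}$ with $l\ge 2$. Then the cohomology of the complex $$\Big(\mathrm{Hom}_{\mathfrak g}\big(\Lambda^{\cdot}_{\mathfrak g}(\mathfrak g\otimes_{\mathfrak g_{\mathcal I+}}\Omega_{\mathfrak g_{\mathcal I+}}),\mathfrak g_{\mathcal I}\big),\ \delta^{1,1}\Big)$$ is concentrated in degree $0$.
   Context: $\mathbb K=\mathbb R$ or $\mathbb C$; $C=\{x\in\mathbb R^n:x''=0\}$, with coordinates $x=(x',x'')$, $x'=(x'_1,\dots,x'_{n-l})$, $x''=(x''_1,\dots,x''_l)$. $E=E'\oplus E''$ with $E=\mathbb K^n$, $E'=\mathbb K^{n-l}$ with basis $y'_\alpha$, $E''=\mathbb K^l$ with basis $y''_\mu$. $\mathfrak g=C^\infty(\mathbb R^n,\mathbb K)\otimes\Lambda E$ is the graded commutative algebra (under $\wedge$) of multivector fields on $\mathbb R^n$, with Schouten bracket $[\cdot,\cdot]_S$ on $\mathfrak g[1]$ (where $(\mathfrak h[j])^k=\mathfrak h^{j+k}$). $\tilde{\mathfrak g}=C^\infty(\mathbb R^{n-l},\mathbb K)\otimes\Lambda E''$, and $\mathfrak g_{\mathcal I}\subset\mathfrak g$ is the kernel of the natural projection $\mathfrak g\to\tilde{\mathfrak g}$ (restriction to $C$ and projection $\Lambda E\to\Lambda E''$), i.e. the ideal of $\mathfrak g$ generated by the $x''_\mu$ and the $y'_\alpha$; it consists of the multivector fields adapted to $C$ and is stable under $[\cdot,\cdot]_S$. $\mathfrak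 g_{\mathcal I+}=\mathbb K1\oplus\mathfrak g_{\mathcal I}$. $\Omega$ denotes the (continuous, graded) Kähler differentials. $\Omega^1_{\mathfrak g}$ is the free $\mathfrak g$-module on $\mathbf dx'_\alpha,\mathbf dx''_\mu,\mathbf dy'_\beta,\mathbf dy''_\nu$, and $\Omega^1_{\tilde{\mathfrak g}}$ is the free $\tilde{\mathfrak g}$-module on $\mathbf dx'_\alpha,\mathbf dy''_\nu$. The $\mathfrak g$-module $\mathfrak g\otimes_{\mathfrak g_{\mathcal I+}}\Omega_{\mathfrak g_{\mathcal I+}}$ is identified with $\mathrm{Ker}(\Omega^1_{\mathfrak g}\to\Omega^1_{\tilde{\mathfrak g}})$, the $\mathfrak g$-submodule of $\Omega^1_{\mathfrak g}$ generated by $\mathbf dx''_\mu,\ \mathbf dy'_\alpha,\ x''_\nu\mathbf dx'_\beta,\ y'_\gamma\mathbf dx'_{\gamma'},\ x''_\rho\mathbf dy''_\sigma,\ y'_{\gamma''}\mathbf dy''_\tau$. $\Omega^1_{\mathfrak g}$ carries the graded Lie bracket and action on $\mathfrak g$ determined by $[\mathbf d\xi,\mathbf d\eta]=\mathbf d[\xi,\eta]_S$ and $\mathbf d\xi.\eta=[\xi,\eta]_S$ (extended by the Leibniz rule), which restrict to $\mathfrak g\otimes_{\mathfrak g_{\mathcal I+}}\Omega_{\mathfrak g_{\mathcal I+}}$ acting on $\mathfrak g_{\mathcal I}$. Exterior powers $\Lambda_{\mathfrak g}^k$ are graded exterior powers over $\mathfrak g$ with antisymmetry taken relative to the degrees of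 $\mathfrak g[1]$. The differential $\delta^{1,1}$ is the graded Chevalley–Eilenberg differential $$(\delta^{1,1}\varphi)(A_0,\dots,A_k)=\sum_i\pm A_i.\varphi(\dots\widehat{A_i}\dots)+\sum_{i<j}\pm\varphi([A_i,A_j],\dots\widehat{A_i}\dots\widehat{A_j}\dots)$$ with the usual signs and Koszul signs; equivalently, identifying $\varphi$ with the multiderivation $(\xi_1,\dots,\xi_k)\mapsto\varphi(\mathbf d\xi_1,\dots,\mathbf d\xi_k)$, it is the Chevalley–Eilenberg differential of the graded Lie algebra $(\mathfrak g_{\mathcal I}[1],[\cdot,\cdot]_S)$ with values in the adjoint module. Only exterior powers with $k\ge1$ occur, and a cochain defined on $\Lambda^k_{\mathfrak g}$ has degree $k-1$. *)

theory Defs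
  imports "HOL-Analysis.Analysis" "HOL-Library.Function_Algebras"
begin

text \<open>
  The ambient space is \<open>real ^ 'n\<close>, so \<open>n = CARD('n)\<close>; the linear order on \<open>'n\<close> only serves to
  order the basis of the exterior algebra. A set \<open>N\<close> of indices (with \<open>l = card N\<close>) singles out
  the coordinates \<open>x''\<close>; the indices outside \<open>N\<close> are those of \<open>x'\<close>. Vector space structures on
  spaces of functions are pointwise (\<open>HOL-Library.Function_Algebras\<close>).
\<close>

section \<open>Smooth functions\<close>

definition pd :: "'n::finite \<Rightarrow> (real ^ 'n \<Rightarrow> 'k) \<Rightarrow> real ^ 'n \<Rightarrow> 'k::real_normed_vector" where
  "pd i f = (\<lambda>x. frechet_derivative f (at x) (axis i 1))"

primrec Ck :: "nat \<Rightarrow> (real ^ 'n \<Rightarrow> 'k::real_normed_vector) \<Rightarrow> bool" where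
  "Ck 0 f \<longleftrightarrow> continuous_on UNIV f"
| "Ck (Suc k) f \<longleftrightarrow> (\<forall>x. f differentiable (at x)) \<and> (\<forall>i. Ck k (pd i f))"

definition smooth :: "(real ^ 'n::finite \<Rightarrow> 'k::real_normed_vector) \<Rightarrow> bool" where
  "smooth f \<longleftrightarrow> (\<forall>k. Ck k f)"

section \<open>Multivector fields and the Schouten bracket\<close>

text \<open>\<open>\<xi> I\<close> is the coefficient of \<open>y\<^sub>i\<^sub>1 \<and> \<dots> \<and> y\<^sub>i\<^sub>p\<close>, where \<open>I = {i\<^sub>1 < \<dots> < i\<^sub>p}\<close>.\<close>
type_synonym ('n, 'k) mv = "'n set \<Rightarrow> real ^ 'n \<Rightarrow> 'k"

definition mvs :: "('n::finite, 'k::real_normed_field) mv set" where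
  "mvs = {\<xi>. \<forall>I. smooth (\<xi> I)}"

definition mv_degree :: "int \<Rightarrow> ('n::finite, 'k::real_normed_field) mv \<Rightarrow> bool" where
  "mv_degree m \<xi> \<longleftrightarrow> (\<forall>I. \<xi> I \<noteq> 0 \<longrightarrow> int (card I) = m)"

text \<open>\<open>koszul m v = (-1)\<^sup>m v\<close>\<close>
definition koszul :: "int \<Rightarrow> 'v::ab_group_add \<Rightarrow> 'v" where
  "koszul m v = (if even m then v else - v)"

definition wedge :: "('n::{finite,linorder}, 'k::real_normed_field) mv \<Rightarrow> ('n, 'k) mv \<Rightarrow> ('n, 'k) mv" where
  "wedge \<xi> \<eta> = (\<lambda>I x. \<Sum>J\<in>Pow I.
     koszul (int (card {(i, j). i \<in> J \<and> j \<in> I - J \<and> j < i})) (\<xi> J x * \<eta> (I - J) x))"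

definition dX :: "'n::finite \<Rightarrow> ('n, 'k::real_normed_field) mv \<Rightarrow> ('n, 'k) mv" where
  "dX i \<xi> = (\<lambda>I. pd i (\<xi> I))"

text \<open>Left and right derivative with respect to the odd coordinate \<open>y\<^sub>i\<close>.\<close>

definition dY_left :: "'n::{finite,linorder} \<Rightarrow> ('n, 'k::real_normed_field) mv \<Rightarrow> ('n, 'k) mv" where
  "dY_left i \<xi> = (\<lambda>I. if i \<in> I then 0 else koszul (int (card {j \<in> I. j < i})) (\<xi> (insert i I)))"

definition dY_right :: "'n::{finite,linorder} \<Rightarrow> ('n, 'k::real_normed_field) mv \<Rightarrow> ('n, 'k) mv" where
  "dY_right i \<xi> = (\<lambda>I. if i \<in> I then 0 else koszul (int (card {j \<in> I. i < j})) (\<xi> (insert i I)))"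

text \<open>
  Sign convention: the bracket is the commutator on vector fields, \<open>[X, f] = X f\<close>, and
  \<open>[\<xi>, \<eta> \<and> \<zeta>] = [\<xi>, \<eta>] \<and> \<zeta> + (-1)^((|\<xi>| - 1) |\<eta>|) \<eta> \<and> [\<xi>, \<zeta>]\<close>.
\<close>
definition schouten :: "('n::{finite,linorder}, 'k::real_normed_field) mv \<Rightarrow> ('n, 'k) mv \<Rightarrow> ('n, 'k) mv" where
  "schouten \<xi> \<eta> = (\<Sum>i\<in>UNIV. wedge (dY_right i \<xi>) (dX i \<eta>) - wedge (dX i \<xi>) (dY_left i \<eta>))"

section \<open>The submanifold and the multivector fields adapted to it\<close>

definition submfd :: "'n::finite set \<Rightarrow> (real ^ 'n) set" where
  "submfd N = {x. \<forall>i\<in>N. x $ i = 0}"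

text \<open>
  The projection onto the multivector algebra on the submanifold \<open>C\<close> with values in \<open>\<Lambda>E''\<close>. Its elements
  are coded as families of functions supported on \<open>C\<close>, indexed by the subsets of \<open>N\<close>
  (and zero at all other indices).
\<close>
definition proj_mv :: "'n::finite set \<Rightarrow> ('n, 'k::real_normed_field) mv \<Rightarrow> ('n, 'k) mv" where
  "proj_mv N \<xi> = (\<lambda>I x. if I \<subseteq> N \<and> x \<in> submfd N then \<xi> I x else 0)"

definition adapted :: "'n::finite set \<Rightarrow> ('n, 'k::real_normed_field) mv set" where
  "adapted N = {\<xi> \<in> mvs. proj_mv N \<xi> = 0}"

section \<open>Differentials\<close>

text \<open>
  \<open>A (Inl i)\<close> and \<open>A (Inr i)\<close> are the left coefficients of \<open>dx\<^sub>i\<close> and \<open>dy\<^sub>i\<close>, that is,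
  \<open>A = (\<Sum>c. A c \<^bold>d c)\<close>, with \<open>c\<close> running over the coordinates \<open>x\<^sub>i\<close>, \<open>y\<^sub>i\<close>.
\<close>
type_synonym ('n, 'k) form = "'n + 'n \<Rightarrow> ('n, 'k) mv"

definition coord :: "'n::finite + 'n \<Rightarrow> ('n, 'k::real_normed_field) mv" where
  "coord c = (case c of
     Inl i \<Rightarrow> (\<lambda>I x. if I = {} then of_real (x $ i) else 0)
   | Inr i \<Rightarrow> (\<lambda>I x. if I = {i} then 1 else 0))"

definition coord_degree :: "'n::finite + 'n \<Rightarrow> int" where
  "coord_degree c = (case c of Inl i \<Rightarrow> 0 | Inr i \<Rightarrow> 1)"

definition forms :: "('n::finite, 'k::real_normed_field) form set" where
  "forms = {A. \<forall>c. A c \<in> mvs}"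

definition form_degree :: "int \<Rightarrow> ('n::finite, 'k::real_normed_field) form \<Rightarrow> bool" where
  "form_degree p A \<longleftrightarrow> (\<forall>c I. A c I \<noteq> 0 \<longrightarrow> int (card I) + coord_degree c = p)"

definition form_part :: "int \<Rightarrow> ('n::finite, 'k::real_normed_field) form \<Rightarrow> ('n, 'k) form" where
  "form_part p A = (\<lambda>c I. if int (card I) + coord_degree c = p then A c I else 0)"

text \<open>All homogeneous parts of a form outside of the following degrees vanish.\<close>
abbreviation form_degrees :: "'n itself \<Rightarrow> int set" where
  "form_degrees _ \<equiv> {0..int CARD('n) + 1}"

definition fmult :: "('n::{finite,linorder}, 'k::real_normed_field) mv \<Rightarrow> ('n, 'k) form \<Rightarrow> ('n, 'k) form" where
  "fmult f A = (\<lambda>c. wedge f (A c))"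

text \<open>
  The map from the differentials of \<open>\<gg>\<close> to those of the quotient algebra; the latter are free on
  \<open>\<^bold>d x'\<close> and \<open>\<^bold>d y''\<close>. Its kernel is the module obtained from the differentials of
  \<open>\<gg>\<^sub>\<I>\<^sub>+\<close> by extension of scalars from \<open>\<gg>\<^sub>\<I>\<^sub>+\<close> to \<open>\<gg>\<close>, where \<open>\<gg> = mvs\<close> and
  \<open>\<gg>\<^sub>\<I>\<^sub>+\<close> is spanned by \<open>1\<close> and \<open>adapted N\<close>.
\<close>
definition proj_form :: "'n::finite set \<Rightarrow> ('n, 'k::real_normed_field) form \<Rightarrow> ('n, 'k) form" where
  "proj_form N A = (\<lambda>c. case c of
     Inl i \<Rightarrow> (if i \<in> N then 0 else proj_mv N (A (Inl i)))
   | Inr i \<Rightarrow> (if i \<in> N then proj_mv N (A (Inr i)) else 0))"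

definition adapted_forms :: "'n::finite set \<Rightarrow> ('n, 'k::real_normed_field) form set" where
  "adapted_forms N = {A \<in> forms. proj_form N A = 0}"

text \<open>\<open>\<^bold>d \<xi>\<close> acts as \<open>[\<xi>, _]\<close>, and the action is \<open>\<gg>\<close>-linear in the form.\<close>
definition act :: "('n::{finite,linorder}, 'k::real_normed_field) form \<Rightarrow> ('n, 'k) mv \<Rightarrow> ('n, 'k) mv" where
  "act A \<eta> = (\<Sum>c\<in>UNIV. wedge (A c) (schouten (coord c) \<eta>))"

text \<open>
  The Leibniz rule expresses \<open>[f \<^bold>d c, g \<^bold>d c']\<close>, for coordinates \<open>c, c'\<close>, as
  \<open>((f \<^bold>d c).g) \<^bold>d c' \<mp> ((g \<^bold>d c').f) \<^bold>d c \<plusminus> f g \<^bold>d [c, c']\<close>. Since \<open>[c, c']\<close> is constant,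
  the last term is zero. The sign in the second term is the one of graded antisymmetry for the
  degrees shifted by one.
\<close>
definition form_bracket :: "('n::{finite,linorder}, 'k::real_normed_field) form \<Rightarrow> ('n, 'k) form \<Rightarrow> ('n, 'k) form" where
  "form_bracket A B = (\<Sum>p\<in>form_degrees TYPE('n). \<Sum>q\<in>form_degrees TYPE('n).
     (\<lambda>c. act (form_part p A) (form_part q B c)
        - koszul ((p - 1) * (q - 1)) (act (form_part q B) (form_part p A c))))"

section \<open>The cochain complex\<close>

text \<open>\<open>deg_sum ps\<close> is the total degree of homogeneous arguments of degrees \<open>ps\<close>, all shifted by one.\<close>
definition deg_sum :: "int list \<Rightarrow> int" where
  "deg_sum ps = (\<Sum>p\<leftarrow>ps. p - 1)"

text \<open>
  \<open>multimaps N k e\<close> consists of the homogeneous module homomorphisms of internal degree \<open>e\<close> from the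
  \<open>k\<close>-th graded exterior power of \<open>adapted_forms N\<close> to \<open>adapted N\<close>, given as graded multilinear,
  graded antisymmetric maps on \<open>k\<close>-tuples (extended by zero to all other lists). All signs and the
  degree \<open>e\<close> refer to degrees shifted by one, on arguments and values.
\<close>
definition multimaps ::
  "'n::{finite,linorder} set \<Rightarrow> nat \<Rightarrow> int \<Rightarrow> (('n, 'k::real_normed_field) form list \<Rightarrow> ('n, 'k) mv) set" where
  "multimaps N k e = {\<phi>.
     (\<forall>As. \<not> (length As = k \<and> set As \<subseteq> adapted_forms N) \<longrightarrow> \<phi> As = 0) \<and>
     (\<forall>As. length As = k \<and> set As \<subseteq> adapted_forms N \<longrightarrow> \<phi> As \<in> adapted N) \<and>
     (\<forall>As i B. length As = k \<and> set As \<subseteq> adapted_forms N \<and> i < k \<and> B \<in> adapted_forms N \<longrightarrow>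
        \<phi> (As[i := As ! i + B]) = \<phi> As + \<phi> (As[i := B])) \<and>
     (\<forall>As ps. length As = k \<and> set As \<subseteq> adapted_forms N \<and> list_all2 form_degree ps As \<longrightarrow>
        mv_degree (e + deg_sum ps + 1) (\<phi> As)) \<and>
     (\<forall>As ps i f m. length As = k \<and> set As \<subseteq> adapted_forms N \<and> list_all2 form_degree ps As \<and>
        i < k \<and> f \<in> mvs \<and> mv_degree m f \<longrightarrow>
        \<phi> (As[i := fmult f (As ! i)]) = koszul (m * (e + deg_sum (take i ps))) (wedge f (\<phi> As))) \<and>
     (\<forall>As ps i. length As = k \<and> set As \<subseteq> adapted_forms N \<and> list_all2 form_degree ps As \<and>
        Suc i < k \<longrightarrow>
        \<phi> (As[i := As ! Suc i, Suc i := As ! i]) =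
          - koszul ((ps ! i - 1) * (ps ! Suc i - 1)) (\<phi> As))}"

text \<open>The Chevalley-Eilenberg formula for homogeneous arguments of degrees \<open>ps\<close>.\<close>
definition CE_hom ::
  "int \<Rightarrow> (('n::{finite,linorder}, 'k::real_normed_field) form list \<Rightarrow> ('n, 'k) mv) \<Rightarrow>
   int list \<Rightarrow> ('n, 'k) form list \<Rightarrow> ('n, 'k) mv" where
  "CE_hom e \<phi> ps As =
     (\<Sum>i<length As.
        koszul (int i + (ps ! i - 1) * (e + deg_sum (take i ps)))
          (act (As ! i) (\<phi> (nths As (- {i}))))) +
     (\<Sum>j<length As. \<Sum>i<j.
        koszul (int i + int j + (ps ! i - 1) * deg_sum (take i ps)
                + (ps ! j - 1) * (deg_sum (take j ps) - (ps ! i - 1)))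
          (\<phi> (form_bracket (As ! i) (As ! j) # nths As (- {i, j}))))"

definition CE ::
  "'n::{finite,linorder} set \<Rightarrow> int \<Rightarrow> (('n, 'k::real_normed_field) form list \<Rightarrow> ('n, 'k) mv) \<Rightarrow>
   ('n, 'k) form list \<Rightarrow> ('n, 'k) mv" where
  "CE N e \<phi> As =
     (if set As \<subseteq> adapted_forms N
      then \<Sum>ps | length ps = length As \<and> set ps \<subseteq> form_degrees TYPE('n).
             CE_hom e \<phi> ps (map2 form_part ps As)
      else 0)"

text \<open>
  A cochain is an element of the direct sum, over all internal degrees \<open>e\<close>, of the spaces of homogeneous
  homomorphisms. The cochain degree is one less than the exterior power.
\<close>
type_synonym ('n, 'k) cochain = "int \<Rightarrow> ('n, 'k) form list \<Rightarrow> ('n, 'k) mv"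

definition cochains :: "'n::{finite,linorder} set \<Rightarrow> nat \<Rightarrow> ('n, 'k::real_normed_field) cochain set" where
  "cochains N d = {\<Phi>. (\<forall>e. \<Phi> e \<in> multimaps N (Suc d) e) \<and> finite {e. \<Phi> e \<noteq> 0}}"

definition delta :: "'n::{finite,linorder} set \<Rightarrow> ('n, 'k::real_normed_field) cochain \<Rightarrow> ('n, 'k) cochain" where
  "delta N \<Phi> = (\<lambda>e. CE N e (\<Phi> e))"

definition cocycles :: "'n::{finite,linorder} set \<Rightarrow> nat \<Rightarrow> ('n, 'k::real_normed_field) cochain set" where
  "cocycles N d = {\<Phi> \<in> cochains N d. delta N \<Phi> = 0}"

definition coboundaries :: "'n::{finite,linorder} set \<Rightarrow> nat \<Rightarrow> ('n, 'k::real_normed_field) cochain set" where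
  "coboundaries N d = (case d of 0 \<Rightarrow> {0} | Suc d' \<Rightarrow> delta N ` cochains N d')"

definition cohomology :: "'n::{finite,linorder} set \<Rightarrow> nat \<Rightarrow> ('n, 'k::real_normed_field) cochain set set" where
  "cohomology N d =
     cocycles N d // {(\<Phi>, \<Psi>). \<Phi> \<in> cocycles N d \<and> \<Psi> \<in> cocycles N d \<and> \<Phi> - \<Psi> \<in> coboundaries N d}"

definition concentrated_in_degree_0 :: "'k::real_normed_field itself \<Rightarrow> 'n::{finite,linorder} set \<Rightarrow> bool" where
  "concentrated_in_degree_0 _ N \<longleftrightarrow>
     (\<forall>d. d \<noteq> 0 \<longrightarrow> (cohomology N d :: ('n, 'k) cochain set set) = {coboundaries N d})"

end

(*
  The forms act on the multivector fields as the graded derivations, and their bracket is the graded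
  commutator. Since l >= 2, two of the coordinates x'' form a regular sequence, so a cochain extends
  from the adapted forms to all forms and is given by its coefficients on the differentials of the
  coordinates. The complex becomes the relative de Rham complex of the graded space with coordinates
  x_i (even), y_i (odd) and its linear subspace x'' = 0, y' = 0, without the forms of degree 0. The
  dilations preserve the subspace, hence the Poincare lemma applies: with E the Euler vector field,
  the Lie derivative along E is invertible by averaging over dilations, and contraction with E
  gives a primitive of each closed form.
*)
theory Submission
  imports Defs
begin

section \<open>Smooth functions\<close>

text \<open>Bracketing with x_i is minus the derivative in y_i, and bracketing with y_i is the
  derivative in x_i. So a cochain is an alternating function of derivations, that is, a differential
  form, and taking values in the ideal becomes a condition on its coefficients: only those whose
  slots are all normal (x'' or y') must lie in the ideal. In a tangential slot (x' or y'') the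
  adapted form itself supplies a factor from the ideal. For the same reason the differential dc of a
  tangential coordinate is not an admissible argument; one evaluates on x dc with x among the x''
  and has to divide by powers of x afterwards.

  Odd coordinates have weight 1 under dilation just like even ones. On a component with k slots and
  index set I the Lie derivative is therefore the Euler operator in x plus k + |I|, inverted by
  integration against t^(k+|I|-1) over [0,1]; the weight is positive because k is at least 1. The
  primitive has one slot less than the form, so the construction stays inside the complex exactly
  for two slots or more, which are the positive cochain degrees.\<close>

lemma has_derivative_pd:
  fixes f :: "real ^ 'n::finite \<Rightarrow> 'k::real_normed_vector"
  assumes "f differentiable (at x)"
  shows "(f has_derivative (\<lambda>v. \<Sum>i\<in>UNIV. (v $ i) *\<^sub>R pd i f x)) (at x)"
proof -
  let ?D = "frechet_derivative f (at x)"
  have D: "(f has_derivative ?D) (at x)"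
    using assms frechet_derivative_works by blast
  then interpret D: linear ?D
    by (simp add: has_derivative_linear)
  have "?D v = (\<Sum>i\<in>UNIV. (v $ i) *\<^sub>R pd i f x)" for v
  proof -
    have "?D v = ?D (\<Sum>i\<in>UNIV. (v $ i) *\<^sub>R axis i 1)"
      using basis_expansion[of v] by (simp add: scalar_mult_eq_scaleR)
    then show ?thesis
      by (simp add: D.sum D.scaleR pd_def)
  qed
  then have "?D = (\<lambda>v. \<Sum>i\<in>UNIV. (v $ i) *\<^sub>R pd i f x)" by (rule ext)
  with D show ?thesis by simp
qed

lemma pd_eqI: "(f has_derivative D) (at x) \<Longrightarrow> pd i f x = D (axis i 1)"
  unfolding pd_def using frechet_derivative_at by metis

lemma smooth_differentiable: "smooth f \<Longrightarrow> f differentiable (at x)"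
  unfolding smooth_def by (metis Ck.simps(2))

lemma smooth_pd: "smooth f \<Longrightarrow> smooth (pd i f)"
  unfolding smooth_def by (metis Ck.simps(2))

lemma smooth_continuous: "smooth f \<Longrightarrow> continuous_on S f"
  unfolding smooth_def by (metis Ck.simps(1) continuous_on_subset top_greatest)

lemma smooth_has_derivative:
  "smooth f \<Longrightarrow> (f has_derivative (\<lambda>v. \<Sum>i\<in>UNIV. (v $ i) *\<^sub>R pd i f x)) (at x)"
  by (rule has_derivative_pd) (rule smooth_differentiable)

text \<open>A coinduction principle: all derivatives stay inside the class \<open>P\<close>, whose
  members are differentiable and so continuous. Later proofs only have to choose a suitable
  class.\<close>

lemma smoothI:
  assumes "P f"
    and "\<And>g x. P g \<Longrightarrow> g differentiable (at x)"
    and "\<And>g i. P g \<Longrightarrow> P (pd i g)"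
  shows "smooth f"
proof -
  have "P g \<Longrightarrow> Ck k g" for k g
    by (induction k arbitrary: g)
      (auto simp: assms continuous_on_eq_continuous_within
        intro!: differentiable_imp_continuous_within)
  with assms(1) show ?thesis by (auto simp: smooth_def)
qed

lemma pd_const: "pd i (\<lambda>x. c) = (\<lambda>x. 0)"
  by (rule ext, subst pd_eqI[where D = "\<lambda>v. 0"]) auto

lemma smooth_const [simp]: "smooth (\<lambda>x. c)"
  by (rule smoothI[of "\<lambda>f. \<exists>c. f = (\<lambda>x. c)"]) (auto simp: pd_const)

lemma smooth_0 [simp]: "smooth 0"
  using smooth_const[of 0] by (simp add: zero_fun_def)

lemma pd_0 [simp]: "pd i 0 = 0"
  using pd_const[of i 0] by (simp add: zero_fun_def)

lemma pd_add:
  assumes "smooth f" "smooth g"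
  shows "pd i (f + g) = pd i f + pd i g"
proof
  fix x
  have "((\<lambda>x. f x + g x) has_derivative (\<lambda>v. (\<Sum>i\<in>UNIV. (v $ i) *\<^sub>R pd i f x) + (\<Sum>i\<in>UNIV. (v $ i) *\<^sub>R pd i g x))) (at x)"
    by (intro has_derivative_add smooth_has_derivative assms)
  from pd_eqI[OF this, of i] show "pd i (f + g) x = (pd i f + pd i g) x"
    by (simp add: plus_fun_def axis_def if_distrib[of "\<lambda>c. c *\<^sub>R _"] cong: if_cong)
qed

lemma pd_uminus:
  assumes "smooth f"
  shows "pd i (- f) = - pd i f"
proof
  fix x
  have "((\<lambda>x. - f x) has_derivative (\<lambda>v. - (\<Sum>i\<in>UNIV. (v $ i) *\<^sub>R pd i f x))) (at x)"
    by (intro has_derivative_minus smooth_has_derivative assms)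
  from pd_eqI[OF this, of i] show "pd i (- f) x = (- pd i f) x"
    by (simp add: fun_Compl_def axis_def if_distrib[of "\<lambda>c. c *\<^sub>R _"] cong: if_cong)
qed

lemma pd_mult:
  fixes f g :: "real ^ 'n::finite \<Rightarrow> 'k::real_normed_field"
  assumes "smooth f" "smooth g"
  shows "pd i (f * g) = pd i f * g + f * pd i g"
proof
  fix x
  have "((\<lambda>x. f x * g x) has_derivative (\<lambda>v. f x * (\<Sum>i\<in>UNIV. (v $ i) *\<^sub>R pd i g x) + (\<Sum>i\<in>UNIV. (v $ i) *\<^sub>R pd i f x) * g x)) (at x)"
    by (intro has_derivative_mult smooth_has_derivative assms)
  from pd_eqI[OF this, of i] show "pd i (f * g) x = (pd i f * g + f * pd i g) x"
    by (simp add: times_fun_def axis_def if_distrib[of "\<lambda>c. c *\<^sub>R _"] cong: if_cong)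
qed

text \<open>The finite order matters: in the induction for products the two terms of the Leibniz
  rule are known to be \<open>Ck k\<close> only, while the factors themselves stay smooth.\<close>

lemma Ck_add: "Ck k f \<Longrightarrow> Ck k g \<Longrightarrow> Ck k (f + g)"
proof (induction k arbitrary: f g)
  case 0
  then show ?case by (auto simp: plus_fun_def intro: continuous_on_add)
next
  case (Suc k)
  have "pd i (f + g) = pd i f + pd i g" for i
  proof
    fix x
    have "((\<lambda>x. f x + g x) has_derivative (\<lambda>v. (\<Sum>i\<in>UNIV. (v $ i) *\<^sub>R pd i f x) + (\<Sum>i\<in>UNIV. (v $ i) *\<^sub>R pd i g x))) (at x)"
      using Suc.prems by (intro has_derivative_add has_derivative_pd) auto
    from pd_eqI[OF this, of i] show "pd i (f + g) x = (pd i f + pd i g) x"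
      by (simp add: plus_fun_def axis_def if_distrib[of "\<lambda>c. c *\<^sub>R _"] cong: if_cong)
  qed
  with Suc show ?case by (auto simp: plus_fun_def)
qed

lemma smooth_add: "smooth f \<Longrightarrow> smooth g \<Longrightarrow> smooth (f + g)"
  by (simp add: smooth_def Ck_add)

lemma smooth_uminus:
  assumes "smooth f"
  shows "smooth (- f)"
proof (rule smoothI[of "\<lambda>f. \<exists>g. smooth g \<and> f = - g"])
  fix h :: "real ^ 'n \<Rightarrow> 'b" and x
  assume "\<exists>g. smooth g \<and> h = - g"
  then obtain g where "smooth g" "h = - g" by blast
  then show "h differentiable (at x)"
    using differentiable_minus[OF smooth_differentiable] by (simp add: fun_Compl_def)
next
  fix h :: "real ^ 'n \<Rightarrow> 'b" and i
  assume "\<exists>g. smooth g \<and> h = - g"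
  then show "\<exists>g. smooth g \<and> pd i h = - g" using pd_uminus smooth_pd by blast
qed (use assms in blast)

lemma smooth_diff: "smooth f \<Longrightarrow> smooth g \<Longrightarrow> smooth (f - g)"
  using smooth_add[of f "- g"] by (simp add: smooth_uminus)

lemma pd_diff: "smooth f \<Longrightarrow> smooth g \<Longrightarrow> pd i (f - g) = pd i f - pd i g"
  using pd_add[of f "- g" i] by (simp add: smooth_uminus pd_uminus)

lemma smooth_sum: "(\<And>a. a \<in> A \<Longrightarrow> smooth (f a)) \<Longrightarrow> smooth (sum f A)"
  by (induction A rule: infinite_finite_induct) (auto intro!: smooth_add)

lemma pd_sum: "(\<And>a. a \<in> A \<Longrightarrow> smooth (f a)) \<Longrightarrow> pd i (sum f A) = (\<Sum>a\<in>A. pd i (f a))"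
  by (induction A rule: infinite_finite_induct) (auto simp: pd_add smooth_sum)

lemma smooth_mult:
  fixes f g :: "real ^ 'n::finite \<Rightarrow> 'k::real_normed_field"
  assumes "smooth f" "smooth g"
  shows "smooth (f * g)"
proof -
  have "Ck k (f * g)" if "smooth f" "smooth g" for k and f g :: "real ^ 'n \<Rightarrow> 'k"
    using that
  proof (induction k arbitrary: f g)
    case 0
    then show ?case
      by (simp add: times_fun_def continuous_on_mult smooth_continuous)
  next
    case (Suc k)
    have "(f * g) differentiable (at x)" for x
      using differentiable_mult[OF smooth_differentiable smooth_differentiable] Suc.prems
      by (simp add: times_fun_def)
    moreover have "Ck k (pd i (f * g))" for i
      using Suc by (metis pd_mult Ck_add smooth_pd)
    ultimately show ?case by (simp only: Ck.simps simp_thms)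
  qed
  with assms show ?thesis by (simp add: smooth_def)
qed

lemma pd_coord: "pd j (\<lambda>x. of_real (x $ i)) = (\<lambda>x. if i = j then 1 else 0 :: 'k::real_normed_field)"
proof
  fix x :: "real ^ 'a"
  have "((\<lambda>x. of_real (x $ i) :: 'k) has_derivative (\<lambda>v. of_real (v $ i))) (at x)"
    by (auto intro!: derivative_eq_intros bounded_linear.has_derivative[OF bounded_linear_of_real]
        bounded_linear.has_derivative[OF bounded_linear_vec_nth])
  from pd_eqI[OF this, of j] show "pd j (\<lambda>x. of_real (x $ i)) x = (if i = j then 1 else 0 :: 'k)"
    by (auto simp: axis_def)
qed

lemma smooth_coord [simp]: "smooth (\<lambda>x. of_real (x $ i) :: 'k::real_normed_field)"
proof (rule smoothI[of "\<lambda>f. f = (\<lambda>x. of_real (x $ i)) \<or> (\<exists>c. f = (\<lambda>x. c))"])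
  fix g :: "real ^ 'a \<Rightarrow> 'k" and x
  assume "g = (\<lambda>x. of_real (x $ i)) \<or> (\<exists>c. g = (\<lambda>x. c))"
  moreover have "(\<lambda>x. of_real (x $ i) :: 'k) differentiable (at x)"
    by (auto intro!: differentiableI derivative_eq_intros bounded_linear.has_derivative[OF bounded_linear_of_real]
        bounded_linear.has_derivative[OF bounded_linear_vec_nth])
  ultimately show "g differentiable (at x)" by auto
qed (auto simp: pd_coord pd_const)

text \<open>The complement of a coordinate hyperplane is dense and smooth functions are continuous.
  The cancellations of a factor \<open>x $ i\<close> below rest on this.\<close>

lemma eq_off_hyperplane:
  fixes f g :: "real ^ 'n::finite \<Rightarrow> 'k::real_normed_vector"
  assumes "smooth f" "smooth g" and eq: "\<And>x. x $ i \<noteq> 0 \<Longrightarrow> f x = g x"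
  shows "f = g"
proof
  fix x :: "real ^ 'n"
  let ?p = "\<lambda>t. x + t *\<^sub>R axis i 1"
  have lim: "((\<lambda>t. h (?p t)) \<longlongrightarrow> h x) (at 0)" if "smooth h" for h :: "real ^ 'n \<Rightarrow> 'k"
  proof -
    have "isCont h (?p 0)"
      using smooth_continuous[OF that, of UNIV] by (simp add: continuous_on_eq_continuous_at)
    moreover have "isCont ?p 0" by (intro continuous_intros)
    ultimately have "isCont (\<lambda>t. h (?p t)) 0" by (rule isCont_o2[rotated])
    then show ?thesis by (simp add: isCont_def)
  qed
  have "\<forall>\<^sub>F t in at 0. ?p t $ i \<noteq> 0"
  proof (cases "x $ i = 0")
    case True
    then show ?thesis by (auto simp: axis_def eventually_at_filter)
  next
    case False
    have "((\<lambda>t. ?p t $ i) \<longlongrightarrow> ?p 0 $ i) (at 0)"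
      by (intro tendsto_intros)
    moreover have "?p 0 $ i \<noteq> 0" using False by simp
    ultimately show ?thesis by (rule tendsto_imp_eventually_ne)
  qed
  then have "\<forall>\<^sub>F t in at 0. f (?p t) = g (?p t)"
    by eventually_elim (rule eq)
  then have "((\<lambda>t. g (?p t)) \<longlongrightarrow> f x) (at 0)"
    using lim[OF assms(1)] by (simp cong: tendsto_cong)
  with lim[OF assms(2)] show "f x = g x"
    using tendsto_unique trivial_limit_at by blast
qed

section \<open>Averaging along partial dilations\<close>

text \<open>Scaling only the coordinates in \<open>S\<close> serves two purposes: a single
  coordinate gives Hadamard's lemma, all of them give the homotopy.\<close>

definition dilate :: "'n::finite set \<Rightarrow> real \<Rightarrow> real ^ 'n \<Rightarrow> real ^ 'n" where
  "dilate S t x = (\<chi> i. if i \<in> S then t * x $ i else x $ i)"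

text \<open>On smooth functions this inverts \<open>m + 1\<close> plus the Euler operator of the
  coordinates in \<open>S\<close>, as \<open>avg_ftc\<close> with \<open>w = m + 1\<close> and
  \<open>pd_avg\<close> show.\<close>

definition avg :: "'n::finite set \<Rightarrow> nat \<Rightarrow> (real ^ 'n \<Rightarrow> 'k) \<Rightarrow> real ^ 'n \<Rightarrow> 'k::{real_normed_field,banach}" where
  "avg S m f x = integral {0..1} (\<lambda>t. t ^ m *\<^sub>R f (dilate S t x))"

lemma continuous_on_dilate: "continuous_on A (\<lambda>(x, t). dilate S t x)"
  unfolding dilate_def case_prod_beta
proof (rule continuous_on_vec_lambda)
  show "continuous_on A (\<lambda>p. if i \<in> S then snd p * fst p $ i else fst p $ i)" for i
    by (cases "i \<in> S") (auto intro!: continuous_intros)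
qed

lemma dilate_1 [simp]: "dilate S 1 x = x"
  by (simp add: dilate_def vec_eq_iff)

lemma has_derivative_dilate: "(dilate S t has_derivative dilate S t) (at x)"
proof -
  have "linear (dilate S t)"
    by (auto intro!: linearI simp: dilate_def vec_eq_iff algebra_simps)
  then show ?thesis
    by (simp add: bounded_linear_imp_has_derivative linear_conv_bounded_linear)
qed

lemma has_derivative_dilate_t:
  "((\<lambda>t. dilate S t x) has_vector_derivative (\<chi> i. if i \<in> S then x $ i else 0)) (at t)"
proof -
  have "(\<lambda>t. dilate S t x) = (\<lambda>t. (\<chi> i. if i \<in> S then 0 else x $ i) + t *\<^sub>R (\<chi> i. if i \<in> S then x $ i else 0))"
    by (auto simp: dilate_def vec_eq_iff fun_eq_iff)
  then show ?thesis
    by (auto intro!: derivative_eq_intros)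
qed

lemma continuous_on_avg_integrand:
  assumes "smooth f"
  shows "continuous_on A (\<lambda>(x, t). t ^ m *\<^sub>R f (dilate S t x))"
proof -
  have "continuous_on A (\<lambda>z. f (case z of (x, t) \<Rightarrow> dilate S t x))"
    by (rule continuous_on_compose2[OF smooth_continuous[OF assms, of UNIV] continuous_on_dilate]) auto
  then show ?thesis
    unfolding case_prod_beta by (intro continuous_intros)
qed

lemma integrable_avg:
  fixes f :: "real ^ 'n::finite \<Rightarrow> 'k::banach"
  assumes "smooth f"
  shows "(\<lambda>t. t ^ m *\<^sub>R f (dilate S t x)) integrable_on {0..1}"
proof -
  have "continuous_on {0..1} (\<lambda>t. (\<lambda>(x, t). t ^ m *\<^sub>R f (dilate S t x)) (x, t))"
    by (rule continuous_on_compose2[OF continuous_on_avg_integrand[OF assms, of UNIV]])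
      (auto intro!: continuous_intros)
  then show ?thesis
    by (simp add: integrable_continuous_interval)
qed

text \<open>Differentiation under the integral sign; by the chain rule a derivative in a dilated
  direction contributes one more factor t, whence the exponent \<open>Suc m\<close>.\<close>

lemma avg_has_derivative:
  fixes f :: "real ^ 'n::finite \<Rightarrow> 'k::{real_normed_field,banach}"
  assumes "smooth f"
  shows "(avg S m f has_derivative
    (\<lambda>v. \<Sum>i\<in>UNIV. (v $ i) *\<^sub>R avg S (if i \<in> S then Suc m else m) (pd i f) x)) (at x)"
proof -
  define e where "e i = (if i \<in> S then Suc m else m)" for i
  define F where "F x t = t ^ m *\<^sub>R f (dilate S t x)" for x t
  \<comment> \<open>The Leibniz rule for parameter integrals takes the derivative as a bounded
    linear map depending continuously on (x, t). \<open>B i\<close> sends a value of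
    \<open>pd i f\<close> to its share of that map and, being linear itself, commutes with the
    integral.\<close>
  define B :: "'n \<Rightarrow> 'k \<Rightarrow> (real ^ 'n) \<Rightarrow>\<^sub>L 'k"
    where "B i c = Blinfun (\<lambda>v. (v $ i) *\<^sub>R c)" for i c
  have bl: "bounded_linear (\<lambda>v. (v $ i) *\<^sub>R c)" for i and c :: 'k
    by (intro bounded_linear_scaleR_const bounded_linear_vec_nth)
  have B: "blinfun_apply (B i c) = (\<lambda>v. (v $ i) *\<^sub>R c)" for i c
    unfolding B_def using bl by (rule bounded_linear_Blinfun_apply)
  have linB: "bounded_linear (B i)" for i
  proof (rule bounded_linear_intro[where K = 1])
    show "B i (c + d) = B i c + B i d" "B i (r *\<^sub>R c) = r *\<^sub>R B i c" for c d r
      by (auto intro!: blinfun_eqI simp: B blinfun.add_left blinfun.scaleR_left algebra_simps)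
    show "norm (B i c) \<le> norm c * 1" for c
      by (rule norm_blinfun_bound) (auto simp: B mult.commute intro!: mult_left_mono component_le_norm_cart)
  qed
  define DF where "DF x t = (\<Sum>i\<in>UNIV. B i (t ^ e i *\<^sub>R pd i f (dilate S t x)))" for x t
  have "((\<lambda>x. F x t) has_derivative blinfun_apply (DF x t)) (at x within UNIV)" for x t
  proof -
    have "((\<lambda>x. f (dilate S t x)) has_derivative
        (\<lambda>v. \<Sum>i\<in>UNIV. (dilate S t v $ i) *\<^sub>R pd i f (dilate S t x))) (at x)"
      using has_derivative_compose[OF has_derivative_dilate smooth_has_derivative[OF assms]] .
    then have "((\<lambda>x. F x t) has_derivative
        (\<lambda>v. t ^ m *\<^sub>R (\<Sum>i\<in>UNIV. (dilate S t v $ i) *\<^sub>R pd i f (dilate S t x)))) (at x)"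
      unfolding F_def by (rule has_derivative_scaleR_right)
    moreover have "(\<lambda>v. t ^ m *\<^sub>R (\<Sum>i\<in>UNIV. (dilate S t v $ i) *\<^sub>R pd i f (dilate S t x))) = blinfun_apply (DF x t)"
      by (auto simp: DF_def blinfun.sum_left B fun_eq_iff scaleR_sum_right dilate_def e_def algebra_simps intro!: sum.cong)
    ultimately show ?thesis by simp
  qed
  moreover have "F x integrable_on cbox 0 1" for x
    using integrable_avg[OF assms] by (simp add: F_def[abs_def])
  moreover have "continuous_on (UNIV \<times> cbox 0 1) (\<lambda>(x, t). DF x t)"
  proof -
    have "continuous_on (UNIV \<times> cbox 0 1) (\<lambda>z. (\<lambda>(x, t). t ^ e i *\<^sub>R pd i f (dilate S t x)) z)" for i
      by (rule continuous_on_avg_integrand) (rule smooth_pd[OF assms])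
    then have "continuous_on (UNIV \<times> cbox 0 1) (\<lambda>z. B i ((\<lambda>(x, t). t ^ e i *\<^sub>R pd i f (dilate S t x)) z))" for i
      by (rule bounded_linear.continuous_on[OF linB])
    then show ?thesis
      unfolding DF_def case_prod_beta by (intro continuous_on_sum) auto
  qed
  ultimately have main: "((\<lambda>x. integral (cbox 0 1) (F x)) has_derivative integral (cbox 0 1) (DF x)) (at x within UNIV)"
    by (rule leibniz_rule) auto
  have i: "(\<lambda>t. t ^ e i *\<^sub>R pd i f (dilate S t x)) integrable_on cbox 0 1" for i
    using integrable_avg[OF smooth_pd[OF assms]] by simp
  have iB: "(\<lambda>t. B i (t ^ e i *\<^sub>R pd i f (dilate S t x))) integrable_on cbox 0 1" for i
    using integrable_linear[OF i linB] by (simp add: o_def)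
  have "integral (cbox 0 1) (DF x) = (\<Sum>i\<in>UNIV. B i (avg S (e i) (pd i f) x))"
    unfolding DF_def using iB integral_linear[OF i linB]
    by (subst integral_sum) (auto simp: o_def avg_def)
  then have "blinfun_apply (integral (cbox 0 1) (DF x)) = (\<lambda>v. \<Sum>i\<in>UNIV. (v $ i) *\<^sub>R avg S (e i) (pd i f) x)"
    by (simp add: blinfun.sum_left B fun_eq_iff)
  moreover have "(\<lambda>x. integral (cbox 0 1) (F x)) = avg S m f"
    by (simp add: F_def[abs_def] avg_def fun_eq_iff)
  ultimately show ?thesis using main by (simp add: e_def)
qed

lemma pd_avg: "smooth f \<Longrightarrow> pd i (avg S m f) = avg S (if i \<in> S then Suc m else m) (pd i f)"
  by (rule ext) (simp add: pd_eqI[OF avg_has_derivative] axis_def if_distrib[of "\<lambda>c. c *\<^sub>R _"] cong: if_cong)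

lemma smooth_avg:
  assumes "smooth f"
  shows "smooth (avg S m f)"
\<comment> \<open>The class ranges over all weights, since a derivative along \<open>S\<close>
  raises the weight.\<close>
proof (rule smoothI[of "\<lambda>g. \<exists>m f. smooth f \<and> g = avg S m f"])
  show "\<exists>n h. smooth h \<and> avg S m f = avg S n h" using assms by blast
next
  fix g :: "real ^ 'a \<Rightarrow> 'b" and x assume "\<exists>m f. smooth f \<and> g = avg S m f"
  then obtain m f where "smooth f" "g = avg S m f" by blast
  then show "g differentiable (at x)" by (simp add: differentiableI[OF avg_has_derivative])
next
  fix g :: "real ^ 'a \<Rightarrow> 'b" and i assume "\<exists>m f. smooth f \<and> g = avg S m f"
  then obtain m f where "smooth f" "g = avg S m f" by blast
  then have "smooth (pd i f) \<and> pd i g = avg S (if i \<in> S then Suc m else m) (pd i f)"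
    by (simp add: pd_avg smooth_pd)
  then show "\<exists>m f. smooth f \<and> pd i g = avg S m f" by blast
qed

text \<open>The fundamental theorem of calculus for \<open>t ^ w *\<^sub>R f (dilate S t x)\<close>
  on [0, 1]. The factor \<open>0 ^ w\<close> keeps the boundary value at t = 0 for weight 0 and
  drops it otherwise; for weight 0 the truncated \<open>w - 1\<close> is multiplied by 0.\<close>

lemma avg_ftc:
  fixes f :: "real ^ 'n::finite \<Rightarrow> 'k::{real_normed_field,banach}"
  assumes f: "smooth f"
  shows "f x - 0 ^ w *\<^sub>R f (dilate S 0 x) =
    of_nat w * avg S (w - 1) f x + (\<Sum>i\<in>S. (x $ i) *\<^sub>R avg S w (pd i f) x)"
proof -
  let ?h = "\<lambda>t. t ^ w *\<^sub>R f (dilate S t x)"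
  let ?h' = "\<lambda>t. real w *\<^sub>R (t ^ (w - 1) *\<^sub>R f (dilate S t x))
    + (\<Sum>i\<in>S. (x $ i) *\<^sub>R (t ^ w *\<^sub>R pd i f (dilate S t x)))"
  have "(?h has_vector_derivative ?h' t) (at t)" for t
  proof -
    have "((\<lambda>t. f (dilate S t x)) has_derivative
       (\<lambda>s. \<Sum>i\<in>UNIV. ((s *\<^sub>R (\<chi> i. if i \<in> S then x $ i else 0)) $ i) *\<^sub>R pd i f (dilate S t x))) (at t)"
      using has_derivative_compose[OF has_derivative_dilate_t[unfolded has_vector_derivative_def] smooth_has_derivative[OF f]] .
    moreover have "(\<lambda>s. \<Sum>i\<in>UNIV. ((s *\<^sub>R (\<chi> i. if i \<in> S then x $ i else 0)) $ i) *\<^sub>R pd i f (dilate S t x))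
      = (\<lambda>s. s *\<^sub>R (\<Sum>i\<in>S. (x $ i) *\<^sub>R pd i f (dilate S t x)))"
    proof
      fix s
      have "(\<Sum>i\<in>UNIV. ((s *\<^sub>R (\<chi> i. if i \<in> S then x $ i else 0)) $ i) *\<^sub>R pd i f (dilate S t x))
        = (\<Sum>i\<in>UNIV. if i \<in> S then s *\<^sub>R ((x $ i) *\<^sub>R pd i f (dilate S t x)) else 0)"
        by (intro sum.cong) auto
      also have "\<dots> = (\<Sum>i\<in>S. s *\<^sub>R ((x $ i) *\<^sub>R pd i f (dilate S t x)))"
        by (simp add: sum.If_cases)
      finally show "(\<Sum>i\<in>UNIV. ((s *\<^sub>R (\<chi> i. if i \<in> S then x $ i else 0)) $ i) *\<^sub>R pd i f (dilate S t x))
        = s *\<^sub>R (\<Sum>i\<in>S. (x $ i) *\<^sub>R pd i f (dilate S t x))"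
        by (simp add: scaleR_sum_right)
    qed
    ultimately have "((\<lambda>t. f (dilate S t x)) has_vector_derivative (\<Sum>i\<in>S. (x $ i) *\<^sub>R pd i f (dilate S t x))) (at t)"
      by (simp add: has_vector_derivative_def)
    moreover have "((\<lambda>t. t ^ w) has_field_derivative real w * t ^ (w - 1)) (at t)"
      by (auto intro!: derivative_eq_intros)
    ultimately have "(?h has_vector_derivative (t ^ w *\<^sub>R (\<Sum>i\<in>S. (x $ i) *\<^sub>R pd i f (dilate S t x))
        + (real w * t ^ (w - 1)) *\<^sub>R f (dilate S t x))) (at t)"
      by (rule has_vector_derivative_scaleR[rotated])
    then show ?thesis by (simp add: scaleR_sum_right algebra_simps)
  qed
  then have "(?h' has_integral (?h 1 - ?h 0)) {0..1}"
    by (intro fundamental_theorem_of_calculus) (auto intro: has_vector_derivative_at_within)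
  then have "integral {0..1} ?h' = f x - 0 ^ w *\<^sub>R f (dilate S 0 x)"
    by (simp add: integral_unique)
  moreover have "integral {0..1} ?h' = real w *\<^sub>R avg S (w - 1) f x + (\<Sum>i\<in>S. (x $ i) *\<^sub>R avg S w (pd i f) x)"
  proof -
    have 1: "(\<lambda>t. real w *\<^sub>R (t ^ (w - 1) *\<^sub>R f (dilate S t x))) integrable_on {0..1}"
      by (intro integrable_cmul integrable_avg f)
    have 2: "(\<lambda>t. (x $ i) *\<^sub>R (t ^ w *\<^sub>R pd i f (dilate S t x))) integrable_on {0..1}" for i
      by (intro integrable_cmul integrable_avg smooth_pd f)
    show ?thesis
      unfolding avg_def
      by (subst integral_add[OF 1 integrable_sum]) (simp_all only: 2 finite integral_sum integral_cmul)
  qed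
  ultimately show ?thesis by (simp add: scaleR_conv_of_real)
qed

text \<open>Weight 0 in \<open>avg_ftc\<close>. The right-hand side makes the restriction to the
  hyperplane, extended constantly, visibly smooth and gives its derivatives.\<close>

lemma comp_dilate_0:
  assumes "smooth f"
  shows "(\<lambda>x. f (dilate {i} 0 x)) = f - (\<lambda>x. of_real (x $ i)) * avg {i} 0 (pd i f)"
proof
  fix x
  have "f x - f (dilate {i} 0 x) = of_real (x $ i) * avg {i} 0 (pd i f) x"
    using avg_ftc[OF assms, of x 0 "{i}"] by (simp add: scaleR_conv_of_real)
  then show "f (dilate {i} 0 x) = (f - (\<lambda>x. of_real (x $ i)) * avg {i} 0 (pd i f)) x"
    by (simp add: algebra_simps)
qed

lemma avg_diff:
  assumes "smooth f" "smooth g"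
  shows "avg S m (f - g) = avg S m f - avg S m g"
  using integrable_avg[OF assms(1)] integrable_avg[OF assms(2)]
  by (auto simp: avg_def fun_eq_iff scaleR_diff_right integral_diff)

lemma avg_uminus: "avg S m (- f) = - avg S m f"
  by (simp add: avg_def fun_eq_iff)

lemma avg_0 [simp]: "avg S m 0 = 0"
  by (simp add: avg_def fun_eq_iff)

lemma hadamard:
  fixes f :: "real ^ 'n::finite \<Rightarrow> 'k::{real_normed_field,banach}"
  assumes "smooth f" and "\<And>x. x $ i = 0 \<Longrightarrow> f x = 0"
  shows "f x = of_real (x $ i) * avg {i} 0 (pd i f) x"
  using avg_ftc[OF assms(1), of x 0 "{i}"] assms(2)[of "dilate {i} 0 x"]
  by (simp add: dilate_def scaleR_conv_of_real)

text \<open>Setting x_i to 0 commutes with \<open>pd j\<close> for j different from i. Expanding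
  both sides by \<open>comp_dilate_0\<close> yields x_i times \<open>avg {i} 0\<close> of
  \<open>pd j (pd i f)\<close> on one side and of \<open>pd i (pd j f)\<close> on the other, so the
  average of the difference vanishes; and a function is recovered from its average.\<close>

lemma pd_commute:
  fixes f :: "real ^ 'n::finite \<Rightarrow> 'k::{real_normed_field,banach}"
  assumes f: "smooth f"
  shows "pd i (pd j f) = pd j (pd i f)"
proof (cases "i = j")
  case False
  define g where "g = pd i (pd j f) - pd j (pd i f)"
  have g: "smooth g" unfolding g_def by (intro smooth_diff smooth_pd f)
  let ?x = "\<lambda>x. of_real (x $ i) :: 'k"
  define f0 where "f0 = f - ?x * avg {i} 0 (pd i f)"
  have f0: "f0 = (\<lambda>x. f (dilate {i} 0 x))"
    unfolding f0_def comp_dilate_0[OF f] ..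
  have 1: "pd j f0 x = pd j f (dilate {i} 0 x)" for x
  proof -
    have "((\<lambda>x. f (dilate {i} 0 x)) has_derivative
        (\<lambda>v. \<Sum>k\<in>UNIV. (dilate {i} 0 v $ k) *\<^sub>R pd k f (dilate {i} 0 x))) (at x)"
      using has_derivative_compose[OF has_derivative_dilate smooth_has_derivative[OF f]] .
    from pd_eqI[OF this, of j]
    have "pd j f0 x = (\<Sum>k\<in>UNIV. (dilate {i} 0 (axis j 1) $ k) *\<^sub>R pd k f (dilate {i} 0 x))"
      unfolding f0 .
    also have "(\<Sum>k\<in>UNIV. (dilate {i} 0 (axis j 1) $ k) *\<^sub>R pd k f (dilate {i} 0 x))
      = (\<Sum>k\<in>UNIV. if k = j then pd k f (dilate {i} 0 x) else 0)"
      using False by (intro sum.cong) (auto simp: dilate_def axis_def)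
    finally show ?thesis by simp
  qed
  have "pd j f0 = pd j f - ?x * avg {i} 0 (pd j (pd i f))"
    using False by (simp add: f0_def pd_diff pd_mult f smooth_pd smooth_avg smooth_mult pd_coord pd_avg)
      (simp add: fun_eq_iff)
  then have 2: "pd j f0 x = pd j f x - ?x x * avg {i} 0 (pd j (pd i f)) x" for x by simp
  have 3: "pd j f (dilate {i} 0 x) = pd j f x - ?x x * avg {i} 0 (pd i (pd j f)) x" for x
    using fun_cong[OF comp_dilate_0[OF smooth_pd[OF f]], of j i x] by simp
  have "?x x * avg {i} 0 g x = 0" for x
    using 1[of x] 2[of x] 3[of x] by (simp add: g_def avg_diff smooth_pd f algebra_simps)
  then have A: "avg {i} 0 g = 0"
    by (intro eq_off_hyperplane[where i = i] smooth_avg g) auto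
  \<comment> \<open>Weight 1: the average is inverted by 1 plus the Euler operator in x_i.\<close>
  have "g x = avg {i} 0 g x + of_real (x $ i) * pd i (avg {i} 0 g) x" for x
    using avg_ftc[OF g, of x 1 "{i}"] by (simp add: pd_avg g scaleR_conv_of_real)
  then have "g = 0" by (simp add: A fun_eq_iff)
  then show ?thesis by (simp add: g_def)
qed simp

lemma power_fun_apply: "(f ^ n) x = (f x :: 'a::monoid_mult) ^ n"
  by (induction n) auto

lemma smooth_power: "smooth f \<Longrightarrow> smooth (f ^ n :: real ^ 'n::finite \<Rightarrow> 'k::real_normed_field)"
  by (induction n) (auto simp: one_fun_def intro!: smooth_mult)

text \<open>Coordinates \<open>x\<^sub>i\<close>, \<open>x\<^sub>j\<close> form a regular sequence in the ring of smooth functions.\<close>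
lemma coord_power_dvd:
  fixes g g' :: "real ^ 'n::finite \<Rightarrow> 'k::{real_normed_field,banach}"
  assumes "smooth g" "smooth g'" "i \<noteq> j"
    and "\<And>x. of_real (x $ j) ^ k * g x = of_real (x $ i) ^ n * g' x"
  shows "\<exists>h. smooth h \<and> (\<forall>x. g x = of_real (x $ i) ^ n * h x)"
  using assms
proof (induction n arbitrary: g)
  case (Suc n)
  \<comment> \<open>At x_i = 0 the right side of the hypothesis vanishes, so g is 0 there wherever
    x_j is not 0. Composing with \<open>dilate {i} 0\<close> turns this into a statement on the
    whole space, where density applies.\<close>
  have "g x = 0" if "x $ i = 0" for x
  proof -
    have "(\<lambda>x. g (dilate {i} 0 x)) = (\<lambda>x. 0)"
    proof (rule eq_off_hyperplane[where i = j])
      show "smooth (\<lambda>x. g (dilate {i} 0 x))"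
        unfolding comp_dilate_0[OF Suc.prems(1)]
        by (intro smooth_diff smooth_mult smooth_avg smooth_pd smooth_coord Suc.prems)
      fix x :: "real ^ 'n" assume "x $ j \<noteq> 0"
      then show "g (dilate {i} 0 x) = 0"
        using Suc.prems(4)[of "dilate {i} 0 x"] \<open>i \<noteq> j\<close> by (auto simp: dilate_def)
    qed simp
    from fun_cong[OF this, of x] have "g (dilate {i} 0 x) = 0" .
    moreover have "dilate {i} 0 x = x" using that by (simp add: dilate_def vec_eq_iff)
    ultimately show ?thesis by simp
  qed
  then have g: "g x = of_real (x $ i) * avg {i} 0 (pd i g) x" for x
    by (rule hadamard[OF Suc.prems(1)])
  have sm: "smooth (avg {i} 0 (pd i g))" using Suc.prems(1) by (intro smooth_avg smooth_pd)
  let ?c = "\<lambda>i. (\<lambda>x. of_real (x $ i) :: 'k)"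
  \<comment> \<open>One factor x_i cancels on both sides: \<open>n\<close> drops while
    \<open>k\<close> stays.\<close>
  have "?c j ^ k * avg {i} 0 (pd i g) = ?c i ^ n * g'"
  proof (rule eq_off_hyperplane[where i = i])
    fix x :: "real ^ 'n" assume "x $ i \<noteq> 0"
    then show "(?c j ^ k * avg {i} 0 (pd i g)) x = (?c i ^ n * g') x"
      using Suc.prems(4)[of x] g[of x] by (simp add: power_fun_apply)
  qed (use sm Suc.prems in \<open>auto intro!: smooth_mult smooth_power\<close>)
  then have "of_real (x $ j) ^ k * avg {i} 0 (pd i g) x = of_real (x $ i) ^ n * g' x" for x
    by (auto simp: fun_eq_iff power_fun_apply)
  from Suc.IH[OF sm Suc.prems(2,3) this] obtain h
    where "smooth h" "\<And>x. avg {i} 0 (pd i g) x = of_real (x $ i) ^ n * h x" by blast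
  with g show ?case by (intro exI[of _ h]) auto
qed auto

section \<open>The algebra of multivector fields\<close>

lemma sum_fun_apply: "(\<Sum>a\<in>A. f a) x = (\<Sum>a\<in>A. f a x)"
  by (induction A rule: infinite_finite_induct) auto

section \<open>Calculus of Koszul signs\<close>

lemma koszul_0 [simp]: "koszul m 0 = 0"
  by (simp add: koszul_def)

lemma koszul_zero [simp]: "koszul 0 v = v"
  by (simp add: koszul_def)

lemma koszul_koszul [simp]: "koszul m (koszul n v) = koszul (m + n) v"
  by (auto simp: koszul_def)

lemma koszul_add: "koszul m (v + w) = koszul m v + koszul m w"
  by (simp add: koszul_def)

lemma koszul_uminus: "koszul m (- v) = - koszul m v"
  by (simp add: koszul_def)

lemma koszul_diff: "koszul m (v - w) = koszul m v - koszul m w"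
  by (simp add: koszul_def)

lemma koszul_sum: "koszul m (\<Sum>a\<in>A. f a) = (\<Sum>a\<in>A. koszul m (f a))"
  by (simp add: koszul_def sum_negf)

lemma koszul_fun_apply [simp]: "koszul m f x = koszul m (f x)"
  by (simp add: koszul_def)

lemma koszul_mult_left: "koszul m a * b = koszul m (a * b :: 'a::ring)"
  by (simp add: koszul_def)

lemma koszul_mult_right: "a * koszul m b = koszul m (a * b :: 'a::ring)"
  by (simp add: koszul_def)

lemma minus_koszul: "- koszul m v = koszul (m + 1) v"
  by (simp add: koszul_def)

text \<open>Most sign identities below end here: collect the exponents on both sides and compare
  parities.\<close>

lemma koszul_parity: "even (m - n) \<Longrightarrow> koszul m v = koszul n v"
  by (auto simp: koszul_def)

lemma koszul_eq_0_iff [simp]: "koszul m v = 0 \<longleftrightarrow> v = 0"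
  by (simp add: koszul_def)

lemma smooth_koszul: "smooth f \<Longrightarrow> smooth (koszul m f)"
  by (simp add: koszul_def smooth_uminus)

lemma pd_koszul: "smooth f \<Longrightarrow> pd i (koszul m f) = koszul m (pd i f)"
  by (simp add: koszul_def pd_uminus)

text \<open>The exponent of the shuffle sign in \<open>wedge\<close>, named so that its additivity
  in both sets can be used.\<close>

definition inversions :: "'n::{finite,linorder} set \<Rightarrow> 'n set \<Rightarrow> int" where
  "inversions J K = int (card {(i, j). i \<in> J \<and> j \<in> K \<and> j < i})"

lemma inversions_empty [simp]: "inversions {} K = 0" "inversions J {} = 0"
  by (simp_all add: inversions_def)

lemma inversions_Un_left:
  assumes "J \<inter> J' = {}"
  shows "inversions (J \<union> J') K = inversions J K + inversions J' K"
proof -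
  have "{(i, j). i \<in> J \<union> J' \<and> j \<in> K \<and> j < i} =
      {(i, j). i \<in> J \<and> j \<in> K \<and> j < i} \<union> {(i, j). i \<in> J' \<and> j \<in> K \<and> j < i}" by auto
  then show ?thesis
    unfolding inversions_def using assms by (simp, subst card_Un_disjoint) auto
qed

lemma inversions_Un_right:
  assumes "K \<inter> K' = {}"
  shows "inversions J (K \<union> K') = inversions J K + inversions J K'"
proof -
  have "{(i, j). i \<in> J \<and> j \<in> K \<union> K' \<and> j < i} =
      {(i, j). i \<in> J \<and> j \<in> K \<and> j < i} \<union> {(i, j). i \<in> J \<and> j \<in> K' \<and> j < i}" by auto
  then show ?thesis
    unfolding inversions_def using assms by (simp, subst card_Un_disjoint) auto
qed

text \<open>A pair from \<open>J \<times> K\<close> is an inversion in exactly one of the two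
  orders. This is what makes \<open>wedge\<close> graded commutative.\<close>

lemma inversions_swap:
  assumes "J \<inter> K = {}"
  shows "inversions J K + inversions K J = int (card J) * int (card K)"
proof -
  have "card {(i, j). i \<in> K \<and> j \<in> J \<and> j < i} = card {(i, j). i \<in> J \<and> j \<in> K \<and> i < j}"
  proof -
    have "{(i, j). i \<in> K \<and> j \<in> J \<and> j < i} = prod.swap ` {(i, j). i \<in> J \<and> j \<in> K \<and> i < j}"
      by (force simp: image_iff)
    then show ?thesis by (simp add: card_image)
  qed
  moreover have "card (J \<times> K) = card {(i, j). i \<in> J \<and> j \<in> K \<and> j < i} + card {(i, j). i \<in> J \<and> j \<in> K \<and> i < j}"
    (is "_ = card ?A + card ?B")
  proof -
    have ne: "i \<noteq> j" if "i \<in> J" "j \<in> K" for i j using that assms by blast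
    have "J \<times> K = ?A \<union> ?B"
    proof (intro set_eqI iffI)
      fix z assume "z \<in> J \<times> K"
      then obtain i j where "z = (i, j)" "i \<in> J" "j \<in> K" by blast
      moreover from this have "i < j \<or> j < i" using ne[of i j] by (simp add: neq_iff)
      ultimately show "z \<in> ?A \<union> ?B" by auto
    qed fast
    moreover have "?A \<inter> ?B = {}" by fastforce
    ultimately show ?thesis by (simp only: card_Un_disjoint finite)
  qed
  moreover have "int (card J) * int (card K) = int (card (J \<times> K))"
    by (simp add: card_cartesian_product)
  ultimately show ?thesis
    by (simp only: inversions_def of_nat_add)
qed

section \<open>The exterior product\<close>

lemma wedge_eq:
  "wedge \<xi> \<eta> I = (\<Sum>J\<in>Pow I. koszul (inversions J (I - J)) (\<xi> J * \<eta> (I - J)))"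
  by (simp add: wedge_def fun_eq_iff sum_fun_apply inversions_def)

lemma wedge_add_left: "wedge (\<xi> + \<xi>') \<eta> = wedge \<xi> \<eta> + wedge \<xi>' \<eta>"
  by (rule ext) (simp add: wedge_eq koszul_add sum.distrib algebra_simps)

lemma wedge_add_right: "wedge \<xi> (\<eta> + \<eta>') = wedge \<xi> \<eta> + wedge \<xi> \<eta>'"
  by (rule ext) (simp add: wedge_eq koszul_add sum.distrib algebra_simps)

lemma wedge_0_left [simp]: "wedge 0 \<eta> = 0"
  by (rule ext) (simp add: wedge_eq)

lemma wedge_0_right [simp]: "wedge \<xi> 0 = 0"
  by (rule ext) (simp add: wedge_eq)

lemma wedge_uminus_left: "wedge (- \<xi>) \<eta> = - wedge \<xi> \<eta>"
  by (rule ext) (simp add: wedge_eq koszul_uminus sum_negf)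

lemma wedge_uminus_right: "wedge \<xi> (- \<eta>) = - wedge \<xi> \<eta>"
  by (rule ext) (simp add: wedge_eq koszul_uminus sum_negf)

lemma wedge_diff_right: "wedge \<xi> (\<eta> - \<eta>') = wedge \<xi> \<eta> - wedge \<xi> \<eta>'"
  using wedge_add_right[of \<xi> \<eta> "- \<eta>'"] by (simp add: wedge_uminus_right)

lemma wedge_koszul_left: "wedge (koszul m \<xi>) \<eta> = koszul m (wedge \<xi> \<eta>)"
  by (simp add: koszul_def wedge_uminus_left)

lemma wedge_koszul_right: "wedge \<xi> (koszul m \<eta>) = koszul m (wedge \<xi> \<eta>)"
  by (simp add: koszul_def wedge_uminus_right)

lemma wedge_sum_left: "wedge (\<Sum>a\<in>A. f a) \<eta> = (\<Sum>a\<in>A. wedge (f a) \<eta>)"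
  by (induction A rule: infinite_finite_induct) (simp_all only: sum.infinite sum.empty sum.insert wedge_0_left wedge_add_left not_False_eq_True)

lemma wedge_sum_right: "wedge \<xi> (\<Sum>a\<in>A. f a) = (\<Sum>a\<in>A. wedge \<xi> (f a))"
  by (induction A rule: infinite_finite_induct) (simp_all only: sum.infinite sum.empty sum.insert wedge_0_right wedge_add_right not_False_eq_True)

text \<open>Both sides are the sum over ordered partitions of \<open>I\<close> into three blocks,
  signed by the inversions between each two blocks.\<close>

lemma wedge_assoc: "wedge (wedge \<xi> \<eta>) \<zeta> = wedge \<xi> (wedge \<eta> \<zeta>)"
proof
  fix I
  let ?f = "\<lambda>J K. koszul (inversions J K + inversions J (I - J - K) + inversions K (I - J - K))
    (\<xi> J * (\<eta> K * \<zeta> (I - J - K)))"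
  have "wedge (wedge \<xi> \<eta>) \<zeta> I = (\<Sum>L\<in>Pow I. \<Sum>J\<in>Pow L. ?f J (L - J))"
  proof -
    have "koszul (inversions L (I - L)) (wedge \<xi> \<eta> L * \<zeta> (I - L)) = (\<Sum>J\<in>Pow L. ?f J (L - J))"
      if "L \<subseteq> I" for L
    proof -
      have "koszul (inversions L (I - L)) (koszul (inversions J (L - J)) (\<xi> J * \<eta> (L - J)) * \<zeta> (I - L))
        = ?f J (L - J)" if "J \<subseteq> L" for J
      proof -
        have "I - J - (L - J) = I - L" "J \<union> (L - J) = L" using that by auto
        with inversions_Un_left[of J "L - J" "I - L"] show ?thesis
          by (simp add: koszul_mult_left mult.assoc add.commute add.left_commute)
      qed
      then show ?thesis by (simp add: wedge_eq sum_distrib_right koszul_sum)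
    qed
    then show ?thesis by (simp add: wedge_eq[of "wedge \<xi> \<eta>"])
  qed
  also have "\<dots> = (\<Sum>(L, J)\<in>Sigma (Pow I) Pow. ?f J (L - J))"
    by (simp add: sum.Sigma)
  also have "\<dots> = (\<Sum>(J, K)\<in>Sigma (Pow I) (\<lambda>J. Pow (I - J)). ?f J K)"
    by (rule sum.reindex_bij_witness[where i = "\<lambda>(J, K). (J \<union> K, J)" and j = "\<lambda>(L, J). (J, L - J)"]) auto
  also have "\<dots> = (\<Sum>J\<in>Pow I. \<Sum>K\<in>Pow (I - J). ?f J K)"
    by (simp add: sum.Sigma)
  also have "\<dots> = wedge \<xi> (wedge \<eta> \<zeta>) I"
  proof -
    have "(\<Sum>K\<in>Pow (I - J). ?f J K) = koszul (inversions J (I - J)) (\<xi> J * wedge \<eta> \<zeta> (I - J))" for J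
    proof -
      have "?f J K = koszul (inversions J (I - J)) (\<xi> J * koszul (inversions K (I - J - K)) (\<eta> K * \<zeta> (I - J - K)))"
        if "K \<subseteq> I - J" for K
      proof -
        have "K \<union> (I - J - K) = I - J" using that by auto
        with inversions_Un_right[of K "I - J - K" J] show ?thesis
          by (simp add: koszul_mult_right algebra_simps)
      qed
      then show ?thesis by (simp add: wedge_eq sum_distrib_left koszul_sum)
    qed
    then show ?thesis by (simp add: wedge_eq[of \<xi>])
  qed
  finally show "wedge (wedge \<xi> \<eta>) \<zeta> I = wedge \<xi> (wedge \<eta> \<zeta>) I" .
qed

text \<open>The automorphism \<open>\<xi> \<mapsto> (-1)^(e |\<xi>|) \<xi>\<close>, which makes it possible to write the Koszul signs
  of inhomogeneous elements.\<close>
definition sg :: "int \<Rightarrow> ('n::finite, 'k::real_normed_field) mv \<Rightarrow> ('n, 'k) mv" where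
  "sg e \<xi> = (\<lambda>I. koszul (e * int (card I)) (\<xi> I))"

definition unit_mv :: "('n::finite, 'k::real_normed_field) mv" where
  "unit_mv = (\<lambda>I x. if I = {} then 1 else 0)"

lemma wedge_unit_left [simp]: "wedge unit_mv \<xi> = \<xi>"
proof
  fix I
  have "wedge unit_mv \<xi> I = (\<Sum>J\<in>Pow I. if J = {} then \<xi> I else 0)"
    unfolding wedge_eq by (intro sum.cong) (auto simp: unit_mv_def fun_eq_iff)
  then show "wedge unit_mv \<xi> I = \<xi> I" by simp
qed

lemma sg_0 [simp]: "sg e 0 = 0"
  by (simp add: sg_def fun_eq_iff)

lemma sg_unit [simp]: "sg e unit_mv = unit_mv"
  by (auto simp: sg_def unit_mv_def fun_eq_iff)

lemma sg_add: "sg e (\<xi> + \<eta>) = sg e \<xi> + sg e \<eta>"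
  by (simp add: sg_def fun_eq_iff koszul_add)

lemma sg_uminus: "sg e (- \<xi>) = - sg e \<xi>"
  by (simp add: sg_def fun_eq_iff koszul_uminus)

lemma sg_sum: "sg e (\<Sum>a\<in>A. f a) = (\<Sum>a\<in>A. sg e (f a))"
  by (induction A rule: infinite_finite_induct) (simp_all only: sum.infinite sum.empty sum.insert sg_0 sg_add not_False_eq_True)

lemma sg_koszul: "sg e (koszul m \<xi>) = koszul m (sg e \<xi>)"
  by (simp add: koszul_def sg_uminus)

lemma sg_sg: "sg e (sg f \<xi>) = sg (e + f) \<xi>"
  by (simp add: sg_def fun_eq_iff algebra_simps)

lemma sg_homogeneous:
  assumes "mv_degree m \<xi>"
  shows "sg e \<xi> = koszul (e * m) \<xi>"
proof
  fix I
  show "sg e \<xi> I = koszul (e * m) \<xi> I"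
    using assms by (cases "\<xi> I = 0") (auto simp: sg_def mv_degree_def)
qed

lemma sg_wedge: "sg e (wedge \<xi> \<eta>) = wedge (sg e \<xi>) (sg e \<eta>)"
proof
  fix I
  have "koszul (e * int (card I)) (koszul (inversions J (I - J)) (\<xi> J * \<eta> (I - J)))
    = koszul (inversions J (I - J)) (sg e \<xi> J * sg e \<eta> (I - J))" if "J \<subseteq> I" for J
  proof -
    have "int (card I) = int (card J) + int (card (I - J))"
      using that by (metis card_Diff_subset card_mono finite le_add_diff_inverse of_nat_add)
    then show ?thesis by (simp add: sg_def koszul_mult_left koszul_mult_right algebra_simps)
  qed
  then show "sg e (wedge \<xi> \<eta>) I = wedge (sg e \<xi>) (sg e \<eta>) I"
    by (simp add: wedge_eq sg_def[of e "wedge \<xi> \<eta>"] koszul_sum)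
qed

text \<open>\<open>inversions_swap\<close> gives the sign of each summand. Since \<open>sg\<close>
  carries it, only the first factor has to be homogeneous.\<close>

lemma wedge_commute:
  assumes "mv_degree m \<xi>"
  shows "wedge \<xi> \<eta> = wedge (sg m \<eta>) \<xi>"
proof
  fix I
  have "koszul (inversions J (I - J)) (\<xi> J * \<eta> (I - J))
    = koszul (inversions (I - J) J) (sg m \<eta> (I - J) * \<xi> J)" if "J \<subseteq> I" for J
  proof (cases "\<xi> J = 0")
    case False
    then have "m = int (card J)" using assms by (auto simp: mv_degree_def)
    moreover have *: "inversions J (I - J) + inversions (I - J) J = int (card J) * int (card (I - J))"
      by (rule inversions_swap) auto
    ultimately show ?thesis
      by (simp add: sg_def koszul_mult_left mult.commute[of "\<xi> J"] flip: *) (rule koszul_parity, simp)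
  qed simp
  then have "wedge \<xi> \<eta> I = (\<Sum>J\<in>Pow I. koszul (inversions (I - J) J) (sg m \<eta> (I - J) * \<xi> J))"
    by (simp add: wedge_eq)
  also have "\<dots> = (\<Sum>K\<in>Pow I. koszul (inversions K (I - K)) (sg m \<eta> K * \<xi> (I - K)))"
    by (rule sum.reindex_bij_witness[where i = "\<lambda>K. I - K" and j = "\<lambda>J. I - J"]) (auto simp: double_diff)
  finally show "wedge \<xi> \<eta> I = wedge (sg m \<eta>) \<xi> I" by (simp add: wedge_eq)
qed

section \<open>Homogeneity and smoothness of multivector fields\<close>

lemma mv_degree_0 [simp]: "mv_degree m 0"
  by (simp add: mv_degree_def)

lemma mv_degree_add: "mv_degree m \<xi> \<Longrightarrow> mv_degree m \<eta> \<Longrightarrow> mv_degree m (\<xi> + \<eta>)"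
  by (auto simp: mv_degree_def) (metis add_0)

lemma mv_degree_uminus: "mv_degree m \<xi> \<Longrightarrow> mv_degree m (- \<xi>)"
  by (auto simp: mv_degree_def)

lemma mv_degree_koszul: "mv_degree m \<xi> \<Longrightarrow> mv_degree m (koszul n \<xi>)"
  by (auto simp: mv_degree_def)

lemma mv_degree_sg: "mv_degree m \<xi> \<Longrightarrow> mv_degree m (sg e \<xi>)"
  by (auto simp: mv_degree_def sg_def)

lemma mv_degree_sum: "(\<And>a. a \<in> A \<Longrightarrow> mv_degree m (f a)) \<Longrightarrow> mv_degree m (sum f A)"
  by (induction A rule: infinite_finite_induct) (auto intro: mv_degree_add)

lemma mv_degree_unit [simp]: "mv_degree 0 unit_mv"
  by (auto simp: mv_degree_def unit_mv_def fun_eq_iff)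

lemma mv_degree_wedge:
  assumes "mv_degree m \<xi>" "mv_degree n \<eta>"
  shows "mv_degree (m + n) (wedge \<xi> \<eta>)"
  unfolding mv_degree_def
proof (intro allI impI)
  fix I assume "wedge \<xi> \<eta> I \<noteq> 0"
  then obtain J where J: "J \<subseteq> I" "koszul (inversions J (I - J)) (\<xi> J * \<eta> (I - J)) \<noteq> 0"
    unfolding wedge_eq by (metis (no_types, lifting) PowD sum.neutral)
  then have "\<xi> J \<noteq> 0" "\<eta> (I - J) \<noteq> 0" by auto
  then have "int (card J) = m" "int (card (I - J)) = n" using assms by (auto simp: mv_degree_def)
  with J(1) show "int (card I) = m + n"
    by (metis card_Diff_subset card_mono finite le_add_diff_inverse of_nat_add)
qed

lemma mvsD: "\<xi> \<in> mvs \<Longrightarrow> smooth (\<xi> I)"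
  by (simp add: mvs_def)

lemma mvs_0 [simp]: "0 \<in> mvs"
  by (simp add: mvs_def)

lemma mvs_unit [simp]: "unit_mv \<in> mvs"
  by (auto simp: mvs_def unit_mv_def)

lemma mvs_add: "\<xi> \<in> mvs \<Longrightarrow> \<eta> \<in> mvs \<Longrightarrow> \<xi> + \<eta> \<in> mvs"
  by (auto simp: mvs_def intro!: smooth_add)

lemma mvs_uminus: "\<xi> \<in> mvs \<Longrightarrow> - \<xi> \<in> mvs"
  by (auto simp: mvs_def intro!: smooth_uminus)

lemma mvs_diff: "\<xi> \<in> mvs \<Longrightarrow> \<eta> \<in> mvs \<Longrightarrow> \<xi> - \<eta> \<in> mvs"
  by (auto simp: mvs_def intro!: smooth_diff)

lemma mvs_koszul: "\<xi> \<in> mvs \<Longrightarrow> koszul m \<xi> \<in> mvs"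
  by (auto simp: mvs_def intro!: smooth_koszul)

lemma mvs_sg: "\<xi> \<in> mvs \<Longrightarrow> sg e \<xi> \<in> mvs"
  by (auto simp: mvs_def sg_def intro!: smooth_koszul)

lemma mvs_sum: "(\<And>a. a \<in> A \<Longrightarrow> f a \<in> mvs) \<Longrightarrow> sum f A \<in> mvs"
  by (induction A rule: infinite_finite_induct) (auto intro: mvs_add)

lemma mvs_wedge: "\<xi> \<in> mvs \<Longrightarrow> \<eta> \<in> mvs \<Longrightarrow> wedge \<xi> \<eta> \<in> mvs"
  by (auto simp: mvs_def wedge_eq intro!: smooth_sum smooth_koszul smooth_mult)

section \<open>Coordinate derivations\<close>

lemma dY_left_eq:
  "dY_left i \<xi> I = (if i \<in> I then 0 else koszul (inversions {i} I) (\<xi> (insert i I)))"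
proof -
  have "card {(k, j). k \<in> {i} \<and> j \<in> I \<and> j < k} = card {j \<in> I. j < i}"
  proof -
    have "{(k, j). k \<in> {i} \<and> j \<in> I \<and> j < k} = Pair i ` {j \<in> I. j < i}" by auto
    then show ?thesis by (simp add: card_image inj_on_def)
  qed
  then show ?thesis by (simp add: dY_left_def inversions_def)
qed

lemma dY_left_wedge:
  "dY_left i (wedge \<xi> \<eta>) = wedge (dY_left i \<xi>) \<eta> + wedge (sg 1 \<xi>) (dY_left i \<eta>)"
proof
  fix I
  let ?A = "\<lambda>J. koszul (inversions J (I - J)) (dY_left i \<xi> J * \<eta> (I - J))"
  let ?B = "\<lambda>J. koszul (inversions J (I - J)) (sg 1 \<xi> J * dY_left i \<eta> (I - J))"
  have rhs: "(wedge (dY_left i \<xi>) \<eta> + wedge (sg 1 \<xi>) (dY_left i \<eta>)) I = sum ?A (Pow I) + sum ?B (Pow I)"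
    by (simp add: wedge_eq)
  show "dY_left i (wedge \<xi> \<eta>) I = (wedge (dY_left i \<xi>) \<eta> + wedge (sg 1 \<xi>) (dY_left i \<eta>)) I"
  proof (cases "i \<in> I")
    \<comment> \<open>The left side is 0. On the right, the summand of the first product at
      \<open>J\<close> and that of the second at \<open>insert i J\<close> carry the same
      coefficients with opposite signs; all other summands vanish.\<close>
    case True
    define K where "K = I - {i}"
    have iK: "i \<notin> K" and I: "I = insert i K" using True by (auto simp: K_def)
    have Pow: "Pow I = Pow K \<union> insert i ` Pow K" "Pow K \<inter> insert i ` Pow K = {}"
      using iK by (auto simp: I Pow_insert)
    have inj: "inj_on (insert i) (Pow K)" using iK by (auto simp: inj_on_def)
    have A: "sum ?A (Pow I) = sum ?A (Pow K)"
      unfolding Pow(1) using Pow(2) by (subst sum.union_disjoint) (auto simp: dY_left_eq intro!: sum.neutral)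
    have B: "sum ?B (Pow I) = (\<Sum>J\<in>Pow K. ?B (insert i J))"
      unfolding Pow(1) using Pow(2) iK inj
      by (subst sum.union_disjoint) (auto simp: sum.reindex o_def I dY_left_eq intro!: sum.neutral)
    have "?A J + ?B (insert i J) = 0" if J: "J \<subseteq> K" for J
    proof -
      have iJ: "i \<notin> J" using J iK by auto
      have IJ: "I - J = insert i (K - J)" "I - insert i J = K - J" using iJ iK by (auto simp: I)
      have 1: "inversions J (insert i (K - J)) = inversions J {i} + inversions J (K - J)"
        using inversions_Un_right[of "{i}" "K - J" J] iK by simp
      have 2: "inversions (insert i J) (K - J) = inversions {i} (K - J) + inversions J (K - J)"
        using inversions_Un_left[of "{i}" J "K - J"] iJ by simp
      have 3: "inversions {i} J + inversions J {i} = int (card J)"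
        using inversions_swap[of "{i}" J] iJ by simp
      have A: "?A J = koszul (inversions J (K - J) + int (card J)) (\<xi> (insert i J) * \<eta> (insert i (K - J)))"
        using iJ 3 by (simp add: dY_left_eq IJ 1 koszul_mult_left add_ac)
      have "?B (insert i J) = koszul (2 * inversions {i} (K - J) + inversions J (K - J) + int (card J) + 1)
          (\<xi> (insert i J) * \<eta> (insert i (K - J)))"
        using iJ iK by (simp add: dY_left_eq IJ 2 koszul_mult_left koszul_mult_right sg_def algebra_simps)
      also have "\<dots> = - ?A J" unfolding A minus_koszul by (rule koszul_parity) simp
      finally show ?thesis by simp
    qed
    then have "sum ?A (Pow K) + (\<Sum>J\<in>Pow K. ?B (insert i J)) = 0"
      by (simp add: sum.distrib[symmetric])
    with True show ?thesis unfolding rhs A B by (simp add: dY_left_eq)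
  next
    \<comment> \<open>The subsets of \<open>insert i I\<close> that contain \<open>i\<close> give
      the first product, the others the second.\<close>
    case False
    let ?W = "\<lambda>J. koszul (inversions {i} I + inversions J (insert i I - J)) (\<xi> J * \<eta> (insert i I - J))"
    have Pow: "Pow (insert i I) = Pow I \<union> insert i ` Pow I" "Pow I \<inter> insert i ` Pow I = {}"
      using False by (auto simp: Pow_insert)
    have inj: "inj_on (insert i) (Pow I)" using False by (auto simp: inj_on_def)
    have "dY_left i (wedge \<xi> \<eta>) I = sum ?W (Pow (insert i I))"
      using False by (simp add: dY_left_eq wedge_eq koszul_sum)
    also have "\<dots> = sum ?W (Pow I) + (\<Sum>J\<in>Pow I. ?W (insert i J))"
      unfolding Pow(1) using Pow(2) inj by (subst sum.union_disjoint) (auto simp: sum.reindex)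
    also have "(\<Sum>J\<in>Pow I. ?W (insert i J)) = sum ?A (Pow I)"
    proof (rule sum.cong[OF refl])
      fix J assume "J \<in> Pow I"
      then have J: "J \<subseteq> I" "i \<notin> J" using False by auto
      have 0: "insert i I - insert i J = I - J" using J False by auto
      have 1: "inversions (insert i J) (I - J) = inversions {i} (I - J) + inversions J (I - J)"
        using inversions_Un_left[of "{i}" J "I - J"] J by simp
      have "J \<union> (I - J) = I" using J by auto
      then have 2: "inversions {i} I = inversions {i} J + inversions {i} (I - J)"
        using inversions_Un_right[of J "I - J" "{i}"] by simp
      show "?W (insert i J) = ?A J"
        using J by (simp add: 0 1 2 dY_left_eq koszul_mult_left) (rule koszul_parity, simp)
    qed
    also have "sum ?W (Pow I) = sum ?B (Pow I)"
    proof (rule sum.cong[OF refl])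
      fix J assume "J \<in> Pow I"
      then have J: "J \<subseteq> I" "i \<notin> J" using False by auto
      have 0: "insert i I - J = insert i (I - J)" using J False by auto
      have 1: "inversions J (insert i (I - J)) = inversions J {i} + inversions J (I - J)"
        using inversions_Un_right[of "{i}" "I - J" J] False by simp
      have "J \<union> (I - J) = I" using J by auto
      then have 2: "inversions {i} I = inversions {i} J + inversions {i} (I - J)"
        using inversions_Un_right[of J "I - J" "{i}"] by simp
      have 3: "int (card J) = inversions {i} J + inversions J {i}"
        using inversions_swap[of "{i}" J] J by simp
      show "?W J = ?B J"
        using J False by (simp add: 0 1 2 3 dY_left_eq sg_def koszul_mult_left koszul_mult_right algebra_simps)
    qed
    finally show ?thesis unfolding rhs by (simp only: add.commute)
  qed
qed

lemma dY_left_commute: "dY_left i (dY_left j \<xi>) = - dY_left j (dY_left i \<xi>)"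
proof
  fix I
  show "dY_left i (dY_left j \<xi>) I = (- dY_left j (dY_left i \<xi>)) I"
  proof (cases "i = j \<or> i \<in> I \<or> j \<in> I")
    case True
    then show ?thesis by (auto simp: dY_left_eq)
  next
    case False
    have 1: "inversions {i} (insert j I) = inversions {i} {j} + inversions {i} I"
        and 2: "inversions {j} (insert i I) = inversions {j} {i} + inversions {j} I"
      using False inversions_Un_right[of "{j}" I "{i}"] inversions_Un_right[of "{i}" I "{j}"] by auto
    have 3: "inversions {i} {j} = 1 - inversions {j} {i}"
      using False inversions_swap[of "{i}" "{j}"] by simp
    show ?thesis
      using False by (auto simp: dY_left_eq 1 2 3 minus_koszul insert_commute[of i] intro!: koszul_parity)
  qed
qed

text \<open>By \<open>dc_Inl\<close> and \<open>dc_Inr\<close> these are, up to sign, the coordinate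
  derivations, with each coordinate exchanged for its conjugate.\<close>

abbreviation dc :: "'n::{finite,linorder} + 'n \<Rightarrow> ('n, 'k::real_normed_field) mv \<Rightarrow> ('n, 'k) mv" where
  "dc c \<equiv> schouten (coord c)"

text \<open>Also the degree of \<open>dc c\<close> as a derivation.\<close>

definition gam :: "'n::finite + 'n \<Rightarrow> int" where
  "gam c = coord_degree c - 1"

lemma gam_simps [simp]: "gam (Inl i) = - 1" "gam (Inr i) = 0"
  by (simp_all add: gam_def coord_degree_def)

lemma dX_coord_Inl: "dX i (coord (Inl j)) = (if i = j then unit_mv else 0)"
  by (intro ext, auto simp: dX_def coord_def unit_mv_def pd_coord pd_const)

lemma dX_coord_Inr: "dX i (coord (Inr j)) = 0"
  by (intro ext) (simp add: dX_def coord_def pd_const)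

lemma dY_right_coord: "dY_right i (coord (Inl j)) = 0"
  "dY_right i (coord (Inr j)) = (if i = j then unit_mv else 0)"
  by (auto simp: dY_right_def coord_def unit_mv_def fun_eq_iff)

lemma dc_Inl: "dc (Inl j) \<xi> = - dY_left j \<xi>"
proof -
  have "dc (Inl j) \<xi> = (\<Sum>i\<in>UNIV. if i = j then - dY_left j \<xi> else 0)"
    unfolding schouten_def by (intro sum.cong) (auto simp: dX_coord_Inl dY_right_coord)
  then show ?thesis by simp
qed

lemma dc_Inr: "dc (Inr j) \<xi> = dX j \<xi>"
proof -
  have "dc (Inr j) \<xi> = (\<Sum>i\<in>UNIV. if i = j then dX j \<xi> else 0)"
    unfolding schouten_def by (intro sum.cong) (auto simp: dX_coord_Inr dY_right_coord)
  then show ?thesis by simp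
qed

lemma dc_add:
  assumes "\<xi> \<in> mvs" "\<eta> \<in> mvs"
  shows "dc c (\<xi> + \<eta>) = dc c \<xi> + dc c \<eta>"
  using assms by (cases c)
    (auto simp: dc_Inl dc_Inr dX_def dY_left_eq fun_eq_iff pd_add mvsD koszul_add)

lemma dc_uminus:
  assumes "\<xi> \<in> mvs"
  shows "dc c (- \<xi>) = - dc c \<xi>"
  using assms by (cases c)
    (auto simp: dc_Inl dc_Inr dX_def dY_left_eq fun_eq_iff pd_uminus mvsD koszul_uminus)

lemma dc_0 [simp]: "dc c 0 = 0"
  by (cases c) (auto simp: dc_Inl dc_Inr dX_def dY_left_eq fun_eq_iff)

lemma dc_koszul: "\<xi> \<in> mvs \<Longrightarrow> dc c (koszul m \<xi>) = koszul m (dc c \<xi>)"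
  by (simp add: koszul_def dc_uminus)

lemma mvs_dc: "\<xi> \<in> mvs \<Longrightarrow> dc c \<xi> \<in> mvs"
  by (cases c) (auto simp: mvs_def dc_Inl dc_Inr dX_def dY_left_eq intro!: smooth_uminus smooth_pd smooth_koszul)

lemma dc_diff: "\<xi> \<in> mvs \<Longrightarrow> \<eta> \<in> mvs \<Longrightarrow> dc c (\<xi> - \<eta>) = dc c \<xi> - dc c \<eta>"
  using dc_add[of \<xi> "- \<eta>" c] by (simp add: dc_uminus mvs_uminus)

lemma dc_sum: "(\<And>a. a \<in> A \<Longrightarrow> f a \<in> mvs) \<Longrightarrow> dc c (sum f A) = (\<Sum>a\<in>A. dc c (f a))"
  by (induction A rule: infinite_finite_induct) (auto simp: dc_add mvs_sum)

lemma dc_wedge: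
  assumes "\<xi> \<in> mvs" "\<eta> \<in> mvs"
  shows "dc c (wedge \<xi> \<eta>) = wedge (dc c \<xi>) \<eta> + wedge (sg (gam c) \<xi>) (dc c \<eta>)"
proof (cases c)
  case (Inl i)
  have "sg (- 1) \<xi> = sg 1 \<xi>" by (auto simp: sg_def fun_eq_iff intro!: koszul_parity)
  then show ?thesis
    by (simp add: Inl dc_Inl dY_left_wedge wedge_uminus_left wedge_uminus_right)
next
  case (Inr i)
  have "sg 0 \<xi> = \<xi>" by (simp add: sg_def)
  moreover have "pd i (wedge \<xi> \<eta> I) = wedge (dX i \<xi>) \<eta> I + wedge \<xi> (dX i \<eta>) I" for I
    using assms unfolding wedge_eq dX_def
    by (simp add: pd_sum pd_koszul pd_mult smooth_koszul smooth_mult mvsD koszul_add sum.distrib)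
  ultimately show ?thesis
    by (auto simp: Inr dc_Inr dX_def[of _ "wedge \<xi> \<eta>"])
qed

lemma dc_sg:
  fixes \<xi> :: "('n::{finite,linorder}, 'k::real_normed_field) mv"
  shows "\<xi> \<in> mvs \<Longrightarrow> dc c (sg e \<xi>) = koszul (gam c * e) (sg e (dc c \<xi>))"
proof (cases c)
  case (Inl i)
  have "koszul (inversions {i} I + e * (1 + int (card I))) v
      = koszul (e * int (card I) - e + inversions {i} I) v" if "i \<notin> I" for I and v :: "(real, 'n) vec \<Rightarrow> 'k"
    using that by (intro koszul_parity) (auto simp: algebra_simps)
  then show ?thesis
    by (auto simp: Inl dc_Inl dY_left_eq sg_def koszul_uminus intro!: ext)
next
  case (Inr i)
  assume "\<xi> \<in> mvs"
  then show ?thesis by (simp add: Inr dc_Inr dX_def sg_def fun_eq_iff pd_koszul mvsD)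
qed

lemma dc_commute:
  fixes \<xi> :: "('n::{finite,linorder}, 'k::{real_normed_field,banach}) mv"
  assumes "\<xi> \<in> mvs"
  shows "dc c (dc c' \<xi>) = koszul (gam c * gam c') (dc c' (dc c \<xi>))"
proof -
  have XY: "dX i (dY_left j \<xi>) = dY_left j (dX i \<xi>)" for i j
    using assms by (auto simp: dX_def dY_left_eq fun_eq_iff pd_koszul mvsD)
  have XX: "dX i (dX j \<xi>) = dX j (dX i \<xi>)" for i j
    unfolding dX_def using pd_commute[OF mvsD[OF assms]] by (intro ext) metis
  have mY: "dY_left j \<xi> \<in> mvs" for j
    using assms by (auto simp: mvs_def dY_left_eq intro!: smooth_koszul)
  have X: "dX i (- dY_left j \<xi>) = - dX i (dY_left j \<xi>)" for i j
    by (intro ext) (simp add: dX_def pd_uminus mvsD mY)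
  have Y: "dY_left i (- \<eta>) = - dY_left i \<eta>" for i and \<eta> :: "('n, 'k) mv"
    by (intro ext) (simp add: dY_left_eq koszul_uminus)
  have odd: "koszul 1 v = - v" for v :: "('n, 'k) mv"
    by (simp add: koszul_def)
  show ?thesis
  proof (cases c; cases c')
    fix i j assume "c = Inl i" "c' = Inl j"
    then show ?thesis using dY_left_commute[of i j \<xi>] by (simp add: dc_Inl Y odd)
  next
    fix i j assume "c = Inr i" "c' = Inr j"
    then show ?thesis using XX[of i j] by (simp add: dc_Inr)
  next
    fix i j assume "c = Inl i" "c' = Inr j"
    then show ?thesis by (simp add: dc_Inl dc_Inr X XY)
  next
    fix i j assume "c = Inr i" "c' = Inl j"
    then show ?thesis by (simp add: dc_Inl dc_Inr X XY)
  qed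
qed

lemma mv_degree_dc: "mv_degree m \<xi> \<Longrightarrow> mv_degree (m + gam c) (dc c \<xi>)"
proof (cases c)
  case (Inl i)
  assume "mv_degree m \<xi>"
  then show ?thesis by (auto simp: Inl dc_Inl mv_degree_def dY_left_eq)
next
  case (Inr i)
  assume "mv_degree m \<xi>"
  then show ?thesis by (auto simp: Inr dc_Inr mv_degree_def dX_def) (metis pd_0)
qed

section \<open>The action of forms\<close>

text \<open>A flat connection for which the differentials of the coordinates are parallel. It is
  torsion-free in the sense that \<open>form_bracket\<close> is its graded commutator, which drives
  the Chevalley-Eilenberg computation.\<close>

definition nabla :: "('n::{finite,linorder}, 'k::real_normed_field) form \<Rightarrow> ('n, 'k) form \<Rightarrow> ('n, 'k) form" where
  "nabla A B = (\<lambda>c. act A (B c))"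

lemma formsD: "A \<in> forms \<Longrightarrow> A c \<in> mvs"
  by (simp add: forms_def)

lemma form_degree_mv_degree: "form_degree p A \<Longrightarrow> mv_degree (p - 1 - gam c) (A c)"
  by (force simp: form_degree_def mv_degree_def gam_def)

lemma mvs_act: "A \<in> forms \<Longrightarrow> \<eta> \<in> mvs \<Longrightarrow> act A \<eta> \<in> mvs"
  by (auto simp: act_def intro!: mvs_sum mvs_wedge mvs_dc dest: formsD)

lemma forms_nabla: "A \<in> forms \<Longrightarrow> B \<in> forms \<Longrightarrow> nabla A B \<in> forms"
  by (auto simp: forms_def nabla_def intro!: mvs_act)

lemma act_add: "\<xi> \<in> mvs \<Longrightarrow> \<eta> \<in> mvs \<Longrightarrow> act A (\<xi> + \<eta>) = act A \<xi> + act A \<eta>"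
  by (simp add: act_def dc_add wedge_add_right sum.distrib)

lemma act_0 [simp]: "act A 0 = 0"
  by (simp add: act_def)

lemma act_0_left [simp]: "act 0 \<eta> = 0"
  by (simp add: act_def)

lemma act_sum: "(\<And>a. a \<in> S \<Longrightarrow> f a \<in> mvs) \<Longrightarrow> act A (sum f S) = (\<Sum>a\<in>S. act A (f a))"
  by (induction S rule: infinite_finite_induct) (auto simp: act_add mvs_sum)

text \<open>The coefficient, of degree \<open>p - 1 - gam c\<close>, and the derivation
  \<open>dc c\<close>, of degree \<open>gam c\<close>, both have to pass \<xi>; their signs combine
  to that of degree \<open>p - 1\<close>.\<close>

lemma act_wedge:
  assumes "form_degree p A" "\<xi> \<in> mvs" "\<eta> \<in> mvs"
  shows "act A (wedge \<xi> \<eta>) = wedge (act A \<xi>) \<eta> + wedge (sg (p - 1) \<xi>) (act A \<eta>)"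
proof -
  have "wedge (A c) (wedge (sg (gam c) \<xi>) (dc c \<eta>)) = wedge (sg (p - 1) \<xi>) (wedge (A c) (dc c \<eta>))" for c
    using wedge_commute[OF form_degree_mv_degree[OF assms(1), of c], of "sg (gam c) \<xi>"]
    by (simp add: sg_sg flip: wedge_assoc)
  then show ?thesis
    using assms(2,3) by (simp add: act_def dc_wedge wedge_add_right sum.distrib wedge_sum_left wedge_sum_right wedge_assoc)
qed

lemma act_sg:
  assumes "form_degree p A" "\<xi> \<in> mvs"
  shows "act A (sg e \<xi>) = koszul ((p - 1) * e) (sg e (act A \<xi>))"
proof -
  have "wedge (A c) (koszul (gam c * e) (sg e (dc c \<xi>))) = koszul ((p - 1) * e) (wedge (sg e (A c)) (sg e (dc c \<xi>)))" for c
    unfolding sg_homogeneous[OF form_degree_mv_degree[OF assms(1), of c]] wedge_koszul_left wedge_koszul_right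
    by simp (rule koszul_parity, simp add: algebra_simps)
  then show ?thesis
    using assms(2) by (simp add: act_def dc_sg sg_sum sg_wedge koszul_sum)
qed

lemma mv_degree_act:
  assumes "form_degree p A" "mv_degree m \<xi>"
  shows "mv_degree (p - 1 + m) (act A \<xi>)"
proof -
  have "mv_degree (p - 1 - gam c + (m + gam c)) (wedge (A c) (dc c \<xi>))" for c
    by (intro mv_degree_wedge mv_degree_dc assms form_degree_mv_degree)
  then show ?thesis unfolding act_def by (intro mv_degree_sum) (simp add: algebra_simps)
qed

lemma form_degree_iff: "form_degree p A \<longleftrightarrow> (\<forall>c. mv_degree (p - 1 - gam c) (A c))"
  by (simp add: form_degree_def mv_degree_def gam_def eq_diff_eq)

lemma form_degree_nabla:
  assumes "form_degree p A" "form_degree q B"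
  shows "form_degree (p + q - 1) (nabla A B)"
  using mv_degree_act[OF assms(1) form_degree_mv_degree[OF assms(2)]]
  by (auto simp: form_degree_iff nabla_def algebra_simps)

lemmas fun_ops = plus_fun_apply zero_fun_apply times_fun_apply one_fun_apply minus_apply uminus_apply koszul_fun_apply

section \<open>Adapted multivector fields and forms\<close>

text \<open>These are x' and y'', whose differentials survive on the subspace; the remaining
  coordinates, x'' and y', generate the ideal and are called normal below.\<close>

definition tangential :: "'n::finite set \<Rightarrow> 'n + 'n \<Rightarrow> bool" where
  "tangential N c = (case c of Inl i \<Rightarrow> i \<notin> N | Inr i \<Rightarrow> i \<in> N)"

lemma adapted_iff:
  "\<xi> \<in> adapted N \<longleftrightarrow> \<xi> \<in> mvs \<and> (\<forall>I x. I \<subseteq> N \<longrightarrow> x \<in> submfd N \<longrightarrow> \<xi> I x = 0)"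
  by (auto simp: adapted_def proj_mv_def fun_eq_iff)

lemma adapted_mvs: "\<xi> \<in> adapted N \<Longrightarrow> \<xi> \<in> mvs"
  by (simp add: adapted_iff)

lemma adapted_0 [simp]: "0 \<in> adapted N"
  by (simp add: adapted_iff)

lemma adapted_add: "\<xi> \<in> adapted N \<Longrightarrow> \<eta> \<in> adapted N \<Longrightarrow> \<xi> + \<eta> \<in> adapted N"
  by (simp add: adapted_iff mvs_add)

lemma adapted_uminus: "\<xi> \<in> adapted N \<Longrightarrow> - \<xi> \<in> adapted N"
  by (simp add: adapted_iff mvs_uminus)

lemma adapted_diff: "\<xi> \<in> adapted N \<Longrightarrow> \<eta> \<in> adapted N \<Longrightarrow> \<xi> - \<eta> \<in> adapted N"
  by (simp add: adapted_iff mvs_diff)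

lemma adapted_koszul: "\<xi> \<in> adapted N \<Longrightarrow> koszul m \<xi> \<in> adapted N"
  by (simp add: koszul_def adapted_uminus)

lemma adapted_sg: "\<xi> \<in> adapted N \<Longrightarrow> sg e \<xi> \<in> adapted N"
  by (simp add: adapted_iff mvs_sg) (simp add: sg_def)

lemma adapted_sum: "(\<And>a. a \<in> A \<Longrightarrow> f a \<in> adapted N) \<Longrightarrow> sum f A \<in> adapted N"
  by (induction A rule: infinite_finite_induct) (auto intro: adapted_add)

lemma adapted_wedge_left: "\<xi> \<in> adapted N \<Longrightarrow> \<eta> \<in> mvs \<Longrightarrow> wedge \<xi> \<eta> \<in> adapted N"
  by (simp add: adapted_iff mvs_wedge) (auto simp: wedge_def intro!: sum.neutral)

lemma adapted_wedge_right:
  assumes "\<xi> \<in> mvs" "\<eta> \<in> adapted N"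
  shows "wedge \<xi> \<eta> \<in> adapted N"
proof -
  have "\<eta> (I - J) x = 0" if "I \<subseteq> N" "x \<in> submfd N" for I J x
    using assms(2) that Diff_subset[of I J] subset_trans by (simp add: adapted_iff) blast
  with assms show ?thesis
    by (simp add: adapted_iff mvs_wedge) (simp add: wedge_def)
qed

text \<open>Because conjugate coordinates are exchanged, a coordinate from the ideal acts by a
  derivative along the subspace, in y'' or x', and such a derivative preserves vanishing
  there.\<close>

lemma adapted_dc:
  assumes "\<not> tangential N c" "\<xi> \<in> adapted N"
  shows "dc c \<xi> \<in> adapted N"
proof (cases c)
  case (Inl i)
  with assms show ?thesis
    by (simp add: adapted_iff mvs_dc tangential_def) (auto simp: dc_Inl dY_left_eq)
next
  case (Inr i)
  then have i: "i \<notin> N" using assms by (simp add: tangential_def)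
  have "pd i (\<xi> I) x = 0" if "I \<subseteq> N" "x \<in> submfd N" for I x
  proof -
    have "smooth (\<xi> I)" using assms by (simp add: adapted_iff mvsD)
    then have "(\<xi> I has_derivative frechet_derivative (\<xi> I) (at x)) (at (x + 0 *\<^sub>R axis i 1))"
      using frechet_derivative_works smooth_differentiable by fastforce
    moreover have "((\<lambda>t. x + t *\<^sub>R axis i 1) has_derivative (\<lambda>t. t *\<^sub>R axis i 1)) (at 0)"
      by (auto intro!: derivative_eq_intros)
    ultimately have "((\<lambda>t. \<xi> I (x + t *\<^sub>R axis i 1)) has_derivative
        (\<lambda>t. frechet_derivative (\<xi> I) (at x) (t *\<^sub>R axis i 1))) (at 0)"
      using has_derivative_compose by fastforce
    moreover have "x + t *\<^sub>R axis i 1 \<in> submfd N" for t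
      using that i by (auto simp: submfd_def axis_def)
    then have "(\<lambda>t. \<xi> I (x + t *\<^sub>R axis i 1)) = (\<lambda>t. 0)"
      using assms that by (simp add: adapted_iff)
    ultimately have "((\<lambda>t. 0) has_derivative (\<lambda>t. frechet_derivative (\<xi> I) (at x) (t *\<^sub>R axis i 1))) (at (0::real))"
      by simp
    then have "(\<lambda>t. frechet_derivative (\<xi> I) (at x) (t *\<^sub>R axis i 1)) = (\<lambda>t. 0)"
      using has_derivative_unique has_derivative_const by blast
    from fun_cong[OF this, of 1] show ?thesis by (simp add: pd_def)
  qed
  then show ?thesis
    using assms by (simp add: Inr adapted_iff mvs_dc) (simp add: dc_Inr dX_def)
qed

lemma adapted_forms_iff:
  "A \<in> adapted_forms N \<longleftrightarrow> A \<in> forms \<and> (\<forall>c. tangential N c \<longrightarrow> A c \<in> adapted N)"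
proof -
  have "proj_form N A = 0 \<longleftrightarrow> (\<forall>c. tangential N c \<longrightarrow> proj_mv N (A c) = 0)"
    by (auto simp: proj_form_def tangential_def fun_eq_iff split: sum.splits)
  then show ?thesis by (auto simp: adapted_forms_def adapted_def forms_def)
qed

lemma adapted_forms_forms: "A \<in> adapted_forms N \<Longrightarrow> A \<in> forms"
  by (simp add: adapted_forms_iff)

lemma forms_0 [simp]: "0 \<in> forms"
  by (simp add: forms_def)

lemma forms_add: "A \<in> forms \<Longrightarrow> B \<in> forms \<Longrightarrow> A + B \<in> forms"
  by (simp add: forms_def mvs_add)

lemma adapted_forms_0 [simp]: "0 \<in> adapted_forms N"
  by (simp add: adapted_forms_iff)

lemma adapted_forms_add:
  "A \<in> adapted_forms N \<Longrightarrow> B \<in> adapted_forms N \<Longrightarrow> A + B \<in> adapted_forms N"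
  by (simp add: adapted_forms_iff forms_add adapted_add)

lemma adapted_forms_sum: "(\<And>a. a \<in> S \<Longrightarrow> f a \<in> adapted_forms N) \<Longrightarrow> sum f S \<in> adapted_forms N"
  by (induction S rule: infinite_finite_induct) (auto intro: adapted_forms_add)

lemma forms_fmult: "f \<in> mvs \<Longrightarrow> A \<in> forms \<Longrightarrow> fmult f A \<in> forms"
  by (simp add: forms_def fmult_def mvs_wedge)

lemma adapted_forms_fmult: "f \<in> mvs \<Longrightarrow> A \<in> adapted_forms N \<Longrightarrow> fmult f A \<in> adapted_forms N"
  by (simp add: adapted_forms_iff forms_fmult) (simp add: fmult_def adapted_wedge_right)

lemma fmult_adapted: "f \<in> adapted N \<Longrightarrow> A \<in> forms \<Longrightarrow> fmult f A \<in> adapted_forms N"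
  by (auto simp: adapted_forms_iff forms_fmult adapted_mvs) (simp add: fmult_def adapted_wedge_left formsD)

lemma form_part_forms: "A \<in> forms \<Longrightarrow> form_part p A \<in> forms"
  by (simp add: forms_def mvs_def form_part_def)

lemma form_part_adapted: "A \<in> adapted_forms N \<Longrightarrow> form_part p A \<in> adapted_forms N"
  by (simp add: adapted_forms_iff form_part_forms) (simp add: adapted_iff form_part_def mvs_def)

text \<open>Summand by summand: for tangential \<open>c\<close> the coefficient of the form lies in
  the ideal, for normal \<open>c\<close> the derivation preserves the ideal.\<close>

lemma act_adapted:
  assumes "A \<in> adapted_forms N" "\<eta> \<in> adapted N"
  shows "act A \<eta> \<in> adapted N"
  unfolding act_def
proof (rule adapted_sum)
  fix c
  have "A c \<in> mvs" "\<eta> \<in> mvs" using assms adapted_forms_forms adapted_mvs formsD by blast+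
  then show "wedge (A c) (dc c \<eta>) \<in> adapted N"
    using assms by (cases "tangential N c")
      (auto intro: adapted_wedge_left adapted_wedge_right adapted_dc mvs_dc simp: adapted_forms_iff)
qed

lemma nabla_adapted: "A \<in> adapted_forms N \<Longrightarrow> B \<in> adapted_forms N \<Longrightarrow> nabla A B \<in> adapted_forms N"
  by (simp add: adapted_forms_iff[of "nabla A B"] forms_nabla adapted_forms_forms)
    (simp add: nabla_def act_adapted adapted_forms_iff[of B])

section \<open>Homogeneous parts of forms and the bracket\<close>

lemma form_degree_part: "form_degree p (form_part p A)"
  by (auto simp: form_degree_def form_part_def)

lemma form_part_homogeneous: "form_degree p A \<Longrightarrow> form_part q A = (if q = p then A else 0)"
proof (intro ext)
  fix c I x
  assume "form_degree p A"
  then have "A c I = 0 \<or> int (card I) + coord_degree c = p" by (auto simp: form_degree_def)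
  then show "form_part q A c I x = (if q = p then A else 0) c I x" by (auto simp: form_part_def)
qed

lemma sum_form_part:
  "(\<Sum>p\<in>form_degrees TYPE('n). form_part p A) = (A :: ('n::finite, 'k::real_normed_field) form)"
proof (intro ext)
  fix c :: "'n + 'n" and I :: "'n set" and x :: "(real, 'n) vec"
  have "int (card I) + coord_degree c \<in> form_degrees TYPE('n)"
    using card_mono[of "UNIV :: 'n set" I] by (cases c) (auto simp: coord_degree_def)
  moreover have "(\<Sum>p\<in>form_degrees TYPE('n). form_part p A) c I x =
      (\<Sum>p\<in>form_degrees TYPE('n). if p = int (card I) + coord_degree c then A c I x else 0)"
    unfolding sum_fun_apply by (intro sum.cong) (auto simp: form_part_def)
  ultimately show "(\<Sum>p\<in>form_degrees TYPE('n). form_part p A) c I x = A c I x"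
    by simp
qed

definition koszul_form_diff :: "int \<Rightarrow> ('n::finite, 'k::real_normed_field) form \<Rightarrow> ('n, 'k) form \<Rightarrow> ('n, 'k) form" where
  "koszul_form_diff m A B = (\<lambda>c. A c - koszul m (B c))"

lemma form_bracket_homogeneous:
  fixes A B :: "('n::{finite,linorder}, 'k::real_normed_field) form"
  assumes "form_degree p A" "form_degree q B" "p \<in> form_degrees TYPE('n)" "q \<in> form_degrees TYPE('n)"
  shows "form_bracket A B = koszul_form_diff ((p - 1) * (q - 1)) (nabla A B) (nabla B A)"
proof -
  let ?g = "\<lambda>p' q'. (\<lambda>c. act (form_part p' A) (form_part q' B c)
        - koszul ((p' - 1) * (q' - 1)) (act (form_part q' B) (form_part p' A c)))"
  have g: "?g p' q' = (if q' = q then if p' = p then ?g p q else 0 else 0)" for p' q'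
    using assms(1,2) by (intro ext) (auto simp: form_part_homogeneous)
  have "form_bracket A B = (\<Sum>p'\<in>form_degrees TYPE('n). \<Sum>q'\<in>form_degrees TYPE('n).
      if q' = q then if p' = p then ?g p q else 0 else 0)"
    unfolding form_bracket_def by (intro sum.cong refl g)
  also have "\<dots> = ?g p q" using assms(3,4) by simp
  finally show ?thesis
    using assms(1,2) by (simp add: form_part_homogeneous koszul_form_diff_def nabla_def)
qed

lemma koszul_form_diff_adapted:
  "A \<in> adapted_forms N \<Longrightarrow> B \<in> adapted_forms N \<Longrightarrow> koszul_form_diff m A B \<in> adapted_forms N"
  by (simp add: adapted_forms_iff forms_def koszul_form_diff_def mvs_diff mvs_koszul adapted_diff adapted_koszul)

section \<open>Alternating tensors in coordinates\<close>

\<comment> \<open>These rules make the simplifier expand equations between multivector fields pointwise.\<close>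
declare fun_ops [simp del]

text \<open>One slot of the pairing: \<open>sg e\<close> is the sign for taking the coefficient
  \<open>A c\<close> out past a map of degree \<open>e\<close>.\<close>

definition hsum :: "int \<Rightarrow> ('n::{finite,linorder}, 'k::real_normed_field) form \<Rightarrow> ('n + 'n \<Rightarrow> ('n, 'k) mv) \<Rightarrow> ('n, 'k) mv" where
  "hsum e A g = (\<Sum>c\<in>UNIV. wedge (sg e (A c)) (g c))"

text \<open>\<open>pairing e F\<close> is the graded multilinear map of degree \<open>e\<close> with values \<open>F [c\<^sub>1, \<dots>, c\<^sub>k]\<close> on the
  differentials of the coordinates \<open>c\<^sub>1, \<dots>, c\<^sub>k\<close>. Contracting the first slot with \<open>\<^bold>d c\<close> leaves a
  map of degree \<open>e + gam c\<close>.\<close>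
primrec pairing_aux :: "('n::{finite,linorder}, 'k::real_normed_field) form list \<Rightarrow>
    int \<Rightarrow> (('n + 'n) list \<Rightarrow> ('n, 'k) mv) \<Rightarrow> ('n, 'k) mv" where
  "pairing_aux [] e F = F []"
| "pairing_aux (A # As) e F = hsum e A (\<lambda>c. pairing_aux As (e + gam c) (\<lambda>cs. F (c # cs)))"

definition pairing :: "int \<Rightarrow> (('n::{finite,linorder} + 'n) list \<Rightarrow> ('n, 'k::real_normed_field) mv) \<Rightarrow> ('n, 'k) form list \<Rightarrow> ('n, 'k) mv" where
  "pairing e F As = pairing_aux As e F"

lemma pairing_Nil [simp]: "pairing e F [] = F []"
  by (simp add: pairing_def)

lemma pairing_Cons: "pairing e F (A # As) = hsum e A (\<lambda>c. pairing (e + gam c) (\<lambda>cs. F (c # cs)) As)"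
  by (simp add: pairing_def)

text \<open>The slots filled with coordinates x_i are symmetric among themselves, as their shifted
  degree is odd: they correspond to the forms dy_i, which commute.\<close>

definition alternating :: "(('n::finite + 'n) list \<Rightarrow> ('n, 'k::real_normed_field) mv) \<Rightarrow> bool" where
  "alternating F \<longleftrightarrow> (\<forall>us a b vs. F (us @ a # b # vs) = - koszul (gam a * gam b) (F (us @ b # a # vs)))"

lemma alternatingD: "alternating F \<Longrightarrow> F (us @ a # b # vs) = - koszul (gam a * gam b) (F (us @ b # a # vs))"
  unfolding alternating_def by blast

lemma alternating_Cons: "alternating F \<Longrightarrow> alternating (\<lambda>cs. F (c # cs))"
  unfolding alternating_def by (metis append_Cons)

lemma hsum_0 [simp]: "hsum e A (\<lambda>c. 0) = 0"
  by (simp add: hsum_def)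

lemma hsum_0_left [simp]: "hsum e 0 g = 0"
  by (simp add: hsum_def fun_ops)

lemma hsum_add: "hsum e A (\<lambda>c. g c + h c) = hsum e A g + hsum e A h"
  by (simp add: hsum_def wedge_add_right sum.distrib)

lemma hsum_uminus: "hsum e A (\<lambda>c. - g c) = - hsum e A g"
  by (simp add: hsum_def wedge_uminus_right sum_negf)

lemma hsum_diff: "hsum e A (\<lambda>c. g c - h c) = hsum e A g - hsum e A h"
  by (simp add: hsum_def wedge_diff_right sum_subtractf)

lemma hsum_koszul: "hsum e A (\<lambda>c. koszul m (g c)) = koszul m (hsum e A g)"
  by (simp add: hsum_def wedge_koszul_right koszul_sum)

lemma hsum_sum: "hsum e A (\<lambda>c. \<Sum>a\<in>S. g a c) = (\<Sum>a\<in>S. hsum e A (g a))"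
  unfolding hsum_def wedge_sum_right by (rule sum.swap)

lemma hsum_add_left: "hsum e (A + B) g = hsum e A g + hsum e B g"
  by (simp add: hsum_def sg_add wedge_add_left sum.distrib fun_ops)

lemma hsum_sum_left: "hsum e (\<Sum>a\<in>S. f a) g = (\<Sum>a\<in>S. hsum e (f a) g)"
  by (induction S rule: infinite_finite_induct)
    (simp_all only: sum.infinite sum.empty sum.insert hsum_0_left hsum_add_left not_False_eq_True)

lemma hsum_koszul_form_diff:
  "hsum e (koszul_form_diff m A B) g = hsum e A g - koszul m (hsum e B g)"
proof -
  have "wedge (sg e (koszul_form_diff m A B c)) (g c) = wedge (sg e (A c)) (g c) - koszul m (wedge (sg e (B c)) (g c))" for c
    using sg_add[of e "A c" "- koszul m (B c)"] wedge_add_left[of "sg e (A c)" "- koszul m (sg e (B c))" "g c"]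
    by (simp add: koszul_form_diff_def sg_uminus sg_koszul wedge_uminus_left wedge_koszul_left)
  then show ?thesis
    by (simp add: hsum_def koszul_sum sum_subtractf)
qed

lemma hsum_cong: "(\<And>c. g c = h c) \<Longrightarrow> hsum e A g = hsum e A h"
  by (simp add: hsum_def)

lemma hsum_homogeneous:
  assumes "form_degree p A"
  shows "hsum e A g = koszul (e * (p - 1)) (\<Sum>c\<in>UNIV. wedge (A c) (koszul (e * gam c) (g c)))"
proof -
  have "wedge (sg e (A c)) (g c) = koszul (e * (p - 1)) (wedge (A c) (koszul (e * gam c) (g c)))" for c
    unfolding sg_homogeneous[OF form_degree_mv_degree[OF assms]] wedge_koszul_left wedge_koszul_right koszul_koszul
    by (rule koszul_parity) (simp add: algebra_simps)
  then show ?thesis by (simp add: hsum_def koszul_sum)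
qed

lemma sg_shift:
  assumes "form_degree p A"
  shows "sg (e + x) (A c) = koszul (x * (p - 1 - gam c)) (sg e (A c))"
  unfolding sg_homogeneous[OF form_degree_mv_degree[OF assms]] koszul_koszul
  by (simp add: algebra_simps)

lemma act_hsum:
  assumes "form_degree q X" "form_degree p A" "A \<in> forms" "\<And>c. g c \<in> mvs"
  shows "act X (hsum e A g) = koszul ((q - 1) * e) (hsum e (nabla X A) g)
    + hsum e A (\<lambda>c. koszul ((q - 1) * (p - 1 - gam c)) (act X (g c)))"
proof -
  have "act X (wedge (sg e (A c)) (g c)) = koszul ((q - 1) * e) (wedge (sg e (nabla X A c)) (g c))
    + wedge (sg e (A c)) (koszul ((q - 1) * (p - 1 - gam c)) (act X (g c)))" for c
    using assms formsD[OF assms(3), of c] sg_shift[OF assms(2), of e "q - 1" c]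
    by (simp add: act_wedge[OF assms(1)] mvs_sg act_sg[OF assms(1)] nabla_def sg_sg add.commute
        wedge_koszul_left wedge_koszul_right)
  moreover have "wedge (sg e (A c)) (g c) \<in> mvs" for c
    using assms(3,4) by (simp add: mvs_wedge mvs_sg formsD)
  ultimately show ?thesis
    by (simp add: hsum_def act_sum sum.distrib koszul_sum)
qed

lemma mvs_hsum: "A \<in> forms \<Longrightarrow> (\<And>c. g c \<in> mvs) \<Longrightarrow> hsum e A g \<in> mvs"
  unfolding hsum_def by (rule mvs_sum) (simp add: mvs_wedge mvs_sg formsD)

section \<open>Linearity, symmetry and degree of the pairing\<close>

lemma pairing_cong:
  "(\<And>cs. length cs = length As \<Longrightarrow> F cs = G cs) \<Longrightarrow> pairing e F As = pairing e G As"
proof (induction As arbitrary: e F G)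
  case (Cons A As)
  then show ?case unfolding pairing_Cons by (intro hsum_cong Cons.IH) simp
qed simp

lemma pairing_0: "pairing e (\<lambda>cs. 0) As = 0"
  by (induction As arbitrary: e) (auto simp: pairing_Cons)

lemma pairing_mvs:
  "(\<And>cs. F cs \<in> mvs) \<Longrightarrow> set As \<subseteq> forms \<Longrightarrow> pairing e F As \<in> mvs"
  by (induction As arbitrary: e F) (auto simp: pairing_Cons intro!: mvs_hsum)

lemma pairing_diff: "pairing e (\<lambda>cs. F cs - G cs) As = pairing e F As - pairing e G As"
  by (induction As arbitrary: e F G) (auto simp: pairing_Cons hsum_diff)

lemma pairing_koszul: "pairing e (\<lambda>cs. koszul m (F cs)) As = koszul m (pairing e F As)"
  by (induction As arbitrary: e F) (auto simp: pairing_Cons hsum_koszul)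

lemma pairing_uminus: "pairing e (\<lambda>cs. - F cs) As = - pairing e F As"
  by (induction As arbitrary: e F) (auto simp: pairing_Cons hsum_uminus)

lemma pairing_sum: "pairing e (\<lambda>cs. \<Sum>a\<in>S. F a cs) As = (\<Sum>a\<in>S. pairing e (F a) As)"
  by (induction As arbitrary: e F) (auto simp: pairing_Cons hsum_sum)

lemma hsum_wedge:
  assumes "mv_degree m f"
  shows "wedge f (hsum e A g) = hsum (e + m) A (\<lambda>c. wedge f (g c))"
proof -
  have "wedge f (wedge (sg e (A c)) (g c)) = wedge (sg (e + m) (A c)) (wedge f (g c))" for c
    using wedge_commute[OF assms, of "sg e (A c)"]
    by (simp add: sg_sg add.commute flip: wedge_assoc)
  then show ?thesis by (simp add: hsum_def wedge_sum_right)
qed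

lemma pairing_wedge:
  "mv_degree m f \<Longrightarrow> pairing (e + m) (\<lambda>cs. wedge f (G cs)) As = wedge f (pairing e G As)"
proof (induction As arbitrary: e G)
  case (Cons A As)
  have "pairing (e + m + gam c) (\<lambda>cs. wedge f (G (c # cs))) As
      = wedge f (pairing (e + gam c) (\<lambda>cs. G (c # cs)) As)" for c
    using Cons.IH[OF Cons.prems, of "e + gam c"] by (simp add: add_ac)
  then show ?case by (simp add: pairing_Cons hsum_wedge[OF Cons.prems])
qed simp

lemma pairing_swap_hd:
  assumes "form_degree p A" "form_degree q B" "alternating F"
  shows "pairing e F (A # B # As) = - koszul ((p - 1) * (q - 1)) (pairing e F (B # A # As))"
proof -
  define P where "P c c' = pairing (e + gam c + gam c') (\<lambda>cs. F (c # c' # cs)) As" for c c'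
  have sym: "pairing (e + gam c' + gam c) (\<lambda>cs. F (c' # c # cs)) As = - koszul (gam c * gam c') (P c c')" for c c'
  proof -
    have "(\<lambda>cs. F (c' # c # cs)) = (\<lambda>cs. - koszul (gam c * gam c') (F (c # c' # cs)))"
      using alternatingD[OF assms(3), of "[]" c' c] by (simp add: mult.commute)
    then show ?thesis by (simp add: P_def pairing_uminus pairing_koszul add_ac)
  qed
  have "wedge (sg e (A c)) (wedge (sg (e + gam c) (B c')) (P c c'))
    = - koszul ((p - 1) * (q - 1)) (wedge (sg e (B c')) (wedge (sg (e + gam c') (A c)) (- koszul (gam c * gam c') (P c c'))))"
    (is "?l = ?r") for c c'
  proof -
    \<comment> \<open>The degrees of the two coefficients. Exchanging the arguments exchanges
      coefficients (\<open>m * n\<close>), coordinates (\<open>gam c * gam c'\<close>) and each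
      coefficient with the other coordinate; the total has the parity of
      \<open>(p - 1) * (q - 1)\<close>.\<close>
    define m n where "m = p - 1 - gam c" and "n = q - 1 - gam c'"
    have A: "sg k (A c) = koszul (k * m) (A c)" and B: "sg k (B c') = koszul (k * n) (B c')" for k
      unfolding m_def n_def by (intro sg_homogeneous form_degree_mv_degree assms)+
    have AB: "wedge (A c) (B c') = koszul (m * n) (wedge (B c') (A c))"
      using wedge_commute[OF form_degree_mv_degree[OF assms(1), of c], of "B c'"] B[of m]
      by (simp add: m_def[symmetric] wedge_koszul_left)
    have "?l = koszul (e * m + (e + gam c) * n + m * n) (wedge (wedge (B c') (A c)) (P c c'))"
      by (simp add: A B wedge_koszul_left wedge_koszul_right AB add_ac flip: wedge_assoc)
    moreover have "?r = koszul ((p - 1) * (q - 1) + (gam c * gam c' + ((e + gam c') * m + e * n))) (wedge (wedge (B c') (A c)) (P c c'))"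
      by (simp add: A B wedge_koszul_left wedge_koszul_right wedge_uminus_right koszul_uminus add_ac flip: wedge_assoc)
    moreover have "p - 1 = m + gam c" "q - 1 = n + gam c'" by (simp_all add: m_def n_def)
    ultimately show ?thesis
      by (simp only:) (rule koszul_parity, simp add: algebra_simps)
  qed
  then have "pairing e F (A # B # As) = (\<Sum>c\<in>UNIV. \<Sum>c'\<in>UNIV.
      - koszul ((p - 1) * (q - 1)) (wedge (sg e (B c')) (wedge (sg (e + gam c') (A c)) (- koszul (gam c * gam c') (P c c')))))"
    by (simp add: pairing_Cons hsum_def wedge_sum_right flip: P_def)
  also have "\<dots> = - koszul ((p - 1) * (q - 1)) (pairing e F (B # A # As))"
    by (subst sum.swap) (simp add: pairing_Cons hsum_def wedge_sum_right koszul_sum sum_negf sym)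
  finally show ?thesis .
qed

lemma pairing_Cons_cong:
  "(\<And>c. pairing (e + gam c) (\<lambda>cs. F (c # cs)) As = koszul m (pairing (e + gam c) (\<lambda>cs. F (c # cs)) Bs)) \<Longrightarrow>
    pairing e F (A # As) = koszul m (pairing e F (A # Bs))"
  by (simp add: pairing_Cons hsum_koszul)

lemma pairing_swap:
  assumes "form_degree p A" "form_degree q B" "alternating F"
  shows "pairing e F (Us @ A # B # Vs) = - koszul ((p - 1) * (q - 1)) (pairing e F (Us @ B # A # Vs))"
  using assms(3)
proof (induction Us arbitrary: e F)
  case Nil
  then show ?case using pairing_swap_hd[OF assms(1,2)] by simp
next
  case (Cons U Us)
  then show ?case
    by (simp add: minus_koszul) (intro pairing_Cons_cong, simp add: alternating_Cons minus_koszul)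
qed

lemma deg_sum_Nil [simp]: "deg_sum [] = 0" and deg_sum_Cons [simp]: "deg_sum (p # ps) = p - 1 + deg_sum ps"
  by (simp_all add: deg_sum_def)

lemma pairing_move:
  assumes "form_degree p A" "list_all2 form_degree us Us" "alternating F"
  shows "pairing e F (A # Us @ Vs) = koszul (int (length Us) + (p - 1) * deg_sum us) (pairing e F (Us @ A # Vs))"
  using assms(2,3)
proof (induction us Us arbitrary: e F rule: list_all2_induct)
  case (Cons u us U Us)
  have "pairing e F (A # U # Us @ Vs) = - koszul ((p - 1) * (u - 1)) (pairing e F (U # A # Us @ Vs))"
    using pairing_swap_hd[OF assms(1) Cons(1) Cons.prems] .
  also have "pairing e F (U # A # Us @ Vs) = koszul (int (length Us) + (p - 1) * deg_sum us) (pairing e F (U # Us @ A # Vs))"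
    by (intro pairing_Cons_cong Cons.IH alternating_Cons Cons.prems)
  finally show ?case by (simp add: minus_koszul algebra_simps)
qed simp

text \<open>The Leibniz rule over all slots: X differentiates the values of F and, through
  \<open>nabla\<close>, each argument, the differentials of the coordinates being parallel.\<close>

lemma act_pairing:
  assumes "form_degree (x + 1) X" "X \<in> forms" "list_all2 form_degree bs Bs" "set Bs \<subseteq> forms" "\<And>cs. F cs \<in> mvs"
  shows "act X (pairing e F Bs) = pairing (e + x) (\<lambda>cs. act X (F cs)) Bs
    + (\<Sum>j<length Bs. koszul (x * (e + deg_sum (take j bs))) (pairing e F (Bs[j := nabla X (Bs ! j)])))"
  using assms(3-5)
proof (induction bs Bs arbitrary: e F rule: list_all2_induct)
  case (Cons b bs B Bs)
  let ?P = "\<lambda>c. pairing (e + gam c) (\<lambda>cs. F (c # cs))"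
  have "act X (?P c Bs) = pairing (e + gam c + x) (\<lambda>cs. act X (F (c # cs))) Bs
      + (\<Sum>j<length Bs. koszul (x * (e + gam c + deg_sum (take j bs))) (?P c (Bs[j := nabla X (Bs ! j)])))" for c
    using Cons.prems by (intro Cons.IH) auto
  then have "koszul (x * (b - 1 - gam c)) (act X (?P c Bs)) =
      koszul (x * (b - 1 - gam c)) (pairing (e + x + gam c) (\<lambda>cs. act X (F (c # cs))) Bs)
      + (\<Sum>j<length Bs. koszul (x * (e + deg_sum (take (Suc j) (b # bs)))) (?P c (Bs[j := nabla X (Bs ! j)])))" for c
    by (simp add: koszul_add koszul_sum algebra_simps)
  moreover have "hsum e B (\<lambda>c. koszul (x * (b - 1 - gam c)) (g c)) = hsum (e + x) B g" for g
    by (simp add: hsum_def wedge_koszul_right wedge_koszul_left sg_shift[OF Cons(1)])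
  moreover have "act X (pairing e F (B # Bs)) = koszul (x * e) (pairing e F (nabla X B # Bs))
      + hsum e B (\<lambda>c. koszul (x * (b - 1 - gam c)) (act X (?P c Bs)))"
    unfolding pairing_Cons using Cons.prems
    by (subst act_hsum[OF assms(1) Cons(1)]) (auto intro: pairing_mvs)
  ultimately have "act X (pairing e F (B # Bs)) = koszul (x * e) (pairing e F (nabla X B # Bs))
      + (hsum (e + x) B (\<lambda>c. pairing (e + x + gam c) (\<lambda>cs. act X (F (c # cs))) Bs)
      + (\<Sum>j<length Bs. koszul (x * (e + deg_sum (take (Suc j) (b # bs)))) (hsum e B (\<lambda>c. ?P c (Bs[j := nabla X (Bs ! j)])))))"
    by (simp only: hsum_add hsum_sum hsum_koszul)
  then show ?case
    by (simp add: pairing_Cons sum.lessThan_Suc_shift add_ac del: sum.lessThan_Suc)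
qed simp

lemma pairing_update_add:
  "i < length As \<Longrightarrow> pairing e F (As[i := As ! i + B]) = pairing e F As + pairing e F (As[i := B])"
proof (induction As arbitrary: e F i)
  case (Cons A As)
  then show ?case
    by (cases i) (auto simp: pairing_Cons hsum_add_left hsum_add)
qed simp

lemma pairing_update_fmult:
  assumes "mv_degree m f" "list_all2 form_degree ps As" "i < length As"
  shows "pairing e F (As[i := fmult f (As ! i)]) = koszul (m * (e + deg_sum (take i ps))) (wedge f (pairing e F As))"
  using assms(2,3)
proof (induction ps As arbitrary: e F i rule: list_all2_induct)
  case (Cons a ps A As)
  show ?case
  proof (cases i)
    case 0
    have "hsum e (fmult f A) g = koszul (m * e) (wedge f (hsum e A g))" for g
      using sg_homogeneous[OF assms(1), of e]
      by (simp add: hsum_def fmult_def sg_wedge wedge_koszul_left wedge_sum_right koszul_sum wedge_assoc mult.commute)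
    then show ?thesis by (simp add: 0 pairing_Cons)
  next
    case (Suc j)
    have "wedge f (hsum e A g) = hsum e A (\<lambda>c. koszul (m * (a - 1 - gam c)) (wedge f (g c)))" for g
      unfolding hsum_wedge[OF assms(1)]
      by (simp add: hsum_def wedge_koszul_right wedge_koszul_left sg_shift[OF Cons(1)])
    then have 1: "wedge f (pairing e F (A # As)) = hsum e A (\<lambda>c. koszul (m * (a - 1 - gam c)) (wedge f (pairing (e + gam c) (\<lambda>cs. F (c # cs)) As)))"
      by (simp add: pairing_Cons)
    have "pairing (e + gam c) (\<lambda>cs. F (c # cs)) (As[j := fmult f (As ! j)])
        = koszul (m * (e + gam c + deg_sum (take j ps))) (wedge f (pairing (e + gam c) (\<lambda>cs. F (c # cs)) As))" for c
      using Cons.prems Suc by (intro Cons.IH) simp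
    also have "\<dots> c = koszul (m * (e + deg_sum (take i (a # ps))))
        (koszul (m * (a - 1 - gam c)) (wedge f (pairing (e + gam c) (\<lambda>cs. F (c # cs)) As)))" for c
      unfolding koszul_koszul by (rule koszul_parity) (simp add: Suc algebra_simps)
    finally have eq: "pairing (e + gam c) (\<lambda>cs. F (c # cs)) (As[j := fmult f (As ! j)]) =
        koszul (m * (e + deg_sum (take i (a # ps))))
        (koszul (m * (a - 1 - gam c)) (wedge f (pairing (e + gam c) (\<lambda>cs. F (c # cs)) As)))" for c .
    have "pairing e F ((A # As)[i := fmult f ((A # As) ! i)]) =
        hsum e A (\<lambda>c. pairing (e + gam c) (\<lambda>cs. F (c # cs)) (As[j := fmult f (As ! j)]))"
      by (simp add: Suc pairing_Cons)
    also have "\<dots> = koszul (m * (e + deg_sum (take i (a # ps)))) (wedge f (pairing e F (A # As)))"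
      unfolding eq hsum_koszul 1 ..
    finally show ?thesis .
  qed
qed simp

lemma mv_degree_hsum:
  assumes "form_degree p A" "\<And>c. mv_degree (n + gam c) (g c)"
  shows "mv_degree (n + (p - 1)) (hsum e A g)"
proof -
  have "mv_degree ((p - 1 - gam c) + (n + gam c)) (wedge (sg e (A c)) (g c))" for c
    by (intro mv_degree_wedge mv_degree_sg form_degree_mv_degree assms)
  then show ?thesis unfolding hsum_def by (intro mv_degree_sum) (simp add: algebra_simps)
qed

lemma mv_degree_pairing:
  assumes "list_all2 form_degree ps As" "\<And>cs. length cs = length As \<Longrightarrow> mv_degree (n + sum_list (map gam cs)) (F cs)"
  shows "mv_degree (n + deg_sum ps) (pairing e F As)"
  using assms
proof (induction ps As arbitrary: n e F rule: list_all2_induct)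
  case Nil
  from Nil[of "[]"] show ?case by simp
next
  case (Cons p ps A As)
  have "mv_degree (n + gam c + deg_sum ps) (pairing (e + gam c) (\<lambda>cs. F (c # cs)) As)" for c
  proof (rule Cons.IH)
    show "length cs = length As \<Longrightarrow> mv_degree (n + gam c + sum_list (map gam cs)) (F (c # cs))" for cs
      using Cons.prems[of "c # cs"] by (simp add: add.assoc)
  qed
  then have "mv_degree (n + deg_sum ps + (p - 1)) (pairing e F (A # As))"
    unfolding pairing_Cons by (intro mv_degree_hsum Cons(1)) (simp add: add_ac)
  then show ?case by (simp add: algebra_simps)
qed

text \<open>Each term of the expansion either has a tangential slot, whose coefficient in an adapted
  form lies in the ideal, or has only normal slots, where F takes values in the ideal.\<close>

lemma pairing_adapted:
  assumes "set As \<subseteq> adapted_forms N" "\<And>cs. F cs \<in> mvs"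
    and "\<And>cs. length cs = length As \<Longrightarrow> \<forall>c\<in>set cs. \<not> tangential N c \<Longrightarrow> F cs \<in> adapted N"
  shows "pairing e F As \<in> adapted N"
  using assms
proof (induction As arbitrary: e F)
  case Nil
  then show ?case by simp
next
  case (Cons A As)
  have A: "A \<in> forms" "\<And>c. tangential N c \<Longrightarrow> A c \<in> adapted N" and As: "set As \<subseteq> forms"
    using Cons.prems(1) by (auto simp: adapted_forms_iff)
  show ?case
    unfolding pairing_Cons hsum_def
  proof (rule adapted_sum)
    fix c
    show "wedge (sg e (A c)) (pairing (e + gam c) (\<lambda>cs. F (c # cs)) As) \<in> adapted N"
    proof (cases "tangential N c")
      case True
      then show ?thesis
        using A As Cons.prems by (intro adapted_wedge_left adapted_sg pairing_mvs) auto
    next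
      case False
      then have "pairing (e + gam c) (\<lambda>cs. F (c # cs)) As \<in> adapted N"
        using Cons.prems by (intro Cons.IH) auto
      then show ?thesis using A by (intro adapted_wedge_right mvs_sg formsD)
    qed
  qed
qed

lemma sum_lists_Suc:
  fixes D :: "'a set"
  assumes "finite D"
  shows "(\<Sum>ps | length ps = Suc n \<and> set ps \<subseteq> D. g ps) = (\<Sum>p\<in>D. \<Sum>ps | length ps = n \<and> set ps \<subseteq> D. g (p # ps))"
proof -
  have "{ps. length ps = Suc n \<and> set ps \<subseteq> D} = (\<lambda>(p, ps). p # ps) ` (D \<times> {ps. length ps = n \<and> set ps \<subseteq> D})"
    by (auto simp: length_Suc_conv image_iff)
  moreover have "inj_on (\<lambda>(p, ps). p # ps) (D \<times> {ps. length ps = n \<and> set ps \<subseteq> D})"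
    by (auto simp: inj_on_def)
  from sum.reindex[OF this, of g]
  have "sum g ((\<lambda>(p, ps). p # ps) ` (D \<times> {ps. length ps = n \<and> set ps \<subseteq> D})) =
      (\<Sum>p\<in>D. \<Sum>ps | length ps = n \<and> set ps \<subseteq> D. g (p # ps))"
    by (simp add: sum.cartesian_product case_prod_beta o_def)
  ultimately show ?thesis by (simp only:)
qed

text \<open>\<open>CE\<close> is a sum over the homogeneous parts of its arguments; additivity in
  each slot reassembles them.\<close>

lemma pairing_form_parts:
  fixes As :: "('n::{finite,linorder}, 'k::real_normed_field) form list"
  shows "(\<Sum>ps | length ps = length As \<and> set ps \<subseteq> form_degrees TYPE('n). pairing e F (map2 form_part ps As)) = pairing e F As"
proof (induction As arbitrary: e F)
  case Nil
  have "{ps :: int list. length ps = length [] \<and> set ps \<subseteq> form_degrees TYPE('n)} = {[]}" by auto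
  then show ?case by simp
next
  case (Cons A As)
  have "(\<Sum>ps | length ps = length (A # As) \<and> set ps \<subseteq> form_degrees TYPE('n). pairing e F (map2 form_part ps (A # As)))
    = (\<Sum>p\<in>form_degrees TYPE('n). hsum e (form_part p A) (\<lambda>c. \<Sum>ps | length ps = length As \<and> set ps \<subseteq> form_degrees TYPE('n).
        pairing (e + gam c) (\<lambda>cs. F (c # cs)) (map2 form_part ps As)))"
    by (simp add: sum_lists_Suc pairing_Cons hsum_sum)
  also have "\<dots> = hsum e (\<Sum>p\<in>form_degrees TYPE('n). form_part p A) (\<lambda>c. pairing (e + gam c) (\<lambda>cs. F (c # cs)) As)"
    unfolding hsum_sum_left Cons.IH ..
  finally show ?case by (simp only: sum_form_part pairing_Cons)
qed

section \<open>The differential in coordinates\<close>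

text \<open>The de Rham differential in coordinates: an alternating sum over the slots, in each of
  which \<open>dc\<close> acts on the value at the remaining ones. The argument \<open>e\<close>
  grows by the degrees of the slots passed.\<close>

primrec dif_aux :: "('n::{finite,linorder} + 'n) list \<Rightarrow> int \<Rightarrow> (('n + 'n) list \<Rightarrow> ('n, 'k::real_normed_field) mv) \<Rightarrow> ('n, 'k) mv" where
  "dif_aux [] e F = 0"
| "dif_aux (c # cs) e F = koszul (gam c * e) (dc c (F cs)) - dif_aux cs (e + gam c) (\<lambda>cs. F (c # cs))"

definition dif :: "int \<Rightarrow> (('n::{finite,linorder} + 'n) list \<Rightarrow> ('n, 'k::real_normed_field) mv) \<Rightarrow> ('n + 'n) list \<Rightarrow> ('n, 'k) mv" where
  "dif e F cs = dif_aux cs e F"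

lemma dif_Nil [simp]: "dif e F [] = 0"
  by (simp add: dif_def)

lemma dif_Cons: "dif e F (c # cs) = koszul (gam c * e) (dc c (F cs)) - dif (e + gam c) (\<lambda>cs. F (c # cs)) cs"
  by (simp add: dif_def)

lemma mvs_dif: "(\<And>cs. F cs \<in> mvs) \<Longrightarrow> dif e F cs \<in> mvs"
  by (induction cs arbitrary: e F) (auto simp: dif_Cons intro!: mvs_diff mvs_koszul mvs_dc)

lemma dif_koszul: "(\<And>cs. F cs \<in> mvs) \<Longrightarrow> dif e (\<lambda>cs. koszul m (F cs)) cs = koszul m (dif e F cs)"
  by (induction cs arbitrary: e F) (auto simp: dif_Cons dc_koszul koszul_diff add_ac)

lemma dif_uminus: "(\<And>cs. F cs \<in> mvs) \<Longrightarrow> dif e (\<lambda>cs. - F cs) cs = - dif e F cs"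
  using dif_koszul[of F e 1 cs] by (simp add: koszul_def)

lemma dif_diff:
  "(\<And>cs. F cs \<in> mvs) \<Longrightarrow> (\<And>cs. G cs \<in> mvs) \<Longrightarrow> dif e (\<lambda>cs. F cs - G cs) cs = dif e F cs - dif e G cs"
  by (induction cs arbitrary: e F G) (auto simp: dif_Cons dc_diff koszul_diff algebra_simps)

lemma dif_cong: "(\<And>cs. Suc (length cs) = length ds \<Longrightarrow> F cs = G cs) \<Longrightarrow> dif e F ds = dif e G ds"
proof (induction ds arbitrary: e F G)
  case (Cons c ds)
  have "dif (e + gam c) (\<lambda>cs. F (c # cs)) ds = dif (e + gam c) (\<lambda>cs. G (c # cs)) ds"
    using Cons.prems by (intro Cons.IH) auto
  then show ?case using Cons.prems[of ds] by (simp add: dif_Cons)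
qed simp

lemma dif_0: "dif e (\<lambda>cs. 0) cs = 0"
  by (induction cs arbitrary: e) (auto simp: dif_Cons)

lemma alternating_dif:
  assumes "alternating F" "\<And>cs. F cs \<in> mvs"
  shows "alternating (dif e F)"
proof -
  have "dif e F (us @ a # b # vs) = - koszul (gam a * gam b) (dif e F (us @ b # a # vs))" for us a b vs
    using assms
  proof (induction us arbitrary: e F)
    case Nil
    \<comment> \<open>Only the terms of the first two slots change places; the rest of the sum
      inherits its sign from F.\<close>
    define m X Y Z where "m = gam a * gam b" and "X = dc b (F (a # vs))" and "Y = dc a (F (b # vs))"
      and "Z = dif (e + gam b + gam a) (\<lambda>cs. F (b # a # cs)) vs"
    have eq: "(\<lambda>cs. F (a # b # cs)) = (\<lambda>cs. - koszul m (F (b # a # cs)))"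
      using alternatingD[OF Nil(1), of "[]" a b] by (simp add: m_def)
    have "e + gam a + gam b = e + gam b + gam a" by simp
    then have Z: "dif (e + gam a + gam b) (\<lambda>cs. F (a # b # cs)) vs = - koszul m Z"
      unfolding Z_def eq dif_uminus[of "\<lambda>cs. koszul m (F (b # a # cs))", OF mvs_koszul[OF Nil(2)]]
        dif_koszul[of "\<lambda>cs. F (b # a # cs)", OF Nil(2)] by (simp only:)
    have Y: "koszul (m + gam a * (e + gam b)) Y = koszul (gam a * e) Y"
      and X: "koszul (m + gam b * e) X = koszul (gam b * (e + gam a)) X"
      by (rule koszul_parity, simp add: m_def algebra_simps)+
    have "- koszul m (koszul (gam b * e) X - (koszul (gam a * (e + gam b)) Y - Z))
        = koszul (gam a * e) Y - (koszul (gam b * (e + gam a)) X - - koszul m Z)"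
      by (simp add: koszul_diff X Y)
    then show ?case
      by (simp only: append_Nil dif_Cons Z X_def[symmetric] Y_def[symmetric] Z_def[symmetric] m_def[symmetric])
  next
    case (Cons u us)
    define m where "m = gam a * gam b"
    have 1: "F (us @ a # b # vs) = - koszul m (F (us @ b # a # vs))"
      unfolding m_def by (rule alternatingD[OF Cons.prems(1)])
    have 2: "dif (e + gam u) (\<lambda>cs. F (u # cs)) (us @ a # b # vs) = - koszul m (dif (e + gam u) (\<lambda>cs. F (u # cs)) (us @ b # a # vs))"
      unfolding m_def by (rule Cons.IH[OF alternating_Cons[OF Cons.prems(1)] Cons.prems(2)])
    have 3: "dc u (- koszul m (F (us @ b # a # vs))) = - koszul m (dc u (F (us @ b # a # vs)))"
      using Cons.prems(2) by (simp add: dc_uminus dc_koszul mvs_koszul)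
    show ?case
      unfolding append_Cons dif_Cons 1 2 3 m_def[symmetric]
      by (simp add: koszul_diff koszul_uminus add.commute)
  qed
  then show ?thesis unfolding alternating_def by blast
qed

lemma dc_dif:
  fixes F :: "('n::{finite,linorder} + 'n) list \<Rightarrow> ('n, 'k::{real_normed_field,banach}) mv"
  assumes "\<And>cs. F cs \<in> mvs"
  shows "dc c (dif e F cs) = dif (e + gam c) (\<lambda>cs. dc c (F cs)) cs"
  using assms
proof (induction cs arbitrary: e F)
  case (Cons b cs)
  have "koszul (gam b * e) (dc c (dc b (F cs))) = koszul (gam b * (e + gam c)) (dc b (dc c (F cs)))"
    using dc_commute[of "F cs" c b, OF Cons.prems] by (simp add: algebra_simps)
  then show ?case
    using Cons by (simp add: dif_Cons dc_diff dc_koszul mvs_koszul mvs_dc mvs_dif add_ac)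
qed simp

text \<open>Once the first slot \<open>c\<close> is split off, \<open>dc c\<close> outside
  \<open>dif\<close> and \<open>dc c\<close> inside it cancel by \<open>dc_dif\<close>, that is,
  because the coordinate derivations commute up to sign; the remaining term is a shorter
  instance.\<close>

lemma dif_dif:
  fixes F :: "('n::{finite,linorder} + 'n) list \<Rightarrow> ('n, 'k::{real_normed_field,banach}) mv"
  assumes "\<And>cs. F cs \<in> mvs"
  shows "dif e (dif e F) cs = 0"
  using assms
proof (induction cs arbitrary: e F)
  case (Cons c cs)
  have "dif (e + gam c) (\<lambda>cs. dif e F (c # cs)) cs = koszul (gam c * e) (dif (e + gam c) (\<lambda>cs. dc c (F cs)) cs)
      - dif (e + gam c) (dif (e + gam c) (\<lambda>cs. F (c # cs))) cs"
    unfolding dif_Cons using Cons.prems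
    by (subst dif_diff) (auto intro!: mvs_koszul mvs_dc mvs_dif simp: dif_koszul mvs_dc)
  also have "dif (e + gam c) (dif (e + gam c) (\<lambda>cs. F (c # cs))) cs = 0"
    by (intro Cons.IH Cons.prems)
  finally show ?case
    unfolding dif_Cons[of e "dif e F"] using dc_dif[of F c e cs, OF Cons.prems] by simp
qed simp

lemma dif_adapted:
  assumes "\<And>cs. F cs \<in> mvs" "\<forall>c\<in>set ds. \<not> tangential N c"
    and "\<And>cs. Suc (length cs) = length ds \<Longrightarrow> \<forall>c\<in>set cs. \<not> tangential N c \<Longrightarrow> F cs \<in> adapted N"
  shows "dif e F ds \<in> adapted N"
  using assms
proof (induction ds arbitrary: e F)
  case (Cons c ds)
  have "dif (e + gam c) (\<lambda>cs. F (c # cs)) ds \<in> adapted N"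
    using Cons.prems by (intro Cons.IH) auto
  then show ?case
    using Cons.prems by (simp add: dif_Cons adapted_diff adapted_koszul adapted_dc)
qed simp

lemma mv_degree_dif:
  assumes "\<And>cs. Suc (length cs) = length ds \<Longrightarrow> mv_degree (n + sum_list (map gam cs)) (F cs)"
  shows "mv_degree (n + sum_list (map gam ds)) (dif e F ds)"
  using assms
proof (induction ds arbitrary: n e F)
  case (Cons c ds)
  have "mv_degree (n + gam c + sum_list (map gam ds)) (dif (e + gam c) (\<lambda>cs. F (c # cs)) ds)"
  proof (rule Cons.IH)
    show "Suc (length cs) = length ds \<Longrightarrow> mv_degree (n + gam c + sum_list (map gam cs)) (F (c # cs))" for cs
      using Cons.prems[of "c # cs"] by (simp add: add.assoc)
  qed
  moreover have "mv_degree (n + sum_list (map gam ds) + gam c) (dc c (F ds))"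
    using Cons.prems by (intro mv_degree_dc) simp
  ultimately show ?case
    using mv_degree_add[OF mv_degree_koszul mv_degree_uminus] by (simp add: dif_Cons add_ac)
qed simp

section \<open>The Chevalley-Eilenberg differential in coordinates\<close>

lemma nths_Cons_compl: "nths (A # As) (- {0}) = As" "nths (A # As) (- {Suc i}) = A # nths As (- {i})"
  "nths (A # As) (- {0, Suc i}) = nths As (- {i})"
  "nths (A # As) (- {Suc i, Suc j}) = A # nths As (- {i, j})"
proof -
  have "{k. Suc k \<in> - {0}} = UNIV" "{k. Suc k \<in> - {Suc i}} = - {i}"
    "{k. Suc k \<in> - {0, Suc i}} = - {i}" "{k. Suc k \<in> - {Suc i, Suc j}} = - {i, j}" by auto
  then show "nths (A # As) (- {0}) = As" "nths (A # As) (- {Suc i}) = A # nths As (- {i})"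
    "nths (A # As) (- {0, Suc i}) = nths As (- {i})"
    "nths (A # As) (- {Suc i, Suc j}) = A # nths As (- {i, j})"
    by (simp_all add: nths_Cons nths_all)
qed

lemma nths_compl_singleton: "i < length As \<Longrightarrow> nths As (- {i}) = take i As @ drop (Suc i) As"
proof (induction As arbitrary: i)
  case (Cons A As)
  then show ?case by (cases i) (simp_all add: nths_Cons_compl)
qed simp

lemma form_degree_koszul_form_diff:
  "form_degree p A \<Longrightarrow> form_degree p B \<Longrightarrow> form_degree p (koszul_form_diff m A B)"
  unfolding form_degree_iff koszul_form_diff_def
  using mv_degree_add[OF _ mv_degree_uminus[OF mv_degree_koszul]] by fastforce

lemma form_degree_bracket:
  fixes A B :: "('n::{finite,linorder}, 'k::real_normed_field) form"
  assumes "form_degree p A" "form_degree q B" "p \<in> form_degrees TYPE('n)" "q \<in> form_degrees TYPE('n)"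
  shows "form_degree (p + q - 1) (form_bracket A B)"
  unfolding form_bracket_homogeneous[OF assms]
  using form_degree_nabla[OF assms(1,2)] form_degree_nabla[OF assms(2,1)]
  by (intro form_degree_koszul_form_diff) (simp_all add: add.commute)

lemma form_bracket_adapted:
  assumes "A \<in> adapted_forms N" "B \<in> adapted_forms N"
  shows "form_bracket A B \<in> adapted_forms N"
proof -
  have "(\<lambda>c. act (form_part p A) (form_part q B c) - koszul m (act (form_part q B) (form_part p A c))) \<in> adapted_forms N" for p q m
    using koszul_form_diff_adapted[OF nabla_adapted nabla_adapted, OF
        form_part_adapted[OF assms(1)] form_part_adapted[OF assms(2)] form_part_adapted[OF assms(2)] form_part_adapted[OF assms(1)]]
    by (simp add: koszul_form_diff_def nabla_def)
  then show ?thesis unfolding form_bracket_def by (intro adapted_forms_sum)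
qed

lemma pairing_dif_Cons:
  fixes A :: "('n::{finite,linorder}, 'k::real_normed_field) form"
  assumes "form_degree p A"
  shows "pairing e (dif e F) (A # As) = koszul ((p - 1) * e) (pairing (e + (p - 1)) (\<lambda>cs. act A (F cs)) As)
    - hsum e A (\<lambda>c. pairing (e + gam c) (dif (e + gam c) (\<lambda>cs. F (c # cs))) As)"
proof -
  have "pairing (e + (p - 1)) (\<lambda>cs. wedge (A c) (dc c (F cs))) As = wedge (A c) (pairing (e + gam c) (\<lambda>cs. dc c (F cs)) As)" for c
    using pairing_wedge[OF form_degree_mv_degree[OF assms, of c], of "e + gam c"] by simp
  then have 1: "pairing (e + (p - 1)) (\<lambda>cs. act A (F cs)) As = (\<Sum>c\<in>UNIV. wedge (A c) (pairing (e + gam c) (\<lambda>cs. dc c (F cs)) As))"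
    by (simp add: act_def pairing_sum)
  have "koszul (e * gam c) (koszul (gam c * e) v) = v" for c :: "'n + 'n" and v :: "('n, 'k) mv"
    unfolding koszul_koszul by (simp add: koszul_def)
  then have "hsum e A (\<lambda>c. koszul (gam c * e) (pairing (e + gam c) (\<lambda>cs. dc c (F cs)) As))
      = koszul ((p - 1) * e) (pairing (e + (p - 1)) (\<lambda>cs. act A (F cs)) As)"
    unfolding hsum_homogeneous[OF assms] 1 by (simp only: mult.commute[of e "p - 1"])
  then show ?thesis
    by (simp add: pairing_Cons dif_Cons pairing_diff pairing_koszul hsum_diff)
qed

text \<open>Every bracket with the first argument A splits into two covariant derivatives. The
  derivatives of A cancel against the action of the other arguments on the slot of A, and the
  derivatives along A cancel against the action of A on the other slots. Only the action of A on the
  values of F is left.\<close>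

lemma CE_hom_Cons:
  fixes A :: "('n::{finite,linorder}, 'k::real_normed_field) form"
  assumes pA: "form_degree p A" "A \<in> forms" "p \<in> form_degrees TYPE('n)"
    and psAs: "list_all2 form_degree ps As" "set As \<subseteq> forms" "set ps \<subseteq> form_degrees TYPE('n)"
    and F: "alternating F" "\<And>cs. F cs \<in> mvs"
  shows "CE_hom e (pairing e F) (p # ps) (A # As) =
    koszul ((p - 1) * e) (pairing (e + (p - 1)) (\<lambda>cs. act A (F cs)) As)
    - hsum e A (\<lambda>c. CE_hom (e + gam c) (pairing (e + gam c) (\<lambda>cs. F (c # cs))) ps As)"
proof -
  define a b D where "a = p - 1" and "b i = ps ! i - 1" and "D i = deg_sum (take i ps)" for i
  let ?n = "length As"
  let ?P = "pairing e F" and ?P' = "\<lambda>c. pairing (e + gam c) (\<lambda>cs. F (c # cs))"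
  let ?del = "\<lambda>i. nths As (- {i})" and ?del2 = "\<lambda>i j. nths As (- {i, j})"
  have len: "length ps = ?n" using psAs(1) list_all2_lengthD by blast
  have deg: "form_degree (ps ! i) (As ! i)" if "i < ?n" for i
    using psAs(1) that len by (simp add: list_all2_nthD2)
  have forms: "As ! i \<in> forms" if "i < ?n" for i using psAs(2) that by auto
  have ran: "ps ! i \<in> form_degrees TYPE('n)" if "i < ?n" for i
    using that len by (intro subsetD[OF psAs(3)] nth_mem) simp
  have delf: "set (nths As X) \<subseteq> forms" for X
    using psAs(2) set_nths_subset[of As X] by blast
  \<comment> \<open>\<open>U i\<close> holds the derivative of A along argument i,
    \<open>Q i\<close> that of argument i along A, left in its place. \<open>v\<close> and
    \<open>z\<close> are the summands of the formula for the cochain contracted in its first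
    slot.\<close>
  define U V Q v z where "U i = koszul (int i + 1 + b i * (a + D i)) (?P (nabla (As ! i) A # ?del i))"
    and "V i = - hsum e A (v i)" and "Q i = koszul (a * D i) (?P (As[i := nabla A (As ! i)]))"
    and "v i c = koszul (int i + b i * (e + gam c + D i)) (act (As ! i) (?P' c (?del i)))"
    and "z i j c = koszul (int i + int j + b i * D i + b j * (D j - b i)) (?P' c (form_bracket (As ! i) (As ! j) # ?del2 i j))"
    for i j c
  have S1: "koszul (int (Suc i) + b i * (e + (a + D i))) (act (As ! i) (?P (A # ?del i))) = U i + V i"
    if i: "i < ?n" for i
  proof -
    have "act (As ! i) (?P (A # ?del i)) = koszul (b i * e) (?P (nabla (As ! i) A # ?del i))
        + hsum e A (\<lambda>c. koszul (b i * (a - gam c)) (act (As ! i) (?P' c (?del i))))"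
      unfolding pairing_Cons a_def b_def using delf F
      by (intro act_hsum deg i pA pairing_mvs) auto
    moreover have "koszul (int (Suc i) + b i * (e + (a + D i))) (koszul (b i * e) (?P (nabla (As ! i) A # ?del i))) = U i"
      unfolding U_def koszul_koszul by (rule koszul_parity) (simp add: algebra_simps)
    moreover have "koszul (int (Suc i) + b i * (e + (a + D i))) (koszul (b i * (a - gam c)) (act (As ! i) (?P' c (?del i)))) = - v i c" for c
      unfolding v_def koszul_koszul minus_koszul by (rule koszul_parity) (simp add: algebra_simps)
    ultimately show ?thesis
      by (simp only: koszul_add hsum_koszul[symmetric] V_def hsum_uminus)
  qed
  have S2: "koszul (int (Suc j) + b j * D j) (?P (form_bracket A (As ! j) # ?del j)) = - U j - Q j"
    if j: "j < ?n" for j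
  proof -
    have "?P (form_bracket A (As ! j) # ?del j) = ?P (nabla A (As ! j) # ?del j) - koszul (a * b j) (?P (nabla (As ! j) A # ?del j))"
      unfolding form_bracket_homogeneous[OF pA(1) deg[OF j] pA(3) ran[OF j]] pairing_Cons hsum_koszul_form_diff a_def b_def ..
    moreover have "koszul (int (Suc j) + b j * D j) (koszul (a * b j) (?P (nabla (As ! j) A # ?del j))) = U j"
      unfolding U_def koszul_koszul by (rule koszul_parity) (simp add: algebra_simps)
    \<comment> \<open>The derivative of argument j has shifted degree \<open>a + b j\<close>; it
      travels from the front back to its own slot.\<close>
    moreover have "?P (nabla A (As ! j) # ?del j) = koszul (int j + (a + b j) * D j) (?P (As[j := nabla A (As ! j)]))"
    proof -
      have "form_degree (p + ps ! j - 1) (nabla A (As ! j))" by (intro form_degree_nabla pA deg j)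
      from pairing_move[OF this list_all2_takeI[OF psAs(1), of j] F(1), of e "drop (Suc j) As"]
      show ?thesis
        using j by (simp add: nths_compl_singleton upd_conv_take_nth_drop D_def a_def b_def algebra_simps)
    qed
    then have "koszul (int (Suc j) + b j * D j) (?P (nabla A (As ! j) # ?del j)) = - Q j"
      unfolding Q_def minus_koszul by (simp only: koszul_koszul) (rule koszul_parity, simp add: algebra_simps)
    ultimately show ?thesis by (simp only: koszul_diff) (simp only: diff_conv_add_uminus add.commute)
  qed
  \<comment> \<open>Bringing A to the front, past a bracket of shifted degree
    \<open>b i + b j\<close>, makes its slot the contracted one.\<close>
  have S3: "koszul (int (Suc i) + int (Suc j) + b i * (a + D i) + b j * (a + D j - b i))
      (?P (form_bracket (As ! i) (As ! j) # A # ?del2 i j)) = - hsum e A (z i j)"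
    if ij: "i < j" "j < ?n" for i j
  proof -
    have i: "i < ?n" using ij by simp
    have "form_degree (ps ! i + ps ! j - 1) (form_bracket (As ! i) (As ! j))"
      using i ij by (intro form_degree_bracket deg ran)
    from pairing_swap_hd[OF this pA(1) F(1), of e "?del2 i j"]
    have "?P (form_bracket (As ! i) (As ! j) # A # ?del2 i j)
      = - koszul ((b i + b j) * a) (hsum e A (\<lambda>c. ?P' c (form_bracket (As ! i) (As ! j) # ?del2 i j)))"
      by (simp add: a_def b_def pairing_Cons[of e F A] algebra_simps)
    then have "koszul (int (Suc i) + int (Suc j) + b i * (a + D i) + b j * (a + D j - b i))
      (?P (form_bracket (As ! i) (As ! j) # A # ?del2 i j)) =
      - koszul (int (Suc i) + int (Suc j) + b i * (a + D i) + b j * (a + D j - b i) + (b i + b j) * a)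
       (hsum e A (\<lambda>c. ?P' c (form_bracket (As ! i) (As ! j) # ?del2 i j)))"
      by (simp only: koszul_uminus koszul_koszul)
    also have "\<dots> = - koszul (int i + int j + b i * D i + b j * (D j - b i))
       (hsum e A (\<lambda>c. ?P' c (form_bracket (As ! i) (As ! j) # ?del2 i j)))"
      by (intro arg_cong[where f = uminus] koszul_parity) (simp add: algebra_simps)
    also have "\<dots> = - hsum e A (z i j)"
      unfolding z_def hsum_koszul ..
    finally show ?thesis .
  qed
  have "CE_hom e ?P (p # ps) (A # As) =
    koszul (a * e) (act A (?P As))
    + (\<Sum>i<?n. koszul (int (Suc i) + b i * (e + (a + D i))) (act (As ! i) (?P (A # ?del i))))
    + (\<Sum>j<?n. koszul (int (Suc j) + b j * D j) (?P (form_bracket A (As ! j) # ?del j))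
       + (\<Sum>i<j. koszul (int (Suc i) + int (Suc j) + b i * (a + D i) + b j * (a + D j - b i))
      (?P (form_bracket (As ! i) (As ! j) # A # ?del2 i j))))"
    unfolding CE_hom_def a_def b_def D_def
    by (simp add: sum.lessThan_Suc_shift nths_Cons_compl del: sum.lessThan_Suc)
  also have "\<dots> = koszul (a * e) (act A (?P As)) + (\<Sum>i<?n. U i + V i) + (\<Sum>j<?n. - U j - Q j + (\<Sum>i<j. - hsum e A (z i j)))"
    using S1 S2 S3 by simp
  also have "\<dots> = koszul (a * e) (act A (?P As)) - (\<Sum>j<?n. Q j)
      - ((\<Sum>i<?n. hsum e A (v i)) + (\<Sum>j<?n. \<Sum>i<j. hsum e A (z i j)))"
    by (simp add: V_def sum.distrib sum_negf sum_subtractf)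
  also have "(\<Sum>i<?n. hsum e A (v i)) + (\<Sum>j<?n. \<Sum>i<j. hsum e A (z i j))
    = hsum e A (\<lambda>c. CE_hom (e + gam c) (?P' c) ps As)"
    unfolding CE_hom_def hsum_add hsum_sum v_def z_def b_def D_def ..
  \<comment> \<open>The Leibniz rule over the slots produces the \<open>Q j\<close> a second time,
    with the sign that cancels them.\<close>
  also have "koszul (a * e) (act A (?P As)) - (\<Sum>j<?n. Q j) = koszul (a * e) (pairing (e + a) (\<lambda>cs. act A (F cs)) As)"
  proof -
    have "act A (?P As) = pairing (e + a) (\<lambda>cs. act A (F cs)) As
        + (\<Sum>j<?n. koszul (a * (e + D j)) (?P (As[j := nabla A (As ! j)])))"
      unfolding D_def using pA F psAs by (intro act_pairing) (auto simp: a_def)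
    moreover have "koszul (a * e) (koszul (a * (e + D j)) (?P (As[j := nabla A (As ! j)]))) = Q j" for j
      unfolding koszul_koszul Q_def by (rule koszul_parity) (simp add: algebra_simps)
    ultimately show ?thesis by (simp only: koszul_add koszul_sum) simp
  qed
  finally show ?thesis by (simp add: a_def)
qed

text \<open>Both sides satisfy the same recursion in the first argument, by
  \<open>CE_hom_Cons\<close> and \<open>pairing_dif_Cons\<close>.\<close>

lemma CE_hom_pairing:
  fixes As :: "('n::{finite,linorder}, 'k::real_normed_field) form list"
  assumes "list_all2 form_degree ps As" "set As \<subseteq> forms" "set ps \<subseteq> form_degrees TYPE('n)"
    and "alternating F" "\<And>cs. F cs \<in> mvs"
  shows "CE_hom e (pairing e F) ps As = pairing e (dif e F) As"
  using assms
proof (induction ps As arbitrary: e F rule: list_all2_induct)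
  case Nil
  then show ?case by (simp add: CE_hom_def)
next
  case (Cons p ps A As)
  have "CE_hom (e + gam c) (pairing (e + gam c) (\<lambda>cs. F (c # cs))) ps As
      = pairing (e + gam c) (dif (e + gam c) (\<lambda>cs. F (c # cs))) As" for c
    using Cons.prems by (intro Cons.IH alternating_Cons) auto
  moreover have "CE_hom e (pairing e F) (p # ps) (A # As) =
    koszul ((p - 1) * e) (pairing (e + (p - 1)) (\<lambda>cs. act A (F cs)) As)
    - hsum e A (\<lambda>c. CE_hom (e + gam c) (pairing (e + gam c) (\<lambda>cs. F (c # cs))) ps As)"
    using Cons by (intro CE_hom_Cons) auto
  ultimately show ?case by (simp only: pairing_dif_Cons[OF Cons(1)])
qed

section \<open>Cochains given by families of coefficients\<close>

definition cochain_of :: "'n::{finite,linorder} set \<Rightarrow> nat \<Rightarrow> int \<Rightarrow> (('n + 'n) list \<Rightarrow> ('n, 'k::real_normed_field) mv) \<Rightarrow>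
    ('n, 'k) form list \<Rightarrow> ('n, 'k) mv" where
  "cochain_of N k e F As = (if length As = k \<and> set As \<subseteq> adapted_forms N then pairing e F As else 0)"

text \<open>Differential forms relative to the subspace: by \<open>pairing_adapted\<close>, the
  condition on words of normal coordinates is what makes the values adapted. The summand 1 in the
  degree undoes the shift, which \<open>e\<close> includes and \<open>mv_degree\<close> does
  not.\<close>

definition coeff_families :: "'n::{finite,linorder} set \<Rightarrow> nat \<Rightarrow> int \<Rightarrow> (('n + 'n) list \<Rightarrow> ('n, 'k::real_normed_field) mv) set" where
  "coeff_families N k e = {F. alternating F \<and> (\<forall>cs. F cs \<in> mvs) \<and> (\<forall>cs. length cs \<noteq> k \<longrightarrow> F cs = 0) \<and>
     (\<forall>cs. length cs = k \<longrightarrow> mv_degree (e + 1 + sum_list (map gam cs)) (F cs)) \<and>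
     (\<forall>cs. (\<forall>c\<in>set cs. \<not> tangential N c) \<longrightarrow> F cs \<in> adapted N)}"

lemma coeff_familiesD:
  assumes "F \<in> coeff_families N k e"
  shows "alternating F" "F cs \<in> mvs" "length cs \<noteq> k \<Longrightarrow> F cs = 0"
    "length cs = k \<Longrightarrow> mv_degree (e + 1 + sum_list (map gam cs)) (F cs)"
    "\<forall>c\<in>set cs. \<not> tangential N c \<Longrightarrow> F cs \<in> adapted N"
  using assms by (auto simp: coeff_families_def)

lemma cochain_of_pairing:
  assumes "F \<in> coeff_families N k e" "set As \<subseteq> adapted_forms N"
  shows "cochain_of N k e F As = pairing e F As"
proof (cases "length As = k")
  case False
  then have "pairing e F As = pairing e (\<lambda>cs. 0) As"
    using coeff_familiesD(3)[OF assms(1)] by (intro pairing_cong) simp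
  with False show ?thesis by (simp add: cochain_of_def pairing_0)
qed (simp add: cochain_of_def assms)

lemma list_split_two:
  assumes "Suc i < length xs"
  obtains us a b vs where "xs = us @ a # b # vs" "length us = i"
proof
  show "xs = take i xs @ xs ! i # xs ! Suc i # drop (Suc (Suc i)) xs"
    using assms by (simp add: Cons_nth_drop_Suc id_take_nth_drop[symmetric])
  show "length (take i xs) = i" using assms by simp
qed

lemma cochain_of_multimaps:
  fixes F :: "('n::{finite,linorder} + 'n) list \<Rightarrow> ('n, 'k::real_normed_field) mv"
  assumes "F \<in> coeff_families N k e"
  shows "cochain_of N k e F \<in> multimaps N k e"
proof -
  note F = coeff_familiesD[OF assms] and P = cochain_of_pairing[OF assms]
  have upd: "set (As[i := B]) \<subseteq> adapted_forms N"
    if "set As \<subseteq> adapted_forms N" "B \<in> adapted_forms N" for As i and B :: "('n, 'k) form"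
    using that set_update_subset_insert[of As i B] by blast
  have nth: "As ! i \<in> adapted_forms N" if "set As \<subseteq> adapted_forms N" "i < length As" for As :: "('n, 'k) form list" and i
    using that by auto
  show ?thesis
    unfolding multimaps_def
  proof (intro CollectI conjI allI impI)
    fix As :: "('n, 'k) form list" assume "\<not> (length As = k \<and> set As \<subseteq> adapted_forms N)"
    then show "cochain_of N k e F As = 0" by (auto simp: cochain_of_def)
  next
    fix As :: "('n, 'k) form list" assume "length As = k \<and> set As \<subseteq> adapted_forms N"
    then show "cochain_of N k e F As \<in> adapted N"
      using F by (simp add: P pairing_adapted)
  next
    fix As :: "('n, 'k) form list" and i and B :: "('n, 'k) form" assume "length As = k \<and> set As \<subseteq> adapted_forms N \<and> i < k \<and> B \<in> adapted_forms N"
    then show "cochain_of N k e F (As[i := As ! i + B]) = cochain_of N k e F As + cochain_of N k e F (As[i := B])"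
      by (simp add: P upd nth adapted_forms_add pairing_update_add)
  next
    fix As :: "('n, 'k) form list" and ps assume *: "length As = k \<and> set As \<subseteq> adapted_forms N \<and> list_all2 form_degree ps As"
    have "mv_degree (e + 1 + deg_sum ps) (pairing e F As)"
      using * F(4) by (intro mv_degree_pairing) auto
    with * show "mv_degree (e + deg_sum ps + 1) (cochain_of N k e F As)" by (simp add: P add_ac)
  next
    fix As :: "('n, 'k) form list" and ps i and f :: "('n, 'k) mv" and m
    assume "length As = k \<and> set As \<subseteq> adapted_forms N \<and> list_all2 form_degree ps As \<and> i < k \<and> f \<in> mvs \<and> mv_degree m f"
    then show "cochain_of N k e F (As[i := fmult f (As ! i)]) = koszul (m * (e + deg_sum (take i ps))) (wedge f (cochain_of N k e F As))"
      by (simp add: P upd nth adapted_forms_fmult pairing_update_fmult)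
  next
    fix As :: "('n, 'k) form list" and ps i
    assume *: "length As = k \<and> set As \<subseteq> adapted_forms N \<and> list_all2 form_degree ps As \<and> Suc i < k"
    then obtain us a b vs where As: "As = us @ a # b # vs" and us: "length us = i"
      using list_split_two[of i As] by metis
    have ds: "form_degree (ps ! i) a" "form_degree (ps ! Suc i) b"
      using * list_all2_nthD2[of form_degree ps As i] list_all2_nthD2[of form_degree ps As "Suc i"] us
      by (auto simp: As nth_append)
    have eq: "As[i := As ! Suc i, Suc i := As ! i] = us @ b # a # vs"
      using us by (simp add: As list_update_append nth_append)
    have "pairing e F (us @ b # a # vs) = - koszul ((ps ! Suc i - 1) * (ps ! i - 1)) (pairing e F (us @ a # b # vs))"
      by (rule pairing_swap[OF ds(2,1) F(1)])
    with * show "cochain_of N k e F (As[i := As ! Suc i, Suc i := As ! i]) =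
          - koszul ((ps ! i - 1) * (ps ! Suc i - 1)) (cochain_of N k e F As)"
      unfolding eq by (simp add: P As mult.commute)
  qed
qed

text \<open>The formula evaluates its cochain on adapted forms only, brackets included, so
  \<open>cochain_of\<close> may be replaced by the \<open>pairing\<close> that it restricts.\<close>

lemma CE_hom_cong:
  assumes "set As \<subseteq> adapted_forms N" "\<And>Bs. set Bs \<subseteq> adapted_forms N \<Longrightarrow> \<phi> Bs = \<psi> Bs"
  shows "CE_hom e \<phi> ps As = CE_hom e \<psi> ps As"
proof -
  have del: "set (nths As X) \<subseteq> adapted_forms N" for X
    using assms(1) set_nths_subset[of As X] by blast
  have "form_bracket (As ! i) (As ! j) \<in> adapted_forms N" if "i < length As" "j < length As" for i j
    using that assms(1) by (intro form_bracket_adapted) auto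
  with del assms(2) show ?thesis
    unfolding CE_hom_def by (intro arg_cong2[where f = "(+)"] sum.cong arg_cong2[where f = koszul] arg_cong2[where f = act] refl) auto
qed

lemma CE_cochain_of:
  fixes F :: "('n::{finite,linorder} + 'n) list \<Rightarrow> ('n, 'k::real_normed_field) mv"
  assumes "F \<in> coeff_families N k e" "dif e F \<in> coeff_families N (Suc k) e"
  shows "CE N e (cochain_of N k e F) = cochain_of N (Suc k) e (dif e F)"
proof
  fix As :: "('n, 'k) form list"
  show "CE N e (cochain_of N k e F) As = cochain_of N (Suc k) e (dif e F) As"
  proof (cases "set As \<subseteq> adapted_forms N")
    case True
    have "CE_hom e (cochain_of N k e F) ps (map2 form_part ps As) = pairing e (dif e F) (map2 form_part ps As)"
      if ps: "length ps = length As" "set ps \<subseteq> form_degrees TYPE('n)" for ps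
    proof -
      have sub: "set (map2 form_part ps As) \<subseteq> adapted_forms N"
        using True by (auto dest!: set_zip_rightD intro!: form_part_adapted)
      have "list_all2 form_degree ps (map2 form_part ps As)"
        using ps by (auto simp: list_all2_conv_all_nth form_degree_part)
      moreover have "set (map2 form_part ps As) \<subseteq> forms" using sub adapted_forms_forms by blast
      ultimately have "CE_hom e (pairing e F) ps (map2 form_part ps As) = pairing e (dif e F) (map2 form_part ps As)"
        using ps coeff_familiesD[OF assms(1)] by (intro CE_hom_pairing)
      moreover have "CE_hom e (cochain_of N k e F) ps (map2 form_part ps As) = CE_hom e (pairing e F) ps (map2 form_part ps As)"
        by (rule CE_hom_cong[OF sub]) (rule cochain_of_pairing[OF assms(1)])
      ultimately show ?thesis by simp
    qed
    then have "CE N e (cochain_of N k e F) As = (\<Sum>ps | length ps = length As \<and> set ps \<subseteq> form_degrees TYPE('n).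
        pairing e (dif e F) (map2 form_part ps As))"
      using True by (simp add: CE_def)
    then show ?thesis
      by (simp add: pairing_form_parts cochain_of_pairing[OF assms(2) True])
  qed (simp add: CE_def cochain_of_def)
qed

lemma dif_coeff_families:
  assumes "F \<in> coeff_families N k e"
  shows "dif e F \<in> coeff_families N (Suc k) e"
proof -
  note F = coeff_familiesD[OF assms]
  have "dif e F cs = 0" if "length cs \<noteq> Suc k" for cs
  proof -
    have "dif e F cs = dif e (\<lambda>cs. 0) cs" using that F(3) by (intro dif_cong) auto
    then show ?thesis by (simp add: dif_0)
  qed
  moreover have "mv_degree (e + 1 + sum_list (map gam cs)) (dif e F cs)" if "length cs = Suc k" for cs
    using that F(4) by (intro mv_degree_dif) simp
  ultimately show ?thesis
    using F unfolding coeff_families_def by (auto intro: alternating_dif mvs_dif dif_adapted)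
qed

section \<open>Extension of cochains across the submanifold\<close>

definition dform :: "'n::{finite,linorder} + 'n \<Rightarrow> ('n, 'k::real_normed_field) form" where
  "dform c = (\<lambda>c'. if c' = c then unit_mv else 0)"

lemma sg_zero [simp]: "sg 0 \<xi> = \<xi>"
  by (simp add: sg_def)

lemma wedge_unit_right [simp]: "wedge \<xi> unit_mv = \<xi>"
  using wedge_commute[OF mv_degree_unit, of \<xi>] by simp

lemma dform_forms [simp]: "dform c \<in> forms"
  by (simp add: forms_def dform_def)

lemma form_degree_dform: "form_degree (coord_degree c) (dform c)"
  by (simp add: form_degree_iff dform_def gam_def)

lemma form_degree_fmult: "mv_degree m f \<Longrightarrow> form_degree p A \<Longrightarrow> form_degree (m + p) (fmult f A)"
  unfolding form_degree_iff fmult_def using mv_degree_wedge by (fastforce simp: algebra_simps)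

lemma mv_degree_coord: "mv_degree (coord_degree c) (coord c)"
  by (cases c) (auto simp: mv_degree_def coord_def coord_degree_def fun_eq_iff fun_ops split: if_splits)

lemma mvs_coord: "coord c \<in> mvs"
proof (cases c)
  case (Inl i)
  show ?thesis
    unfolding Inl mvs_def
  proof (intro CollectI allI)
    fix I
    show "smooth (coord (Inl i) I)" by (cases "I = {}") (simp_all add: coord_def)
  qed
next
  case (Inr i)
  then show ?thesis by (simp add: mvs_def coord_def)
qed

lemma adapted_coord: "(case c of Inl i \<Rightarrow> i \<in> N | Inr i \<Rightarrow> i \<notin> N) \<Longrightarrow> coord c \<in> adapted N"
  by (cases c) (auto simp: adapted_iff mvs_coord, auto simp: coord_def submfd_def)

section \<open>Multiplication by an even coordinate\<close>

abbreviation xmult :: "'n::{finite,linorder} \<Rightarrow> ('n, 'k::real_normed_field) mv \<Rightarrow> ('n, 'k) mv" where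
  "xmult m \<equiv> wedge (coord (Inl m))"

lemma mv_degree_x: "mv_degree 0 (coord (Inl m))"
  using mv_degree_coord[of "Inl m"] by (simp add: coord_degree_def)

lemma xmult_apply: "xmult m \<xi> I x = of_real (x $ m) * \<xi> I x"
proof -
  have "xmult m \<xi> I = (\<Sum>J\<in>Pow I. if J = {} then (\<lambda>x. of_real (x $ m) * \<xi> I x) else 0)"
    unfolding wedge_eq by (intro sum.cong) (auto simp: coord_def fun_eq_iff fun_ops)
  then show ?thesis by simp
qed

lemma xmult_funpow_apply: "(xmult m ^^ k) \<xi> I x = of_real (x $ m) ^ k * \<xi> I x"
  by (induction k) (auto simp: xmult_apply)

lemma xmult_inj:
  fixes \<xi> \<eta> :: "('n::{finite,linorder}, 'k::real_normed_field) mv"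
  assumes "\<xi> \<in> mvs" "\<eta> \<in> mvs" "(xmult m ^^ k) \<xi> = (xmult m ^^ k) \<eta>"
  shows "\<xi> = \<eta>"
proof
  fix I
  show "\<xi> I = \<eta> I"
  proof (rule eq_off_hyperplane[where i = m])
    fix x :: "(real, 'n) vec" assume "x $ m \<noteq> 0"
    moreover have "of_real (x $ m) ^ k * \<xi> I x = of_real (x $ m) ^ k * \<eta> I x"
      using assms(3) by (simp flip: xmult_funpow_apply)
    ultimately show "\<xi> I x = \<eta> I x" by simp
  qed (use assms mvsD in auto)
qed

lemma xmult_koszul: "(xmult m ^^ k) (koszul s \<xi>) = koszul s ((xmult m ^^ k) \<xi>)"
  by (induction k) (auto simp: wedge_koszul_right)

lemma xmult_uminus: "(xmult m ^^ k) (- \<xi>) = - (xmult m ^^ k) \<xi>"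
  by (induction k) (auto simp: wedge_uminus_right)

lemma mv_degree_xmult_cancel:
  assumes "\<xi> \<in> mvs" "mv_degree n ((xmult m ^^ k) \<xi>)"
  shows "mv_degree n \<xi>"
  unfolding mv_degree_def
proof (intro allI impI)
  fix I assume I: "\<xi> I \<noteq> 0"
  have "(xmult m ^^ k) \<xi> I \<noteq> 0"
  proof
    assume "(xmult m ^^ k) \<xi> I = 0"
    then have 0: "of_real (x $ m) ^ k * \<xi> I x = 0" for x
      using xmult_funpow_apply[of k m \<xi> I x] by (simp add: fun_ops)
    have "\<xi> I = 0"
    proof (rule eq_off_hyperplane[where i = m])
      show "\<xi> I x = 0 x" if "x $ m \<noteq> 0" for x using 0[of x] that by (simp add: fun_ops)
    qed (use assms mvsD in auto)
    with I show False by simp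
  qed
  then show "int (card I) = n" using assms(2) by (simp add: mv_degree_def)
qed

lemma xform_commute:
  fixes A :: "('n::{finite,linorder}, 'k::real_normed_field) form"
  shows "fmult (coord (Inl m)) (fmult (coord (Inl m')) A) = fmult (coord (Inl m')) (fmult (coord (Inl m)) A)"
  using wedge_commute[OF mv_degree_x, of m "coord (Inl m') :: ('n, 'k) mv"]
  by (simp add: fmult_def flip: wedge_assoc)

lemma form_degree_xform: "form_degree p A \<Longrightarrow> form_degree p (fmult (coord (Inl m)) A)"
  using form_degree_fmult[OF mv_degree_x] by fastforce

lemma xform_adapted: "m \<in> N \<Longrightarrow> A \<in> forms \<Longrightarrow> fmult (coord (Inl m)) A \<in> adapted_forms N"
  by (rule fmult_adapted) (auto intro: adapted_coord)

lemma homogeneous_xform: "\<exists>p. form_degree p A \<Longrightarrow> \<exists>p. form_degree p (fmult (coord (Inl m)) A)"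
  using form_degree_xform by blast

lemma homogeneous_dform: "\<exists>p. form_degree p (dform c)"
  using form_degree_dform by blast

text \<open>\<open>dform c\<close> alone may fail to be adapted, but its multiple by x_m is adapted
  as soon as \<open>m \<in> N\<close>. In this form a cochain can be applied term by term.\<close>

lemma xform_expand:
  fixes A :: "('n::{finite,linorder}, 'k::real_normed_field) form"
  shows "fmult (coord (Inl m)) A = (\<Sum>c\<in>UNIV. fmult (A c) (fmult (coord (Inl m)) (dform c)))"
proof
  fix c'
  have "(\<Sum>c\<in>UNIV. fmult (A c) (fmult (coord (Inl m)) (dform c))) c'
      = (\<Sum>c\<in>UNIV. fmult (A c) (fmult (coord (Inl m)) (dform c)) c')"
    by (rule sum_fun_apply)
  also have "\<dots> = (\<Sum>c\<in>UNIV. if c = c' then wedge (A c') (coord (Inl m)) else 0)"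
    by (intro sum.cong) (auto simp: fmult_def dform_def)
  also have "\<dots> = fmult (coord (Inl m)) A c'"
    using wedge_commute[OF mv_degree_x, of m "A c'"] by (simp add: fmult_def)
  finally show "fmult (coord (Inl m)) A c' = (\<Sum>c\<in>UNIV. fmult (A c) (fmult (coord (Inl m)) (dform c))) c'" ..
qed

lemma hsum_fmult_dform: "hsum e (fmult f (dform c)) g = wedge (sg e f) (g c)"
proof -
  have "hsum e (fmult f (dform c)) g = (\<Sum>c'\<in>UNIV. if c' = c then wedge (sg e f) (g c) else 0)"
    unfolding hsum_def by (intro sum.cong) (auto simp: fmult_def dform_def)
  then show ?thesis by simp
qed

lemma fmult_unit [simp]: "fmult unit_mv A = A"
  by (simp add: fmult_def)

lemma pairing_dform: "pairing e F (map dform cs) = F cs"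
  by (induction cs arbitrary: e F)
    (simp_all add: pairing_Cons hsum_fmult_dform[of _ unit_mv, simplified])

lemma pairing_xform:
  fixes F :: "('n::{finite,linorder} + 'n) list \<Rightarrow> ('n, 'k::real_normed_field) mv"
  shows "pairing e F (map (\<lambda>c. fmult (coord (Inl m)) (dform c)) cs) = (xmult m ^^ length cs) (F cs)"
proof (induction cs arbitrary: e F)
  case (Cons c cs)
  then show ?case
    using sg_homogeneous[OF mv_degree_x, where 'a = 'n and 'b = 'k, of _ m]
    by (simp add: pairing_Cons hsum_fmult_dform)
qed simp

lemma pairing_xmult: "pairing e (\<lambda>cs. (xmult m ^^ k) (F cs)) As = (xmult m ^^ k) (pairing e F As)"
proof (induction k)
  case (Suc k)
  have "pairing (e + 0) (\<lambda>cs. xmult m ((xmult m ^^ k) (F cs))) As = xmult m (pairing e (\<lambda>cs. (xmult m ^^ k) (F cs)) As)"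
    by (rule pairing_wedge[OF mv_degree_x])
  with Suc show ?case by simp
qed simp

lemma homogeneous_listE:
  assumes "\<forall>A\<in>set As. \<exists>p. form_degree p A"
  obtains ps where "list_all2 form_degree ps As"
proof
  show "list_all2 form_degree (map (\<lambda>A. SOME p. form_degree p A) As) As"
    using assms by (auto simp: list_all2_conv_all_nth intro: someI_ex)
qed

lemma list_all2_homogeneous: "list_all2 form_degree ps As \<Longrightarrow> \<forall>A\<in>set As. \<exists>p. form_degree p A"
  by (induction rule: list_all2_induct) auto

section \<open>Values of a homogeneous cochain\<close>

context
  fixes N :: "'n::{finite,linorder} set" and k e and \<phi> :: "('n, 'k::{real_normed_field,banach}) form list \<Rightarrow> ('n, 'k) mv"
  assumes \<phi>: "\<phi> \<in> multimaps N k e"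
begin

lemmas multimaps_conj = \<phi>[unfolded multimaps_def mem_Collect_eq]

lemma multimaps_zero: "\<not> (length As = k \<and> set As \<subseteq> adapted_forms N) \<Longrightarrow> \<phi> As = 0"
  by (rule multimaps_conj[THEN conjunct1, THEN spec, THEN mp])

lemma multimaps_adapted: "\<phi> As \<in> adapted N"
proof (cases "length As = k \<and> set As \<subseteq> adapted_forms N")
  case True
  then show ?thesis
    by (rule multimaps_conj[THEN conjunct2, THEN conjunct1, THEN spec, THEN mp])
next
  case False
  then show ?thesis by (simp add: multimaps_zero)
qed

lemma multimaps_add:
  assumes "length (Us @ A # Vs) = k" "set (Us @ A # Vs) \<subseteq> adapted_forms N" "B \<in> adapted_forms N"
  shows "\<phi> (Us @ (A + B) # Vs) = \<phi> (Us @ A # Vs) + \<phi> (Us @ B # Vs)"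
proof -
  have "\<forall>As i B. length As = k \<and> set As \<subseteq> adapted_forms N \<and> i < k \<and> B \<in> adapted_forms N \<longrightarrow>
        \<phi> (As[i := As ! i + B]) = \<phi> As + \<phi> (As[i := B])"
    by (rule multimaps_conj[THEN conjunct2, THEN conjunct2, THEN conjunct1])
  from this[rule_format, of "Us @ A # Vs" "length Us" B] assms show ?thesis by simp
qed

lemma multimaps_sum:
  assumes "length (Us @ Vs) + 1 = k" "set (Us @ Vs) \<subseteq> adapted_forms N" "finite S"
    and "\<And>a. a \<in> S \<Longrightarrow> f a \<in> adapted_forms N"
  shows "\<phi> (Us @ (\<Sum>a\<in>S. f a) # Vs) = (\<Sum>a\<in>S. \<phi> (Us @ f a # Vs))"
  using assms(3,4)
proof (induction S rule: finite_induct)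
  case empty
  have "\<phi> (Us @ (0 + 0) # Vs) = \<phi> (Us @ 0 # Vs) + \<phi> (Us @ 0 # Vs)"
    using assms by (intro multimaps_add) auto
  then show ?case by simp
next
  case (insert a S)
  have "\<phi> (Us @ (f a + (\<Sum>a\<in>S. f a)) # Vs) = \<phi> (Us @ f a # Vs) + \<phi> (Us @ (\<Sum>a\<in>S. f a) # Vs)"
    using assms(1,2) insert by (intro multimaps_add adapted_forms_sum) auto
  with insert show ?case by simp
qed

lemma multimaps_fmult:
  assumes "length (Us @ A # Vs) = k" "set (Us @ A # Vs) \<subseteq> adapted_forms N"
    and "list_all2 form_degree us Us" "\<forall>V\<in>set (A # Vs). \<exists>p. form_degree p V" "f \<in> mvs" "mv_degree m f"
  shows "\<phi> (Us @ fmult f A # Vs) = koszul (m * (e + deg_sum us)) (wedge f (\<phi> (Us @ A # Vs)))"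
proof -
  obtain vs where vs: "list_all2 form_degree vs (A # Vs)"
    by (rule homogeneous_listE[OF assms(4)])
  have *: "\<forall>As ps i f m. length As = k \<and> set As \<subseteq> adapted_forms N \<and> list_all2 form_degree ps As \<and>
        i < k \<and> f \<in> mvs \<and> mv_degree m f \<longrightarrow>
        \<phi> (As[i := fmult f (As ! i)]) = koszul (m * (e + deg_sum (take i ps))) (wedge f (\<phi> As))"
    by (rule multimaps_conj[THEN conjunct2, THEN conjunct2, THEN conjunct2, THEN conjunct2, THEN conjunct1])
  have "length Us < k" using assms(1) by simp
  with assms(1,2,5,6) list_all2_appendI[OF assms(3) vs]
  have "length (Us @ A # Vs) = k \<and> set (Us @ A # Vs) \<subseteq> adapted_forms N \<and>
      list_all2 form_degree (us @ vs) (Us @ A # Vs) \<and> length Us < k \<and> f \<in> mvs \<and> mv_degree m f"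
    by (intro conjI)
  from *[THEN spec, THEN spec, THEN spec, THEN spec, THEN spec, THEN mp, OF this]
  show ?thesis
    using list_all2_lengthD[OF assms(3)] by simp
qed

lemma multimaps_swap:
  assumes "length (Us @ A # B # Vs) = k" "set (Us @ A # B # Vs) \<subseteq> adapted_forms N"
    and "\<forall>V\<in>set (Us @ A # B # Vs). \<exists>p. form_degree p V" "form_degree p A" "form_degree q B"
  shows "\<phi> (Us @ B # A # Vs) = - koszul ((p - 1) * (q - 1)) (\<phi> (Us @ A # B # Vs))"
proof -
  have "\<forall>V\<in>set Us. \<exists>p. form_degree p V" using assms(3) by simp
  then obtain us where us: "list_all2 form_degree us Us" by (rule homogeneous_listE)
  have "\<forall>V\<in>set Vs. \<exists>p. form_degree p V" using assms(3) by simp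
  then obtain vs where vs: "list_all2 form_degree vs Vs" by (rule homogeneous_listE)
  have deg: "list_all2 form_degree (us @ p # q # vs) (Us @ A # B # Vs)"
    using us vs assms(4,5) by (intro list_all2_appendI) simp_all
  have *: "\<forall>As ps i. length As = k \<and> set As \<subseteq> adapted_forms N \<and> list_all2 form_degree ps As \<and>
        Suc i < k \<longrightarrow>
        \<phi> (As[i := As ! Suc i, Suc i := As ! i]) =
          - koszul ((ps ! i - 1) * (ps ! Suc i - 1)) (\<phi> As)"
    by (rule multimaps_conj[THEN conjunct2, THEN conjunct2, THEN conjunct2, THEN conjunct2, THEN conjunct2])
  have "Suc (length Us) < k" using assms(1) by simp
  with assms(1,2) deg
  have "length (Us @ A # B # Vs) = k \<and> set (Us @ A # B # Vs) \<subseteq> adapted_forms N \<and>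
      list_all2 form_degree (us @ p # q # vs) (Us @ A # B # Vs) \<and> Suc (length Us) < k"
    by (intro conjI)
  from *[THEN spec, THEN spec, THEN spec, THEN mp, OF this]
  show ?thesis
    using list_all2_lengthD[OF us] by (simp add: nth_append list_update_append)
qed

lemma multimaps_degree:
  assumes "length As = k" "set As \<subseteq> adapted_forms N" "list_all2 form_degree ps As"
  shows "mv_degree (e + deg_sum ps + 1) (\<phi> As)"
  by (rule multimaps_conj[THEN conjunct2, THEN conjunct2, THEN conjunct2, THEN conjunct1, THEN spec, THEN spec, THEN mp])
    (intro conjI assms)

lemma multimaps_xform:
  assumes "m \<in> N" "length (Ws @ Us) = k" "set (Ws @ Us) \<subseteq> adapted_forms N" "\<forall>V\<in>set (Ws @ Us). \<exists>p. form_degree p V"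
  shows "\<phi> (Ws @ map (fmult (coord (Inl m))) Us) = (xmult m ^^ length Us) (\<phi> (Ws @ Us))"
  using assms(2-)
proof (induction Us arbitrary: Ws)
  case (Cons U Us)
  let ?U = "fmult (coord (Inl m)) U"
  have "?U \<in> adapted_forms N"
    using Cons.prems by (intro adapted_forms_fmult mvs_coord) auto
  moreover have "\<exists>p. form_degree p ?U" using Cons.prems(3) form_degree_xform by auto
  ultimately have "\<phi> ((Ws @ [?U]) @ map (fmult (coord (Inl m))) Us) = (xmult m ^^ length Us) (\<phi> ((Ws @ [?U]) @ Us))"
    using Cons.prems by (intro Cons.IH) auto
  moreover have "\<forall>V\<in>set Ws. \<exists>p. form_degree p V" using Cons.prems(3) by simp
  then obtain ws where "list_all2 form_degree ws Ws" by (rule homogeneous_listE)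
  then have "\<phi> (Ws @ ?U # Us) = koszul (0 * (e + deg_sum ws)) (xmult m (\<phi> (Ws @ U # Us)))"
    using Cons.prems by (intro multimaps_fmult mvs_coord mv_degree_x) auto
  ultimately show ?case by (simp add: funpow_swap1)
qed simp

text \<open>The slots are expanded one at a time from the left: \<open>cs\<close> lists the
  coordinates already chosen, and later coefficients have to pass them, which shifts
  \<open>e\<close> by their degrees.\<close>

lemma multimaps_expand:
  assumes "m \<in> N" "length cs + length As = k" "set As \<subseteq> forms" "list_all2 form_degree ps As"
  shows "\<phi> (map (\<lambda>c. fmult (coord (Inl m)) (dform c)) cs @ map (fmult (coord (Inl m))) As) =
    pairing (e + sum_list (map gam cs)) (\<lambda>ds. \<phi> (map (\<lambda>c. fmult (coord (Inl m)) (dform c)) (cs @ ds))) As"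
  using assms(4,2,3)
proof (induction ps As arbitrary: cs rule: list_all2_induct)
  case Nil
  show ?case by simp
next
  case (Cons p ps A As)
  let ?X = "fmult (coord (Inl m)) :: ('n, 'k) form \<Rightarrow> ('n, 'k) form"
  let ?Xd = "\<lambda>c. ?X (dform c)"
  let ?G = "\<lambda>ds. \<phi> (map ?Xd ds)"
  let ?e = "e + sum_list (map gam cs)"
  have Xd: "set (map ?Xd ds) \<subseteq> adapted_forms N" for ds
    using assms(1) by (auto intro!: xform_adapted)
  have X: "set (map ?X As) \<subseteq> adapted_forms N"
    using assms(1) Cons.prems by (auto intro!: xform_adapted)
  have deg: "list_all2 form_degree (map coord_degree cs) (map ?Xd cs)"
    by (auto simp: list_all2_conv_all_nth intro!: form_degree_xform form_degree_dform)
  have sum: "deg_sum (map coord_degree cs) = sum_list (map gam cs)"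
    by (induction cs) (auto simp: gam_def)
  have hom: "\<forall>V\<in>set (?Xd c # map ?X As). \<exists>p. form_degree p V" for c
    using list_all2_homogeneous[OF Cons(2)] by (simp add: homogeneous_xform homogeneous_dform)
  have Amvs: "A c \<in> mvs" for c using Cons.prems(2) formsD[of A c] by simp
  have fm: "\<phi> (map ?Xd cs @ fmult (A c) (?Xd c) # map ?X As) =
      koszul ((p - 1 - gam c) * ?e) (wedge (A c) (\<phi> (map ?Xd cs @ ?Xd c # map ?X As)))" for c
  proof -
    have 1: "length (map ?Xd cs @ ?Xd c # map ?X As) = k" using Cons.prems(1) by simp
    have "?Xd c \<in> adapted_forms N" by (rule xform_adapted[OF assms(1) dform_forms])
    then have 2: "set (map ?Xd cs @ ?Xd c # map ?X As) \<subseteq> adapted_forms N"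
      using Xd[of cs] X by simp
    show ?thesis
      unfolding sum[symmetric]
      by (rule multimaps_fmult[OF 1 2 deg hom[of c] Amvs[of c] form_degree_mv_degree[OF Cons(1), of c]])
  qed
  have "\<phi> (map ?Xd cs @ map ?X (A # As)) = \<phi> (map ?Xd cs @ (\<Sum>c\<in>UNIV. fmult (A c) (?Xd c)) # map ?X As)"
    by (simp only: list.map xform_expand[of m A, symmetric])
  also have "\<dots> = (\<Sum>c\<in>UNIV. \<phi> (map ?Xd cs @ fmult (A c) (?Xd c) # map ?X As))"
    using Cons.prems(1) Xd[of cs] X
    by (intro multimaps_sum) (simp_all add: adapted_forms_fmult Amvs xform_adapted[OF assms(1)])
  also have "\<dots> = hsum ?e A (\<lambda>c. \<phi> (map ?Xd (cs @ [c]) @ map ?X As))"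
    unfolding hsum_def fm sg_homogeneous[OF form_degree_mv_degree[OF Cons(1)]] wedge_koszul_left
    by (simp only: mult.commute map_append list.map append_assoc append_Cons append_Nil)
  also have "\<dots> = hsum ?e A (\<lambda>c. pairing (e + sum_list (map gam (cs @ [c]))) (\<lambda>ds. ?G ((cs @ [c]) @ ds)) As)"
    using Cons.prems by (intro hsum_cong Cons.IH) auto
  finally show ?case by (simp add: pairing_Cons add.assoc)
qed

end

text \<open>Additivity in each slot reduces to homogeneous parts; in the induction \<open>Us\<close>
  is the prefix whose entries are already homogeneous.\<close>

lemma multimaps_eqI:
  fixes N :: "'n::{finite,linorder} set" and \<phi> \<psi> :: "('n, 'k::{real_normed_field,banach}) form list \<Rightarrow> ('n, 'k) mv"
  assumes \<phi>: "\<phi> \<in> multimaps N k e" and \<psi>: "\<psi> \<in> multimaps N k e"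
    and eq: "\<And>As ps. length As = k \<Longrightarrow> set As \<subseteq> adapted_forms N \<Longrightarrow> list_all2 form_degree ps As \<Longrightarrow> \<phi> As = \<psi> As"
  shows "\<phi> = \<psi>"
proof
  fix As
  have main: "\<phi> (Us @ Vs) = \<psi> (Us @ Vs)"
    if "length (Us @ Vs) = k" "set (Us @ Vs) \<subseteq> adapted_forms N" "\<forall>U\<in>set Us. \<exists>p. form_degree p U" for Us Vs
    using that
  proof (induction Vs arbitrary: Us)
    case Nil
    from Nil(3) obtain ps where "list_all2 form_degree ps Us" by (rule homogeneous_listE)
    then show ?case using eq[of Us ps] Nil by simp
  next
    case (Cons V Vs)
    let ?V = "\<lambda>p. form_part p V"
    have "\<phi> ((Us @ [?V p]) @ Vs) = \<psi> ((Us @ [?V p]) @ Vs)" for p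
      using Cons.prems form_degree_part[of p V] by (intro Cons.IH) (auto intro!: form_part_adapted)
    then have "(\<Sum>p\<in>form_degrees TYPE('n). \<phi> (Us @ ?V p # Vs)) = (\<Sum>p\<in>form_degrees TYPE('n). \<psi> (Us @ ?V p # Vs))"
      by simp
    moreover have "\<phi>' (Us @ V # Vs) = (\<Sum>p\<in>form_degrees TYPE('n). \<phi>' (Us @ ?V p # Vs))" if "\<phi>' \<in> multimaps N k e" for \<phi>'
      using multimaps_sum[OF that, of Us Vs "form_degrees TYPE('n)" ?V] Cons.prems
      by (auto simp: sum_form_part intro: form_part_adapted)
    ultimately show ?case using \<phi> \<psi> by simp
  qed
  show "\<phi> As = \<psi> As"
  proof (cases "length As = k \<and> set As \<subseteq> adapted_forms N")
    case True
    then show ?thesis using main[of "[]" As] by simp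
  next
    case False
    then show ?thesis using multimaps_zero[OF \<phi>] multimaps_zero[OF \<psi>] by simp
  qed
qed

text \<open>The coefficients are found by evaluating on \<open>x \<^bold>d c\<close> with \<open>x\<close> one of the coordinates
  vanishing on the submanifold; a second such coordinate shows that the value is divisible by a power of \<open>x\<close>.\<close>
lemma multimaps_coeff_families:
  fixes N :: "'n::{finite,linorder} set" and \<phi> :: "('n, 'k::{real_normed_field,banach}) form list \<Rightarrow> ('n, 'k) mv"
  assumes \<phi>: "\<phi> \<in> multimaps N k e" and m: "m \<in> N" "m' \<in> N" "m \<noteq> m'"
  shows "\<exists>F\<in>coeff_families N k e. \<phi> = cochain_of N k e F"
proof -
  let ?X = "\<lambda>m. fmult (coord (Inl m) :: ('n, 'k) mv)"
  let ?Xd = "\<lambda>m c. ?X m (dform c)"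
  define G where "G m cs = \<phi> (map (?Xd m) cs)" for m cs
  have Gmvs: "G m cs \<in> mvs" for m cs
    unfolding G_def using multimaps_adapted[OF \<phi>] by (rule adapted_mvs)
  have Xd: "set (map (?Xd m) cs) \<subseteq> adapted_forms N" if "m \<in> N" for m cs
    using that by (auto intro!: xform_adapted)
  have Xdh: "\<forall>V\<in>set (map (?Xd m) cs). \<exists>p. form_degree p V" for m cs
    by (auto intro!: homogeneous_xform homogeneous_dform)
  have G: "\<phi> (map (?X n) (map (?Xd n') cs)) = (xmult n ^^ k) (G n' cs)" if "length cs = k" "n \<in> N" "n' \<in> N" for n n' cs
  proof -
    have "\<phi> ([] @ map (?X n) (map (?Xd n') cs)) = (xmult n ^^ length (map (?Xd n') cs)) (\<phi> ([] @ map (?Xd n') cs))"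
      by (rule multimaps_xform[OF \<phi> that(2)])
        (use Xd[OF that(3), of cs] Xdh[of n' cs] that(1) in simp_all)
    then show ?thesis by (simp only: append_Nil length_map that(1) G_def)
  qed
  have div: "\<exists>h. smooth h \<and> (\<forall>x. G m cs I x = of_real (x $ m) ^ k * h x)" if "length cs = k" for cs I
  proof (rule coord_power_dvd[where i = m and j = m' and k = k and g' = "G m' cs I"])
    \<comment> \<open>The value on the forms x_m x_m' dc is computed in two ways, taking out either
      coordinate.\<close>
    have eq: "map (?X m') (map (?Xd m) cs) = map (?X m) (map (?Xd m') cs)"
      by (simp add: xform_commute[of m' m])
    have "(xmult m' ^^ k) (G m cs) = (xmult m ^^ k) (G m' cs)"
      unfolding G[OF that m(2,1), symmetric] eq by (rule G[OF that m(1,2)])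
    then have "(xmult m' ^^ k) (G m cs) I x = (xmult m ^^ k) (G m' cs) I x" for x by simp
    then show "of_real (x $ m') ^ k * G m cs I x = of_real (x $ m) ^ k * G m' cs I x" for x
      unfolding xmult_funpow_apply .
  qed (simp_all add: mvsD[OF Gmvs] m)
  \<comment> \<open>The smooth quotient of \<open>G m cs\<close> by the power of x_m; pointwise
    division would leave it undetermined on the hyperplane x_m = 0.\<close>
  define F where "F cs = (if length cs = k then (\<lambda>I. SOME h. smooth h \<and> (\<forall>x. G m cs I x = of_real (x $ m) ^ k * h x)) else 0)" for cs
  have F: "smooth (F cs I) \<and> (\<forall>x. G m cs I x = of_real (x $ m) ^ k * F cs I x)" if "length cs = k" for cs I
  proof -
    have "F cs I = (SOME h. smooth h \<and> (\<forall>x. G m cs I x = of_real (x $ m) ^ k * h x))"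
      using that by (simp add: F_def)
    then show ?thesis by (simp only:) (rule someI_ex[OF div[OF that]])
  qed
  have Fmvs: "F cs \<in> mvs" for cs
  proof (cases "length cs = k")
    case False
    then have "F cs = 0" by (simp add: F_def)
    then show ?thesis by simp
  qed (use F in \<open>simp add: mvs_def\<close>)
  have FG: "(xmult m ^^ k) (F cs) = G m cs" if "length cs = k" for cs
  proof (intro ext)
    fix I x
    show "(xmult m ^^ k) (F cs) I x = G m cs I x"
      unfolding xmult_funpow_apply using F[OF that, of I] by simp
  qed
  have alt: "alternating F"
    unfolding alternating_def
  proof (intro allI)
    fix us a b vs
    show "F (us @ a # b # vs) = - koszul (gam a * gam b) (F (us @ b # a # vs))"
    proof (cases "length (us @ a # b # vs) = k")
      case True
      have 1: "length (map (?Xd m) us @ ?Xd m b # ?Xd m a # map (?Xd m) vs) = k" using True by simp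
      have 2: "set (map (?Xd m) us @ ?Xd m b # ?Xd m a # map (?Xd m) vs) \<subseteq> adapted_forms N"
        using Xd[OF m(1), of "us @ b # a # vs"] by simp
      have 3: "\<forall>V\<in>set (map (?Xd m) us @ ?Xd m b # ?Xd m a # map (?Xd m) vs). \<exists>p. form_degree p V"
        using Xdh[of m "us @ b # a # vs"] by simp
      have "G m (us @ a # b # vs) = - koszul ((coord_degree b - 1) * (coord_degree a - 1)) (G m (us @ b # a # vs))"
        unfolding G_def map_append list.map
        by (rule multimaps_swap[OF \<phi> 1 2 3 form_degree_xform[OF form_degree_dform] form_degree_xform[OF form_degree_dform]])
      also have "(coord_degree b - 1) * (coord_degree a - 1) = gam a * gam b" by (simp add: gam_def)
      finally have "(xmult m ^^ k) (F (us @ a # b # vs)) = (xmult m ^^ k) (- koszul (gam a * gam b) (F (us @ b # a # vs)))"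
        using True by (simp add: FG xmult_uminus xmult_koszul)
      then show ?thesis by (rule xmult_inj[OF Fmvs mvs_uminus[OF mvs_koszul[OF Fmvs]]])
    qed (simp add: F_def)
  qed
  \<comment> \<open>After multiplication by the power of x_m both sides become the pairing with
    \<open>G m\<close>, and the power cancels.\<close>
  have ev: "\<phi> As = pairing e F As" if "length As = k" "set As \<subseteq> adapted_forms N" "list_all2 form_degree ps As" for As ps
  proof (rule xmult_inj[where m = m and k = k])
    have "set As \<subseteq> forms" using that(2) adapted_forms_forms by blast
    then show "\<phi> As \<in> mvs" "pairing e F As \<in> mvs"
      using multimaps_adapted[OF \<phi>] adapted_mvs Fmvs pairing_mvs by blast+
    have "\<forall>V\<in>set As. \<exists>p. form_degree p V"
      by (rule list_all2_homogeneous[OF that(3)])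
    then have "(xmult m ^^ k) (\<phi> As) = \<phi> (map (?X m) As)"
      using multimaps_xform[OF \<phi> m(1), of "[]" As] that by simp
    also have "\<dots> = pairing e (G m) As"
      using multimaps_expand[OF \<phi> m(1), of "[]" As ps] that \<open>set As \<subseteq> forms\<close> by (simp add: G_def[abs_def])
    also have "\<dots> = pairing e (\<lambda>cs. (xmult m ^^ k) (F cs)) As"
      using that(1) FG by (intro pairing_cong) simp
    finally show "(xmult m ^^ k) (\<phi> As) = (xmult m ^^ k) (pairing e F As)"
      by (simp add: pairing_xmult)
  qed
  have degs: "list_all2 form_degree (map coord_degree cs) (map (?Xd m) cs)" for cs
    by (auto simp: list_all2_conv_all_nth intro!: form_degree_xform form_degree_dform)
  have "F \<in> coeff_families N k e"
    unfolding coeff_families_def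
  proof (intro CollectI conjI allI impI alt Fmvs)
    fix cs :: "('n + 'n) list"
    assume "length cs \<noteq> k"
    then show "F cs = 0" by (simp add: F_def)
  next
    fix cs :: "('n + 'n) list"
    assume len: "length cs = k"
    have "mv_degree (e + deg_sum (map coord_degree cs) + 1) (G m cs)"
      unfolding G_def using len Xd[OF m(1)] by (intro multimaps_degree[OF \<phi>] degs) auto
    moreover have "deg_sum (map coord_degree cs) = sum_list (map gam cs)"
      by (induction cs) (auto simp: gam_def)
    ultimately have "mv_degree (e + 1 + sum_list (map gam cs)) ((xmult m ^^ k) (F cs))"
      using len by (simp add: FG add_ac)
    then show "mv_degree (e + 1 + sum_list (map gam cs)) (F cs)"
      by (rule mv_degree_xmult_cancel[OF Fmvs])
  next
    fix cs :: "('n + 'n) list"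
    assume normal: "\<forall>c\<in>set cs. \<not> tangential N c"
    show "F cs \<in> adapted N"
    proof (cases "length cs = k")
      case True
      \<comment> \<open>Differentials of normal coordinates are adapted, so here F is itself a value
        of the cochain.\<close>
      have "set (map dform cs) \<subseteq> adapted_forms N"
        using normal dform_forms by (auto simp: adapted_forms_iff) (auto simp: dform_def)
      moreover have "list_all2 form_degree (map coord_degree cs) (map dform cs)"
        by (auto simp: list_all2_conv_all_nth intro!: form_degree_dform)
      ultimately have "\<phi> (map dform cs) = F cs"
        using ev[of "map dform cs"] True by (simp add: pairing_dform)
      then show ?thesis using multimaps_adapted[OF \<phi>] by metis
    qed (simp add: F_def)
  qed
  moreover have "\<phi> = cochain_of N k e F"
  proof (rule multimaps_eqI[OF \<phi> cochain_of_multimaps[OF \<open>F \<in> coeff_families N k e\<close>]])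
    fix As :: "('n, 'k) form list" and ps assume "length As = k" "set As \<subseteq> adapted_forms N" "list_all2 form_degree ps As"
    then show "\<phi> As = cochain_of N k e F As"
      by (simp only: ev cochain_of_pairing[OF \<open>F \<in> coeff_families N k e\<close>])
  qed
  ultimately show ?thesis by blast
qed

text \<open>On the forms x_m dc the cochain takes the value x_m^k F, and x_m cancels.\<close>

lemma cochain_of_eq_0:
  assumes "F \<in> coeff_families N k e" "cochain_of N k e F = 0" "m \<in> N"
  shows "F cs = 0"
proof (cases "length cs = k")
  case True
  let ?As = "map (\<lambda>c. fmult (coord (Inl m)) (dform c)) cs"
  have "set ?As \<subseteq> adapted_forms N" using assms(3) by (auto intro!: xform_adapted)
  then have "(xmult m ^^ k) (F cs) = 0"
    using cochain_of_pairing[OF assms(1), of ?As] pairing_xform[of e F m cs] True assms(2) by (simp add: fun_ops)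
  moreover have "(xmult m ^^ k) 0 = 0" by (induction k) auto
  ultimately have "(xmult m ^^ k) (F cs) = (xmult m ^^ k) 0" by simp
  then show ?thesis by (rule xmult_inj[OF coeff_familiesD(2)[OF assms(1)] mvs_0])
qed (use coeff_familiesD(3)[OF assms(1)] in auto)

section \<open>The homotopy\<close>

text \<open>The form acting as the Euler vector field \<open>\<Sum>\<^sub>i x\<^sub>i \<partial>/\<partial>x\<^sub>i + y\<^sub>i \<partial>/\<partial>y\<^sub>i\<close>; the minus sign comes
  from \<open>[x\<^sub>i, _] = - \<partial>/\<partial>y\<^sub>i\<close>.\<close>
definition euler :: "('n::{finite,linorder}, 'k::real_normed_field) form" where
  "euler c = (case c of Inl i \<Rightarrow> - coord (Inr i) | Inr i \<Rightarrow> coord (Inl i))"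

lemma euler_forms: "euler \<in> forms"
  by (auto simp: forms_def euler_def mvs_coord mvs_uminus split: sum.split)

lemma form_degree_euler: "form_degree 1 euler"
proof -
  have "mv_degree 1 (- coord (Inr i))" for i
    using mv_degree_coord[of "Inr i"] by (intro mv_degree_uminus) (simp add: coord_degree_def)
  then show ?thesis by (auto simp: form_degree_iff euler_def mv_degree_x split: sum.split)
qed

text \<open>\<open>euler c\<close> is, up to sign, the coordinate conjugate to \<open>c\<close>, and
  its sign is the one that makes this bracket 1.\<close>

lemma dc_euler: "dc b (euler c) = (if b = c then unit_mv else (0 :: ('n::{finite,linorder}, 'k::real_normed_field) mv))"
proof -
  have Y: "dY_left i (coord (Inr j)) = (if i = j then unit_mv else (0 :: ('n, 'k) mv))" for i j
    by (intro ext) (auto simp: dY_left_eq coord_def unit_mv_def fun_ops)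
  have X: "dY_left i (coord (Inl j)) = (0 :: ('n, 'k) mv)" for i j
    by (intro ext) (auto simp: dY_left_eq coord_def fun_ops)
  show ?thesis
  proof (cases b; cases c)
    fix i j assume "b = Inl i" "c = Inl j"
    then show ?thesis by (simp add: euler_def dc_uminus mvs_coord) (simp add: dc_Inl Y)
  next
    fix i j assume "b = Inl i" "c = Inr j"
    then show ?thesis by (simp add: euler_def dc_Inl X)
  next
    fix i j assume "b = Inr i" "c = Inl j"
    then show ?thesis by (simp add: euler_def dc_uminus mvs_coord) (simp add: dc_Inr dX_coord_Inr)
  next
    fix i j assume "b = Inr i" "c = Inr j"
    then show ?thesis by (simp add: euler_def dc_Inr dX_coord_Inl)
  qed
qed

lemma sg_euler: "sg e (euler c) = koszul (e * gam c) (euler c)"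
  using sg_homogeneous[OF form_degree_mv_degree[OF form_degree_euler], of e c]
  by simp (rule trans, assumption, rule koszul_parity, simp)

text \<open>Contraction of the first slot with the Euler field, whose shifted degree is 0, so that
  the internal degree \<open>e\<close> is kept.\<close>

definition iota :: "int \<Rightarrow> (('n::{finite,linorder} + 'n) list \<Rightarrow> ('n, 'k::real_normed_field) mv) \<Rightarrow> ('n + 'n) list \<Rightarrow> ('n, 'k) mv" where
  "iota e F cs = hsum e euler (\<lambda>c. F (c # cs))"

lemma mvs_iota: "(\<And>cs. F cs \<in> mvs) \<Longrightarrow> iota e F cs \<in> mvs"
  unfolding iota_def by (rule mvs_hsum) (auto simp: euler_forms)

lemma hsum_shift:
  "hsum (e + x) euler g = hsum e euler (\<lambda>c. koszul (x * gam c) (g c))"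
  by (simp add: hsum_def sg_euler wedge_koszul_left wedge_koszul_right algebra_simps)

lemma iota_Cons:
  assumes "alternating F"
  shows "iota e F (b # cs) = - iota (e + gam b) (\<lambda>cs. F (b # cs)) cs"
proof -
  have "F (c # b # cs) = - koszul (gam b * gam c) (F (b # c # cs))" for c
    using alternatingD[OF assms, of "[]" c b cs] by (simp add: mult.commute)
  then show ?thesis by (simp add: iota_def hsum_shift hsum_uminus)
qed

text \<open>Cartan's formula. Since every coordinate has weight 1, the Lie derivative adds one copy
  of \<open>F cs\<close> per slot to the action on the value.\<close>

lemma cartan:
  fixes F :: "('n::{finite,linorder} + 'n) list \<Rightarrow> ('n, 'k::real_normed_field) mv"
  assumes "alternating F" "\<And>cs. F cs \<in> mvs"
  shows "dif e (iota e F) cs + iota e (dif e F) cs = act euler (F cs) + (\<Sum>i<length cs. F cs)"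
  using assms
proof (induction cs arbitrary: e F)
  case Nil
  have "iota e (dif e F) [] = act euler (F [])"
    by (simp add: iota_def dif_Cons hsum_homogeneous[OF form_degree_euler] act_def)
      (simp add: koszul_def)
  then show ?case by simp
next
  case (Cons b cs)
  let ?Fb = "\<lambda>cs. F (b # cs)" and ?e = "e + gam b"
  note F = Cons.prems(2)
  have 1: "dif e (iota e F) (b # cs) = koszul (gam b * e) (dc b (iota e F cs)) + dif ?e (iota ?e ?Fb) cs"
    using F by (simp add: dif_Cons iota_Cons[OF Cons.prems(1)] dif_uminus mvs_iota)
  have "iota e (dif e F) (b # cs) = - iota ?e (\<lambda>cs. dif e F (b # cs)) cs"
    by (rule iota_Cons) (intro alternating_dif Cons.prems)
  then have 2: "iota e (dif e F) (b # cs) = iota ?e (dif ?e ?Fb) cs - koszul (gam b * e) (hsum ?e euler (\<lambda>c. dc b (F (c # cs))))"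
    by (simp add: iota_def dif_Cons hsum_diff hsum_koszul)
  \<comment> \<open>In the first summand \<open>dc b\<close> has hit the coefficient
    \<open>euler b\<close>: this is the copy of F contributed by the slot \<open>b\<close>.\<close>
  have 3: "dc b (iota e F cs) = koszul (gam b * e) (F (b # cs)) + hsum ?e euler (\<lambda>c. dc b (F (c # cs)))"
  proof -
    have E: "(euler c :: ('n, 'k) mv) \<in> mvs" for c by (rule formsD[OF euler_forms])
    have "dc b (wedge (sg e (euler c)) (F (c # cs))) = (if c = b then koszul (gam b * e) (F (b # cs)) else 0)
      + wedge (sg ?e (euler c)) (dc b (F (c # cs)))" for c
      using F E
      by (simp add: dc_wedge mvs_sg dc_sg dc_euler sg_sg add.commute wedge_koszul_left)
    then show ?thesis
      using F E
      by (simp add: iota_def hsum_def dc_sum mvs_wedge mvs_sg sum.distrib)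
  qed
  have "koszul (gam b * e) (koszul (gam b * e) (F (b # cs))) = F (b # cs)"
    unfolding koszul_koszul by (simp add: koszul_def)
  with 3 have 4: "koszul (gam b * e) (dc b (iota e F cs)) = F (b # cs) + koszul (gam b * e) (hsum ?e euler (\<lambda>c. dc b (F (c # cs))))"
    by (simp only: koszul_add)
  have "dif ?e (iota ?e ?Fb) cs + iota ?e (dif ?e ?Fb) cs = act euler (F (b # cs)) + (\<Sum>i<length cs. F (b # cs))"
    using F by (intro Cons.IH alternating_Cons Cons.prems)
  then show ?case
    unfolding 1 2 4 by (simp add: algebra_simps)
qed

section \<open>Inverting the Lie derivative along the Euler field\<close>

lemma act_euler:
  fixes \<xi> :: "('n::{finite,linorder}, 'k::real_normed_field) mv"
  assumes "\<xi> \<in> mvs"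
  shows "act euler \<xi> I x = (\<Sum>i\<in>UNIV. of_real (x $ i) * pd i (\<xi> I) x) + of_nat (card I) * \<xi> I x"
proof -
  have UN: "(UNIV :: ('n + 'n) set) = range Inl \<union> range Inr"
    using UNIV_sum by auto
  have Y: "wedge (coord (Inr i)) (dY_left i \<xi>) I = (if i \<in> I then \<xi> I else 0)" for i
  proof -
    have "wedge (coord (Inr i)) (dY_left i \<xi>) I = (\<Sum>J\<in>Pow I. if J = {i} then
       koszul (inversions {i} (I - {i})) (dY_left i \<xi> (I - {i})) else 0)"
      unfolding wedge_eq by (intro sum.cong) (auto simp: coord_def fun_eq_iff fun_ops koszul_def)
    then show ?thesis
      by (auto simp: dY_left_eq insert_absorb) (simp add: koszul_def)
  qed
  have "act euler \<xi> = (\<Sum>i\<in>UNIV. wedge (euler (Inl i)) (dc (Inl i) \<xi>)) + (\<Sum>i\<in>UNIV. wedge (euler (Inr i)) (dc (Inr i) \<xi>))"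
    unfolding act_def UN by (subst sum.union_disjoint) (auto simp: sum.reindex)
  also have "\<dots> = (\<Sum>i\<in>UNIV. wedge (coord (Inr i)) (dY_left i \<xi>)) + (\<Sum>i\<in>UNIV. xmult i (dX i \<xi>))"
    by (simp add: euler_def dc_Inl dc_Inr wedge_uminus_left wedge_uminus_right)
  finally have "act euler \<xi> I x = (\<Sum>i\<in>UNIV. (if i \<in> I then \<xi> I else 0) x) + (\<Sum>i\<in>UNIV. of_real (x $ i) * pd i (\<xi> I) x)"
    by (simp add: fun_ops sum_fun_apply Y xmult_apply dX_def)
  moreover have "(\<Sum>i\<in>UNIV. (if i \<in> I then \<xi> I else 0) x) = (\<Sum>i\<in>UNIV. if i \<in> I then \<xi> I x else 0)"
    by (intro sum.cong) (auto simp: fun_ops)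
  ultimately show ?thesis by (simp add: sum.If_cases add.commute)
qed

text \<open>On the component \<open>I\<close> of a value with \<open>k\<close> slots the Lie
  derivative is the Euler operator in x plus \<open>k + card I\<close>; for positive
  \<open>k\<close> this is its inverse.\<close>

definition average :: "nat \<Rightarrow> ('n::finite, 'k::{real_normed_field,banach}) mv \<Rightarrow> ('n, 'k) mv" where
  "average k \<xi> = (\<lambda>I. avg UNIV (k + card I - 1) (\<xi> I))"

lemma mvs_average: "\<xi> \<in> mvs \<Longrightarrow> average k \<xi> \<in> mvs"
  by (auto simp: mvs_def average_def intro: smooth_avg)

lemma average_0 [simp]: "average k 0 = 0"
  by (intro ext) (simp add: average_def fun_ops)

lemma average_diff: "\<xi> \<in> mvs \<Longrightarrow> \<eta> \<in> mvs \<Longrightarrow> average k (\<xi> - \<eta>) = average k \<xi> - average k \<eta>"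
  by (intro ext) (simp add: average_def fun_ops(5) avg_diff mvsD)

lemma avg_koszul: "avg S n (koszul m f) = koszul m (avg S n f)"
  by (simp add: koszul_def avg_uminus)

lemma average_koszul: "average k (koszul m \<xi>) = koszul m (average k \<xi>)"
  by (intro ext) (simp add: average_def fun_ops(7) avg_koszul)

lemma average_uminus: "average k (- \<xi>) = - average k \<xi>"
  using average_koszul[of k 1 \<xi>] by (simp add: koszul_def)

lemma mv_degree_average: "mv_degree n \<xi> \<Longrightarrow> mv_degree n (average k \<xi>)"
  unfolding mv_degree_def
proof (intro allI impI)
  fix I assume "\<forall>I. \<xi> I \<noteq> 0 \<longrightarrow> int (card I) = n" "average k \<xi> I \<noteq> 0"
  moreover from this(2) have "\<xi> I \<noteq> 0" by (auto simp: average_def)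
  ultimately show "int (card I) = n" by blast
qed

lemma average_adapted:
  fixes \<xi> :: "('n::finite, 'k::{real_normed_field,banach}) mv"
  assumes "\<xi> \<in> adapted N"
  shows "average k \<xi> \<in> adapted N"
proof -
  have "dilate UNIV t x \<in> submfd N" if "x \<in> submfd N" for t and x :: "(real, 'n) vec"
    using that by (simp add: submfd_def dilate_def)
  with assms show ?thesis
    by (simp add: adapted_iff mvs_average) (simp add: average_def avg_def)
qed

text \<open>A derivative lowers the weight of a coefficient by one and the new slot raises
  \<open>k\<close> by one, so the total weight is unchanged. \<open>0 < k\<close> keeps the
  subtraction in the exponent exact when \<open>I\<close> is empty.\<close>

lemma dc_average:
  fixes \<xi> :: "('n::{finite,linorder}, 'k::{real_normed_field,banach}) mv"
  assumes "\<xi> \<in> mvs" "0 < k"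
  shows "dc c (average k \<xi>) = average (Suc k) (dc c \<xi>)"
proof (cases c)
  case (Inl i)
  have "dY_left i (average k \<xi>) = average (Suc k) (dY_left i \<xi>)"
    by (intro ext) (simp add: dY_left_eq average_def fun_ops(7) avg_koszul fun_ops(2))
  then show ?thesis by (simp add: Inl dc_Inl average_uminus)
next
  case (Inr i)
  have "Suc (k + card I - 1) = Suc k + card I - 1" for I :: "'n set" using assms(2) by simp
  then show ?thesis
    using assms(1) by (intro ext) (simp add: Inr dc_Inr dX_def average_def pd_avg mvsD)
qed

lemma dif_average:
  assumes "\<And>cs. F cs \<in> mvs" "0 < k"
  shows "dif e (\<lambda>cs. average k (F cs)) cs = average (Suc k) (dif e F cs)"
  using assms(1)
proof (induction cs arbitrary: e F)
  case (Cons c cs)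
  then show ?case
    using assms(2)
    by (simp add: dif_Cons dc_average average_diff average_koszul mvs_koszul mvs_dc mvs_dif)
qed simp

text \<open>This is \<open>avg_ftc\<close> with weight \<open>k + card I\<close>, which is positive,
  so the boundary term at t = 0 vanishes.\<close>

lemma average_euler:
  fixes \<xi> :: "('n::{finite,linorder}, 'k::{real_normed_field,banach}) mv"
  assumes "\<xi> \<in> mvs" "0 < k"
  shows "act euler (average k \<xi>) + (\<Sum>i<k. average k \<xi>) = \<xi>"
proof (intro ext)
  fix I :: "'n set" and x :: "(real, 'n) vec"
  define w where "w = k + card I"
  have w: "0 < w" "Suc (w - 1) = w" using assms(2) by (simp_all add: w_def)
  have "\<xi> I x = of_nat w * avg UNIV (w - 1) (\<xi> I) x + (\<Sum>i\<in>UNIV. of_real (x $ i) * avg UNIV w (pd i (\<xi> I)) x)"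
    using avg_ftc[OF mvsD[OF assms(1)], of I x w UNIV] w by (simp add: scaleR_conv_of_real zero_power)
  moreover have "pd i (average k \<xi> I) = avg UNIV w (pd i (\<xi> I))" for i
    using assms(1) w by (simp add: average_def pd_avg mvsD w_def[symmetric])
  ultimately show "(act euler (average k \<xi>) + (\<Sum>i<k. average k \<xi>)) I x = \<xi> I x"
    using assms(1)
    by (simp add: fun_ops sum_fun_apply act_euler mvs_average del: sum_constant)
      (simp add: average_def w_def algebra_simps)
qed

text \<open>Averaging commutes with \<open>dif\<close> up to a shift of \<open>k\<close>, so the
  average of F is closed too, and Cartan's formula turns its contraction into a primitive of
  F.\<close>

lemma dif_exact:
  fixes F :: "('n::{finite,linorder} + 'n) list \<Rightarrow> ('n, 'k::{real_normed_field,banach}) mv"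
  assumes F: "F \<in> coeff_families N (Suc (Suc k)) e" and closed: "\<And>cs. dif e F cs = 0"
  shows "\<exists>G\<in>coeff_families N (Suc k) e. \<forall>cs. dif e G cs = F cs"
proof
  let ?P = "\<lambda>cs. average (Suc (Suc k)) (F cs)"
  define G where "G = iota e ?P"
  note D = coeff_familiesD[OF F]
  have P: "?P cs \<in> mvs" for cs using D(2) by (rule mvs_average)
  have alt: "alternating ?P"
    unfolding alternating_def
  proof (intro allI)
    fix us a b vs
    show "?P (us @ a # b # vs) = - koszul (gam a * gam b) (?P (us @ b # a # vs))"
      unfolding alternatingD[OF D(1), of us a b vs] average_uminus average_koszul ..
  qed
  have "dif e ?P cs = 0" for cs
    using closed dif_average[OF D(2)] by simp
  then have "iota e (dif e ?P) cs = 0" for cs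
    by (simp add: iota_def)
  then have "dif e G cs = act euler (?P cs) + (\<Sum>i<length cs. ?P cs)" for cs
    using cartan[OF alt P, of e cs] by (simp add: G_def)
  moreover have "act euler (?P cs) + (\<Sum>i<length cs. ?P cs) = F cs" for cs
  proof (cases "length cs = Suc (Suc k)")
    case True
    then show ?thesis using average_euler[OF D(2), of "Suc (Suc k)" cs] by simp
  next
    \<comment> \<open>At other lengths the averaging weight does not match the number of slots, but
      F vanishes there.\<close>
    case False
    then have "F cs = 0" by (rule D(3))
    then show ?thesis by simp
  qed
  ultimately show "\<forall>cs. dif e G cs = F cs" by simp
  show "G \<in> coeff_families N (Suc k) e"
    unfolding coeff_families_def
  proof (intro CollectI conjI allI impI)
    show "alternating G"
      unfolding alternating_def
    proof (intro allI)
      fix us a b vs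
      have "?P (c # us @ a # b # vs) = - koszul (gam a * gam b) (?P (c # us @ b # a # vs))" for c
        using alternatingD[OF alt, of "c # us" a b vs] by simp
      then show "G (us @ a # b # vs) = - koszul (gam a * gam b) (G (us @ b # a # vs))"
        unfolding G_def iota_def by (simp only: hsum_uminus hsum_koszul)
    qed
    show "G cs \<in> mvs" for cs unfolding G_def using P by (rule mvs_iota)
    show "G cs = 0" if "length cs \<noteq> Suc k" for cs
      using D(3) that by (simp add: G_def iota_def)
    show "mv_degree (e + 1 + sum_list (map gam cs)) (G cs)" if "length cs = Suc k" for cs
    proof -
      have "mv_degree (e + 1 + sum_list (map gam cs) + gam c) (?P (c # cs))" for c
        using D(4)[of "c # cs"] that by (intro mv_degree_average) (simp add: add_ac)
      then have "mv_degree (e + 1 + sum_list (map gam cs) + (1 - 1)) (G cs)"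
        unfolding G_def iota_def by (rule mv_degree_hsum[OF form_degree_euler])
      then show ?thesis by simp
    qed
    show "G cs \<in> adapted N" if "\<forall>c\<in>set cs. \<not> tangential N c" for cs
      unfolding G_def iota_def hsum_def
    proof (rule adapted_sum)
      fix c :: "'n + 'n"
      \<comment> \<open>The Euler field is tangent to the subspace: for tangential \<open>c\<close>
        its coefficient is y' or x'' up to sign, hence in the ideal. For normal \<open>c\<close> the
        word stays normal and the value lies in the ideal.\<close>
      show "wedge (sg e (euler c)) (?P (c # cs)) \<in> adapted N"
      proof (cases "tangential N c")
        case True
        then have "euler c \<in> adapted N"
          by (cases c) (auto simp: tangential_def euler_def intro!: adapted_uminus adapted_coord)
        then show ?thesis using P by (intro adapted_wedge_left adapted_sg)
      next
        case False
        then have "?P (c # cs) \<in> adapted N"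
          using that D(5) by (intro average_adapted) auto
        then show ?thesis using formsD[OF euler_forms] by (intro adapted_wedge_right mvs_sg)
      qed
    qed
  qed
qed

section \<open>Cohomology\<close>

lemma coeff_families_0: "(\<lambda>cs. 0) \<in> coeff_families N k e"
  by (simp add: coeff_families_def alternating_def)

lemma multimaps_0: "0 \<in> multimaps N k e"
proof -
  have "cochain_of N k e (\<lambda>cs. 0) = 0"
    by (intro ext) (simp add: cochain_of_def pairing_0 fun_ops)
  then show ?thesis using cochain_of_multimaps[OF coeff_families_0] by metis
qed

lemma coeff_families_diff:
  fixes F G :: "('n::{finite,linorder} + 'n) list \<Rightarrow> ('n, 'k::real_normed_field) mv"
  assumes "F \<in> coeff_families N k e" "G \<in> coeff_families N k e"
  shows "(\<lambda>cs. F cs - G cs) \<in> coeff_families N k e"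
proof -
  note F = coeff_familiesD[OF assms(1)] and G = coeff_familiesD[OF assms(2)]
  have "alternating (\<lambda>cs. F cs - G cs)"
    unfolding alternating_def
  proof (intro allI)
    fix us a b vs
    show "F (us @ a # b # vs) - G (us @ a # b # vs) = - koszul (gam a * gam b) (F (us @ b # a # vs) - G (us @ b # a # vs))"
      unfolding alternatingD[OF F(1), of us a b] alternatingD[OF G(1), of us a b] by (simp add: koszul_diff)
  qed
  moreover have "mv_degree n (\<xi> - \<eta>)" if "mv_degree n \<xi>" "mv_degree n \<eta>" for n and \<xi> \<eta> :: "('n, 'k) mv"
    using mv_degree_add[OF that(1) mv_degree_uminus[OF that(2)]] by simp
  ultimately show ?thesis
    using F G unfolding coeff_families_def by (auto intro: mvs_diff adapted_diff)
qed

lemma cochain_of_diff: "cochain_of N k e (\<lambda>cs. F cs - G cs) = cochain_of N k e F - cochain_of N k e G"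
  by (intro ext) (simp add: cochain_of_def pairing_diff fun_ops)

lemma CE_0: "CE N e 0 = 0"
  by (intro ext) (simp add: CE_def CE_hom_def fun_ops)

section \<open>The complex in the presence of two coordinates x''\<close>

context
  fixes N :: "'n::{finite,linorder} set" and m m'
  assumes m: "m \<in> N" "m' \<in> N" "m \<noteq> m'"
begin

lemma CE_multimaps:
  fixes \<phi> :: "('n, 'k::{real_normed_field,banach}) form list \<Rightarrow> ('n, 'k) mv"
  assumes "\<phi> \<in> multimaps N k e"
  shows "CE N e \<phi> \<in> multimaps N (Suc k) e" "CE N e (CE N e \<phi>) = 0"
proof -
  obtain F where F: "F \<in> coeff_families N k e" and \<phi>: "\<phi> = cochain_of N k e F"
    using multimaps_coeff_families[OF assms m] by blast
  note dF = dif_coeff_families[OF F]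
  have CE: "CE N e \<phi> = cochain_of N (Suc k) e (dif e F)"
    unfolding \<phi> by (rule CE_cochain_of[OF F dF])
  then show "CE N e \<phi> \<in> multimaps N (Suc k) e" by (simp add: cochain_of_multimaps dF)
  have "CE N e (CE N e \<phi>) = cochain_of N (Suc (Suc k)) e (dif e (dif e F))"
    unfolding CE by (rule CE_cochain_of[OF dF dif_coeff_families[OF dF]])
  also have "\<dots> = cochain_of N (Suc (Suc k)) e (\<lambda>cs. 0)"
    using dif_dif[OF coeff_familiesD(2)[OF F]] by presburger
  also have "\<dots> = 0" by (intro ext) (simp add: cochain_of_def pairing_0 fun_ops)
  finally show "CE N e (CE N e \<phi>) = 0" .
qed

lemma CE_diff:
  fixes \<phi> \<psi> :: "('n, 'k::{real_normed_field,banach}) form list \<Rightarrow> ('n, 'k) mv"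
  assumes "\<phi> \<in> multimaps N k e" "\<psi> \<in> multimaps N k e"
  shows "\<phi> - \<psi> \<in> multimaps N k e" "CE N e (\<phi> - \<psi>) = CE N e \<phi> - CE N e \<psi>"
proof -
  obtain F where F: "F \<in> coeff_families N k e" and \<phi>: "\<phi> = cochain_of N k e F"
    using multimaps_coeff_families[OF assms(1) m] by blast
  obtain G where G: "G \<in> coeff_families N k e" and \<psi>: "\<psi> = cochain_of N k e G"
    using multimaps_coeff_families[OF assms(2) m] by blast
  have eq: "\<phi> - \<psi> = cochain_of N k e (\<lambda>cs. F cs - G cs)"
    by (simp add: \<phi> \<psi> cochain_of_diff)
  note FG = coeff_families_diff[OF F G]
  show "\<phi> - \<psi> \<in> multimaps N k e" unfolding eq by (rule cochain_of_multimaps[OF FG])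
  have "dif e (\<lambda>cs. F cs - G cs) = (\<lambda>cs. dif e F cs - dif e G cs)"
    using coeff_familiesD(2)[OF F] coeff_familiesD(2)[OF G] by (intro ext dif_diff)
  then show "CE N e (\<phi> - \<psi>) = CE N e \<phi> - CE N e \<psi>"
    unfolding eq CE_cochain_of[OF FG dif_coeff_families[OF FG]]
    by (simp add: \<phi> \<psi> CE_cochain_of F G dif_coeff_families cochain_of_diff)
qed

lemma CE_exact:
  fixes \<phi> :: "('n, 'k::{real_normed_field,banach}) form list \<Rightarrow> ('n, 'k) mv"
  assumes "\<phi> \<in> multimaps N (Suc (Suc k)) e" "CE N e \<phi> = 0"
  shows "\<exists>\<psi>\<in>multimaps N (Suc k) e. CE N e \<psi> = \<phi>"
proof -
  obtain F where F: "F \<in> coeff_families N (Suc (Suc k)) e" and \<phi>: "\<phi> = cochain_of N (Suc (Suc k)) e F"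
    using multimaps_coeff_families[OF assms(1) m] by blast
  note dF = dif_coeff_families[OF F]
  have "cochain_of N (Suc (Suc (Suc k))) e (dif e F) = 0"
    using assms(2) unfolding \<phi> by (simp add: CE_cochain_of F dF)
  then have "dif e F cs = 0" for cs by (rule cochain_of_eq_0[OF dF _ m(1)])
  from dif_exact[OF F this] obtain G where G: "G \<in> coeff_families N (Suc k) e" "dif e G = F" by blast
  then have "CE N e (cochain_of N (Suc k) e G) = \<phi>"
    using CE_cochain_of[OF G(1) dif_coeff_families[OF G(1)]] \<phi> by simp
  with cochain_of_multimaps[OF G(1)] show ?thesis by blast
qed

lemma delta_cochains:
  fixes \<Phi> :: "('n, 'k::{real_normed_field,banach}) cochain"
  assumes "\<Phi> \<in> cochains N d"
  shows "delta N \<Phi> \<in> cochains N (Suc d)" "delta N (delta N \<Phi>) = 0"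
proof -
  have \<Phi>: "\<Phi> e \<in> multimaps N (Suc d) e" for e using assms by (simp add: cochains_def)
  have "{e. delta N \<Phi> e \<noteq> 0} \<subseteq> {e. \<Phi> e \<noteq> 0}"
    by (auto simp: delta_def CE_0)
  then have "finite {e. delta N \<Phi> e \<noteq> 0}"
    using assms finite_subset by (auto simp: cochains_def)
  with CE_multimaps(1)[OF \<Phi>] show "delta N \<Phi> \<in> cochains N (Suc d)"
    by (simp add: cochains_def delta_def)
  show "delta N (delta N \<Phi>) = 0"
    by (rule ext) (simp add: delta_def CE_multimaps(2)[OF \<Phi>] zero_fun_apply)
qed

lemma coboundaries_eq_cocycles:
  "(coboundaries N (Suc d) :: ('n, 'k::{real_normed_field,banach}) cochain set) = cocycles N (Suc d)"
proof (intro equalityI subsetI)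
  fix \<Phi> :: "('n, 'k) cochain"
  assume "\<Phi> \<in> coboundaries N (Suc d)"
  then show "\<Phi> \<in> cocycles N (Suc d)"
    using delta_cochains by (auto simp: coboundaries_def cocycles_def)
next
  fix \<Phi> :: "('n, 'k) cochain"
  assume \<Phi>: "\<Phi> \<in> cocycles N (Suc d)"
  \<comment> \<open>Where the cocycle vanishes the primitive is chosen to be 0, so that the
    primitives again involve only finitely many internal degrees.\<close>
  have "\<exists>\<psi>\<in>multimaps N (Suc d) e. CE N e \<psi> = \<Phi> e \<and> (\<Phi> e = 0 \<longrightarrow> \<psi> = 0)" for e
  proof (cases "\<Phi> e = 0")
    case True
    then show ?thesis using multimaps_0 CE_0 by (intro bexI[of _ 0]) auto
  next
    case False
    have "\<Phi> e \<in> multimaps N (Suc (Suc d)) e" using \<Phi> by (simp add: cocycles_def cochains_def)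
    moreover have "delta N \<Phi> e = 0 e" using \<Phi> by (simp add: cocycles_def)
    then have "CE N e (\<Phi> e) = 0" by (simp add: delta_def zero_fun_apply)
    ultimately show ?thesis using CE_exact False by blast
  qed
  then obtain \<Psi> where \<Psi>: "\<And>e. \<Psi> e \<in> multimaps N (Suc d) e" "\<And>e. CE N e (\<Psi> e) = \<Phi> e"
      "\<And>e. \<Phi> e = 0 \<Longrightarrow> \<Psi> e = 0"
    by metis
  have "{e. \<Psi> e \<noteq> 0} \<subseteq> {e. \<Phi> e \<noteq> 0}" using \<Psi>(3) by auto
  moreover have "finite {e. \<Phi> e \<noteq> 0}" using \<Phi> by (simp add: cocycles_def cochains_def)
  ultimately have "\<Psi> \<in> cochains N d"
    using \<Psi>(1) finite_subset by (auto simp: cochains_def)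
  moreover have "delta N \<Psi> = \<Phi>" by (rule ext) (simp add: delta_def \<Psi>(2))
  ultimately show "\<Phi> \<in> coboundaries N (Suc d)" by (auto simp: coboundaries_def)
qed

lemma cocycles_diff:
  fixes \<Phi> \<Psi> :: "('n, 'k::{real_normed_field,banach}) cochain"
  assumes "\<Phi> \<in> cocycles N d" "\<Psi> \<in> cocycles N d"
  shows "\<Phi> - \<Psi> \<in> cocycles N d"
proof -
  have mm: "\<Phi> e \<in> multimaps N (Suc d) e" "\<Psi> e \<in> multimaps N (Suc d) e" for e
    using assms by (simp_all add: cocycles_def cochains_def)
  have "delta N \<Phi> = 0" "delta N \<Psi> = 0"
    using assms by (simp_all only: cocycles_def mem_Collect_eq)
  from fun_cong[OF this(1)] fun_cong[OF this(2)]
  have 0: "CE N e (\<Phi> e) = 0" "CE N e (\<Psi> e) = 0" for e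
    by (simp_all only: delta_def zero_fun_apply)
  have "{e. (\<Phi> - \<Psi>) e \<noteq> 0} \<subseteq> {e. \<Phi> e \<noteq> 0} \<union> {e. \<Psi> e \<noteq> 0}" by (auto simp: minus_apply)
  moreover have "finite ({e. \<Phi> e \<noteq> 0} \<union> {e. \<Psi> e \<noteq> 0})"
    using assms by (simp add: cocycles_def cochains_def)
  ultimately have "finite {e. (\<Phi> - \<Psi>) e \<noteq> 0}" using finite_subset by blast
  moreover have "delta N (\<Phi> - \<Psi>) = 0"
    by (rule ext) (simp add: delta_def minus_apply CE_diff(2)[OF mm] 0 zero_fun_apply)
  ultimately show ?thesis
    using CE_diff(1)[OF mm] by (simp add: cocycles_def cochains_def minus_apply)
qed

lemma concentrated: "concentrated_in_degree_0 TYPE('k::{real_normed_field,banach}) N"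
  unfolding concentrated_in_degree_0_def
proof (intro allI impI)
  fix d :: nat assume "d \<noteq> 0"
  then obtain d' where d: "d = Suc d'" by (cases d) auto
  let ?B = "coboundaries N d :: ('n, 'k) cochain set" and ?Z = "cocycles N d :: ('n, 'k) cochain set"
  have BZ: "?B = ?Z" unfolding d by (rule coboundaries_eq_cocycles)
  \<comment> \<open>Without a cocycle the quotient would be empty instead of a single class.\<close>
  have "(0 :: ('n, 'k) cochain) \<in> ?Z"
  proof -
    have "delta N 0 = (0 :: ('n, 'k) cochain)" by (rule ext) (simp add: delta_def zero_fun_apply CE_0)
    then show ?thesis by (simp add: cocycles_def cochains_def zero_fun_apply multimaps_0)
  qed
  moreover have "{(\<Phi>, \<Psi>). \<Phi> \<in> ?Z \<and> \<Psi> \<in> ?Z \<and> \<Phi> - \<Psi> \<in> ?B} `` {\<Phi>} = ?B" if "\<Phi> \<in> ?Z" for \<Phi>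
    using that by (auto simp: BZ cocycles_diff)
  then have "cohomology N d = (\<Union>\<Phi>\<in>?Z. {?B})"
    unfolding cohomology_def quotient_def by (intro SUP_cong refl) simp
  ultimately show "(cohomology N d :: ('n, 'k) cochain set set) = {?B}" by blast
qed

end

theorem mainTheorem2:
  fixes N :: "'n::{finite,linorder} set" and l :: nat
  assumes "card N = l" and "l \<ge> 2"
  shows "concentrated_in_degree_0 TYPE(real) N \<and> concentrated_in_degree_0 TYPE(complex) N"
proof -
  from assms have "\<not> card N \<le> Suc 0" by simp
  then obtain m m' where "m \<in> N" "m' \<in> N" "m \<noteq> m'"
    by (auto simp: card_le_Suc0_iff_eq)
  then show ?thesis by (intro conjI concentrated)
qed

end
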